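(* Let $G$ be a countable sofic group with a sofic approximation sequence $\Sigma=\{\sigma_i:G\to\mathrm{Sym}(d_i)\}_{i=1}^\infty$, let $G$ act continuously on a compact metrizable space $X$ with a $G$-invariant Borel probability measure $\mu$, and let $\rho$ be a continuous pseudometric on $X$. Suppose that $\rho$ is dynamically generating, i.e. for any distinct points $x,y\in X$ one has $\rho(sx,sy)>0$ for some $s\in G$. Then $$h_{\Sigma,\mu}(X,G)=h_{\Sigma,\mu,2}(\rho)=h_{\Sigma,\mu,\infty}(\rho).$$
   Context: **Sofic approximation sequence.** $\mathrm{Sym}(d)$ is the permutation group of $\{1,\dots,d\}$. A sofic approximation sequence for a countable discrete group $G$ is a sequence of maps $\sigma_i: G\to\mathrm{Sym}(d_i)$, $s\mapsto\sigma_{i,s}$ (not necessarily homomorphisms), with $d_i\in\mathbb N$, $\lim_{i\to\infty} d_i=\infty$, such that $\lim_{i\to\infty}\frac1{d_i}|\{a:\sigma_{i,st}(a)=\sigma_{i,s}\sigma_{i,t}(a)\}|=1$ for all $s,t\in G$, and $\lim_{i\to\infty}\frac1{d_i}|\{a:\sigma_{i,s}(a)\ne\sigma_{i,t}(a)\}|=1$ for all distinct $s,t\in G$. **Separated sets.** For a pseudometric space $(Y,\rho)$ and $\varepsilon>0$, $N_\varepsilon(Y,\rho)$ is the maximal cardinality of a finite set $A\subseteq Y$ with $\rho(x,y)\ge\varepsilon$ for all distinct $x,y\in A$. **Sofic measure entropy $h_{\Sigma,\mu}(X,G)$.** Let $\alpha$ denote the action, and also the induced action on $C(X)$, $\alpha_s(f)(x)=f(s^{-1}x)$;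 write $\mu(f)=\int f\,d\mu$. For $\sigma:G\to\mathrm{Sym}(d)$ write also $\sigma_s(f)(a)=f(\sigma_s^{-1}(a))$ for $f\in\mathbb C^d=C(\{1,\dots,d\})$; $\zeta$ is the uniform probability measure on $\{1,\dots,d\}$, $\zeta(f)=\frac1d\sum_a f(a)$, and $\|f\|_2=(\frac1d\sum_a|f(a)|^2)^{1/2}$. Let $\mathcal S=\{p_n\}_{n=1}^\infty$ be a sequence in the unit ball of $C_{\mathbb R}(X)$. For unital homomorphisms $\varphi,\psi:C(X)\to\mathbb C^d$ set $\rho_{\mathcal S,2}(\varphi,\psi)=\sum_{n}2^{-n}\|\varphi(p_n)-\psi(p_n)\|_2$. For nonempty finite $F\subseteq G$ and $m\in\mathbb N$, $\mathcal S_{F,m}$ is the set of all products $\alpha_{s_1}(f_1)\cdots\alpha_{s_j}(f_j)$ with $1\le j\le m$, $f_1,\dots,f_j\in\{p_1,\dots,p_m\}$, $s_1,\dots,s_j\in F$. For $\delta>0$, $\mathrm{Hom}^X_\mu(\mathcal S,F,m,\delta,\sigma)$ is the set of unital homomorphisms $\varphi:C(X)\to\mathbb C^d$ with (i) $|\zeta\circ\varphi(f)-\mu(f)|<\delta$ for all $f\in\mathcal S_{F,m}$ and (ii) $\|\varphi\circ\alpha_s(f)-\sigma_s\circ\varphi(f)\|_2<\delta$ for all $s\in F$, $f\in\{p_1,\dots,p_m\}$. Define $$\bar h_{\Sigma,\mu}(\mathcal S)=\sup_{\varepsilon>0}\inf_F\inf_{m\in\mathbb N}\inf_{\delta>0}\limsup_{i\to\infty}\frac1{d_i}\log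 N_\varepsilon(\mathrm{Hom}^X_\mu(\mathcal S,F,m,\delta,\sigma_i),\rho_{\mathcal S,2}),$$ $F$ ranging over nonempty finite subsets of $G$, $\log 0=-\infty$. $\mathcal S$ is dynamically generating if it is not contained in any proper $G$-invariant unital $C^*$-subalgebra of $C(X)$. It is known that $\bar h_{\Sigma,\mu}(\mathcal S)$ is the same for all dynamically generating $\mathcal S$; $h_{\Sigma,\mu}(X,G)$ is this common value. **Spatial entropies.** For maps $\varphi,\psi:\{1,\dots,d\}\to X$ set $\rho_2(\varphi,\psi)=\big(\frac1d\sum_{a=1}^d\rho(\varphi(a),\psi(a))^2\big)^{1/2}$ and $\rho_\infty(\varphi,\psi)=\max_{1\le a\le d}\rho(\varphi(a),\psi(a))$. For nonempty finite $F\subseteq G$, finite $L\subseteq C(X)$, $\delta>0$ and $\sigma:G\to\mathrm{Sym}(d)$, $\mathrm{Map}_\mu(\rho,F,L,\delta,\sigma)$ is the set of maps $\varphi:\{1,\dots,d\}\to X$ with $\rho_2(\varphi\circ\sigma_s,\alpha_s\circ\varphi)<\delta$ for all $s\in F$ and $\big|\frac1d\sum_{a=1}^d f(\varphi(a))-\mu(f)\big|<\delta$ for all $f\in L$. For $\ast\in\{2,\infty\}$, $$h_{\Sigma,\mu,\ast}(\rho)=\sup_{\varepsilon>0}\inf_F\inf_L\inf_{\delta>0}\limsup_{i\to\infty}\frac1{d_i}\log N_\varepsilon(\mathrm{Map}_\mu(\rho,F,L,\delta,\sigma_i),\rho_\ast),$$ $F$ ranging over nonempty finite subsets of $G$ and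 $L$ over finite subsets of $C(X)$, $\log 0=-\infty$. (The set $\mathrm{Map}_\mu$ is defined with $\rho_2$ in both cases.) *)

theory Defs
  imports "HOL-Probability.Probability" "HOL-Algebra.Group_Action"
begin

text \<open>
  Sofic measure entropy of a continuous action of a countable group \<open>G\<close> on a compact
  metrizable space, which is a type \<open>'x\<close>.  A map \<open>\<sigma> : G \<rightarrow> Sym(d)\<close> is a function
  \<open>'g \<Rightarrow> nat \<Rightarrow> nat\<close> whose values permute \<open>{1..d}\<close>, and a sofic approximation sequence is
  given by the sequence \<open>d\<close> of degrees together with the sequence \<open>\<sigma>\<close> of maps.
\<close>

definition sofic_approx ::
  "('g, 'r) monoid_scheme \<Rightarrow> (nat \<Rightarrow> nat) \<Rightarrow> (nat \<Rightarrow> 'g \<Rightarrow> nat \<Rightarrow> nat) \<Rightarrow> bool" where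
  "sofic_approx G d \<sigma> \<longleftrightarrow>
     (\<forall>i. \<forall>s\<in>carrier G. \<sigma> i s permutes {1..d i}) \<and>
     filterlim d at_top sequentially \<and>
     (\<forall>s\<in>carrier G. \<forall>t\<in>carrier G.
        (\<lambda>i. real (card {a\<in>{1..d i}. \<sigma> i (s \<otimes>\<^bsub>G\<^esub> t) a = \<sigma> i s (\<sigma> i t a)}) / real (d i))
          \<longlonglongrightarrow> 1) \<and>
     (\<forall>s\<in>carrier G. \<forall>t\<in>carrier G. s \<noteq> t \<longrightarrow>
        (\<lambda>i. real (card {a\<in>{1..d i}. \<sigma> i s a \<noteq> \<sigma> i t a}) / real (d i)) \<longlonglongrightarrow> 1)"

definition continuous_action ::
  "('g, 'r) monoid_scheme \<Rightarrow> ('g \<Rightarrow> 'x \<Rightarrow> 'x::topological_space) \<Rightarrow> bool" where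
  "continuous_action G \<alpha> \<longleftrightarrow>
     group_action G UNIV \<alpha> \<and> (\<forall>s\<in>carrier G. continuous_on UNIV (\<alpha> s))"

definition invariant_borel_prob ::
  "('g, 'r) monoid_scheme \<Rightarrow> ('g \<Rightarrow> 'x \<Rightarrow> 'x::topological_space) \<Rightarrow> 'x measure \<Rightarrow> bool" where
  "invariant_borel_prob G \<alpha> \<mu> \<longleftrightarrow>
     sets \<mu> = sets borel \<and> prob_space \<mu> \<and>
     (\<forall>s\<in>carrier G. distr \<mu> borel (\<alpha> s) = \<mu>)"

definition continuous_pseudometric :: "('x::topological_space \<Rightarrow> 'x \<Rightarrow> real) \<Rightarrow> bool" where
  "continuous_pseudometric \<rho> \<longleftrightarrow>
     (\<forall>x y. 0 \<le> \<rho> x y) \<and> (\<forall>x. \<rho> x x = 0) \<and> (\<forall>x y. \<rho> x y = \<rho> y x) \<and>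
     (\<forall>x y z. \<rho> x z \<le> \<rho> x y + \<rho> y z) \<and>
     continuous_on UNIV (\<lambda>(x, y). \<rho> x y)"

definition dyn_generating_pseudometric ::
  "('g, 'r) monoid_scheme \<Rightarrow> ('g \<Rightarrow> 'x \<Rightarrow> 'x) \<Rightarrow> ('x \<Rightarrow> 'x \<Rightarrow> real) \<Rightarrow> bool" where
  "dyn_generating_pseudometric G \<alpha> \<rho> \<longleftrightarrow>
     (\<forall>x y. x \<noteq> y \<longrightarrow> (\<exists>s\<in>carrier G. \<rho> (\<alpha> s x) (\<alpha> s y) > 0))"

text \<open>
  Separation numbers take values in \<^typ>\<open>enat\<close>, so that unbounded cardinalities give \<open>\<infinity>\<close>
  and \<open>sep_num \<epsilon> {} r = 0\<close>.
\<close>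

definition sep_num :: "real \<Rightarrow> 'y set \<Rightarrow> ('y \<Rightarrow> 'y \<Rightarrow> real) \<Rightarrow> enat" where
  "sep_num \<epsilon> Y r =
     (SUP A\<in>{A. finite A \<and> A \<subseteq> Y \<and> (\<forall>x\<in>A. \<forall>y\<in>A. x \<noteq> y \<longrightarrow> \<epsilon> \<le> r x y)}. enat (card A))"

definition log_enat :: "enat \<Rightarrow> ereal" where
  "log_enat n = (case n of
       enat k \<Rightarrow> if k = 0 then - \<infinity> else ereal (ln (real k))
     | \<infinity> \<Rightarrow> \<infinity>)"

definition l2_norm :: "nat \<Rightarrow> (nat \<Rightarrow> complex) \<Rightarrow> real" where
  "l2_norm d f = sqrt ((\<Sum>a\<in>{1..d}. (cmod (f a))\<^sup>2) / real d)"

definition CX :: "('x::topological_space \<Rightarrow> complex) set" where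
  "CX = {f. continuous_on UNIV f}"

definition induced ::
  "('g, 'r) monoid_scheme \<Rightarrow> ('g \<Rightarrow> 'x \<Rightarrow> 'x) \<Rightarrow> 'g \<Rightarrow> ('x \<Rightarrow> complex) \<Rightarrow> 'x \<Rightarrow> complex" where
  "induced G \<alpha> s f = (\<lambda>x. f (\<alpha> (inv\<^bsub>G\<^esub> s) x))"

text \<open>
  Unital homomorphisms \<open>C(X) \<rightarrow> \<complex>\<^sup>d\<close>; both the maps and the vectors in \<open>\<complex>\<^sup>d\<close> are extensional
  functions, so that distinct elements of this set are distinct homomorphisms.
\<close>

definition unital_homs ::
  "nat \<Rightarrow> (('x::topological_space \<Rightarrow> complex) \<Rightarrow> nat \<Rightarrow> complex) set" where
  "unital_homs d = {\<phi> \<in> CX \<rightarrow>\<^sub>E ({1..d} \<rightarrow>\<^sub>E UNIV). \<forall>a\<in>{1..d}.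
     \<phi> (\<lambda>x. 1) a = 1 \<and>
     (\<forall>f\<in>CX. \<forall>c. \<phi> (\<lambda>x. c * f x) a = c * \<phi> f a) \<and>
     (\<forall>f\<in>CX. \<forall>g\<in>CX. \<phi> (\<lambda>x. f x + g x) a = \<phi> f a + \<phi> g a \<and>
                       \<phi> (\<lambda>x. f x * g x) a = \<phi> f a * \<phi> g a)}"

text \<open>
  Sequences \<open>\<S> = {p\<^sub>1, p\<^sub>2, \<dots>}\<close> in \<open>C(X)\<close> are indexed from 0 below, \<open>p n\<close> being the
  entry number \<open>n + 1\<close>; hence the weight \<open>(1/2) ^ Suc n\<close>, and \<open>p ` {..<m}\<close> is \<open>{p\<^sub>1, \<dots>, p\<^sub>m}\<close>.
\<close>

definition rho_S2 :: "nat \<Rightarrow> (nat \<Rightarrow> 'x \<Rightarrow> complex) \<Rightarrow>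
  (('x \<Rightarrow> complex) \<Rightarrow> nat \<Rightarrow> complex) \<Rightarrow> (('x \<Rightarrow> complex) \<Rightarrow> nat \<Rightarrow> complex) \<Rightarrow> real" where
  "rho_S2 d p \<phi> \<psi> = (\<Sum>n. (1/2) ^ Suc n * l2_norm d (\<lambda>a. \<phi> (p n) a - \<psi> (p n) a))"

definition S_products ::
  "('g, 'r) monoid_scheme \<Rightarrow> ('g \<Rightarrow> 'x \<Rightarrow> 'x) \<Rightarrow> (nat \<Rightarrow> 'x \<Rightarrow> complex) \<Rightarrow>
   'g set \<Rightarrow> nat \<Rightarrow> ('x \<Rightarrow> complex) set" where
  "S_products G \<alpha> p F m = {(\<lambda>x. \<Prod>k<j. induced G \<alpha> (s k) (f k) x) | j s f.
     1 \<le> j \<and> j \<le> m \<and> (\<forall>k<j. s k \<in> F \<and> f k \<in> p ` {..<m})}"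

definition Hom_mu ::
  "('g, 'r) monoid_scheme \<Rightarrow> ('g \<Rightarrow> 'x \<Rightarrow> 'x::topological_space) \<Rightarrow> 'x measure \<Rightarrow>
   (nat \<Rightarrow> 'x \<Rightarrow> complex) \<Rightarrow> 'g set \<Rightarrow> nat \<Rightarrow> real \<Rightarrow> nat \<Rightarrow> ('g \<Rightarrow> nat \<Rightarrow> nat) \<Rightarrow>
   (('x \<Rightarrow> complex) \<Rightarrow> nat \<Rightarrow> complex) set" where
  "Hom_mu G \<alpha> \<mu> p F m \<delta> d \<sigma> = {\<phi> \<in> unital_homs d.
     (\<forall>f\<in>S_products G \<alpha> p F m.
        cmod ((\<Sum>a\<in>{1..d}. \<phi> f a) / of_nat d - (\<integral>x. f x \<partial>\<mu>)) < \<delta>) \<and>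
     (\<forall>s\<in>F. \<forall>f\<in>p ` {..<m}.
        l2_norm d (\<lambda>a. \<phi> (induced G \<alpha> s f) a - \<phi> f (inv_into {1..d} (\<sigma> s) a)) < \<delta>)}"

definition h_bar ::
  "('g, 'r) monoid_scheme \<Rightarrow> ('g \<Rightarrow> 'x \<Rightarrow> 'x::topological_space) \<Rightarrow> 'x measure \<Rightarrow>
   (nat \<Rightarrow> nat) \<Rightarrow> (nat \<Rightarrow> 'g \<Rightarrow> nat \<Rightarrow> nat) \<Rightarrow> (nat \<Rightarrow> 'x \<Rightarrow> complex) \<Rightarrow> ereal" where
  "h_bar G \<alpha> \<mu> d \<sigma> p =
     (SUP \<epsilon>\<in>{0<..}. INF F\<in>{F. finite F \<and> F \<noteq> {} \<and> F \<subseteq> carrier G}. INF m\<in>{1..}. INF \<delta>\<in>{0<..}.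
        limsup (\<lambda>i. log_enat (sep_num \<epsilon> (Hom_mu G \<alpha> \<mu> p F m \<delta> (d i) (\<sigma> i)) (rho_S2 (d i) p))
                    / ereal (real (d i))))"

definition invariant_unital_subalgebra ::
  "('g, 'r) monoid_scheme \<Rightarrow> ('g \<Rightarrow> 'x \<Rightarrow> 'x::topological_space) \<Rightarrow>
   ('x \<Rightarrow> complex) set \<Rightarrow> bool" where
  "invariant_unital_subalgebra G \<alpha> A \<longleftrightarrow>
     A \<subseteq> CX \<and> (\<lambda>x. 1) \<in> A \<and>
     (\<forall>f\<in>A. \<forall>c. (\<lambda>x. c * f x) \<in> A) \<and>
     (\<forall>f\<in>A. \<forall>g\<in>A. (\<lambda>x. f x + g x) \<in> A \<and> (\<lambda>x. f x * g x) \<in> A) \<and>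
     (\<forall>f\<in>A. (\<lambda>x. cnj (f x)) \<in> A) \<and>
     (\<forall>u f. (\<forall>n. u n \<in> A) \<and> uniform_limit UNIV u f sequentially \<longrightarrow> f \<in> A) \<and>
     (\<forall>s\<in>carrier G. \<forall>f\<in>A. induced G \<alpha> s f \<in> A)"

definition dyn_generating_seq ::
  "('g, 'r) monoid_scheme \<Rightarrow> ('g \<Rightarrow> 'x \<Rightarrow> 'x::topological_space) \<Rightarrow>
   (nat \<Rightarrow> 'x \<Rightarrow> complex) \<Rightarrow> bool" where
  "dyn_generating_seq G \<alpha> p \<longleftrightarrow>
     (\<forall>n. p n \<in> CX \<and> (\<forall>x. p n x \<in> \<real> \<and> cmod (p n x) \<le> 1)) \<and>
     (\<forall>A. invariant_unital_subalgebra G \<alpha> A \<and> range p \<subseteq> A \<longrightarrow> A = CX)"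

text \<open>
  The common value of \<^const>\<open>h_bar\<close> over all dynamically generating sequences.  It is well defined
  because, for \<open>X\<close> compact metrizable, such sequences exist and \<^const>\<open>h_bar\<close> does not depend
  on the choice.
\<close>

definition sofic_measure_entropy ::
  "('g, 'r) monoid_scheme \<Rightarrow> ('g \<Rightarrow> 'x \<Rightarrow> 'x::topological_space) \<Rightarrow> 'x measure \<Rightarrow>
   (nat \<Rightarrow> nat) \<Rightarrow> (nat \<Rightarrow> 'g \<Rightarrow> nat \<Rightarrow> nat) \<Rightarrow> ereal" where
  "sofic_measure_entropy G \<alpha> \<mu> d \<sigma> =
     (THE h. \<forall>p. dyn_generating_seq G \<alpha> p \<longrightarrow> h_bar G \<alpha> \<mu> d \<sigma> p = h)"

definition rho_2 ::
  "('x \<Rightarrow> 'x \<Rightarrow> real) \<Rightarrow> nat \<Rightarrow> (nat \<Rightarrow> 'x) \<Rightarrow> (nat \<Rightarrow> 'x) \<Rightarrow> real" where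
  "rho_2 \<rho> d \<phi> \<psi> = sqrt ((\<Sum>a\<in>{1..d}. (\<rho> (\<phi> a) (\<psi> a))\<^sup>2) / real d)"

definition rho_inf ::
  "('x \<Rightarrow> 'x \<Rightarrow> real) \<Rightarrow> nat \<Rightarrow> (nat \<Rightarrow> 'x) \<Rightarrow> (nat \<Rightarrow> 'x) \<Rightarrow> real" where
  "rho_inf \<rho> d \<phi> \<psi> = Max ((\<lambda>a. \<rho> (\<phi> a) (\<psi> a)) ` {1..d})"

definition Map_mu ::
  "('g \<Rightarrow> 'x \<Rightarrow> 'x) \<Rightarrow> 'x measure \<Rightarrow> ('x \<Rightarrow> 'x \<Rightarrow> real) \<Rightarrow> 'g set \<Rightarrow> ('x \<Rightarrow> complex) set \<Rightarrow>
   real \<Rightarrow> nat \<Rightarrow> ('g \<Rightarrow> nat \<Rightarrow> nat) \<Rightarrow> (nat \<Rightarrow> 'x) set" where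
  "Map_mu \<alpha> \<mu> \<rho> F L \<delta> d \<sigma> = {\<phi> \<in> {1..d} \<rightarrow>\<^sub>E UNIV.
     (\<forall>s\<in>F. rho_2 \<rho> d (\<lambda>a. \<phi> (\<sigma> s a)) (\<lambda>a. \<alpha> s (\<phi> a)) < \<delta>) \<and>
     (\<forall>f\<in>L. cmod ((\<Sum>a\<in>{1..d}. f (\<phi> a)) / of_nat d - (\<integral>x. f x \<partial>\<mu>)) < \<delta>)}"

text \<open>The argument \<open>D\<close> is the pseudometric on maps used for separation.\<close>

definition h_spatial ::
  "('g, 'r) monoid_scheme \<Rightarrow> ('g \<Rightarrow> 'x \<Rightarrow> 'x::topological_space) \<Rightarrow> 'x measure \<Rightarrow>
   (nat \<Rightarrow> nat) \<Rightarrow> (nat \<Rightarrow> 'g \<Rightarrow> nat \<Rightarrow> nat) \<Rightarrow> ('x \<Rightarrow> 'x \<Rightarrow> real) \<Rightarrow>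
   (nat \<Rightarrow> (nat \<Rightarrow> 'x) \<Rightarrow> (nat \<Rightarrow> 'x) \<Rightarrow> real) \<Rightarrow> ereal" where
  "h_spatial G \<alpha> \<mu> d \<sigma> \<rho> D =
     (SUP \<epsilon>\<in>{0<..}. INF F\<in>{F. finite F \<and> F \<noteq> {} \<and> F \<subseteq> carrier G}.
        INF L\<in>{L. finite L \<and> L \<subseteq> CX}. INF \<delta>\<in>{0<..}.
        limsup (\<lambda>i. log_enat (sep_num \<epsilon> (Map_mu \<alpha> \<mu> \<rho> F L \<delta> (d i) (\<sigma> i)) (D (d i)))
                    / ereal (real (d i))))"

definition h_2 ::
  "('g, 'r) monoid_scheme \<Rightarrow> ('g \<Rightarrow> 'x \<Rightarrow> 'x::topological_space) \<Rightarrow> 'x measure \<Rightarrow>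
   (nat \<Rightarrow> nat) \<Rightarrow> (nat \<Rightarrow> 'g \<Rightarrow> nat \<Rightarrow> nat) \<Rightarrow> ('x \<Rightarrow> 'x \<Rightarrow> real) \<Rightarrow> ereal" where
  "h_2 G \<alpha> \<mu> d \<sigma> \<rho> = h_spatial G \<alpha> \<mu> d \<sigma> \<rho> (rho_2 \<rho>)"

definition h_inf ::
  "('g, 'r) monoid_scheme \<Rightarrow> ('g \<Rightarrow> 'x \<Rightarrow> 'x::topological_space) \<Rightarrow> 'x measure \<Rightarrow>
   (nat \<Rightarrow> nat) \<Rightarrow> (nat \<Rightarrow> 'g \<Rightarrow> nat \<Rightarrow> nat) \<Rightarrow> ('x \<Rightarrow> 'x \<Rightarrow> real) \<Rightarrow> ereal" where
  "h_inf G \<alpha> \<mu> d \<sigma> \<rho> = h_spatial G \<alpha> \<mu> d \<sigma> \<rho> (rho_inf \<rho>)"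

end

theory Submission
  imports Defs
begin

text \<open>
  All entropies are read as exponential growth rates of separated sets of maps \<open>{1..d} \<rightarrow> X\<close>: a unital
  homomorphism \<open>C(X) \<rightarrow> \<complex>\<^sup>d\<close> is evaluation along such a map, and \<open>\<S>\<close> induces the continuous
  pseudometric \<open>\<rho>\<^sub>\<S>(x, y) = \<Sum>\<^sub>n 2\<^sup>-\<^sup>n |p\<^sub>n(x) - p\<^sub>n(y)|\<close>, which is dynamically generating when \<open>\<S>\<close> is.
  Linear combinations of the products in \<open>\<S>\<^sub>F\<^sub>,\<^sub>m\<close> are dense in \<open>C(X)\<close>, so both descriptions
  control the same moments, and the entropy of \<open>\<S>\<close> is the 2-entropy of \<open>\<rho>\<^sub>\<S>\<close>.

  The 2-entropy does not depend on the dynamically generating pseudometric: by compactness of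
  \<open>X \<times> X\<close>, closeness of two points for \<open>\<rho>'\<close> follows from closeness of finitely many translates for
  \<open>\<rho>\<close>, and by approximate equivariance translates along an orbit of \<open>\<phi>\<close> may be replaced by the values
  of \<open>\<phi> \<circ> \<sigma>\<^sub>s\<close>, up to a small proportion of \<open>{1..d}\<close>.

  Finally, a map within small \<open>\<rho>\<^sub>2\<close>-distance of a given one is determined up to \<open>\<rho>\<^sub>\<infinity>\<close>-distance
  \<open>\<epsilon>\<close> by finitely many labels on a set of at most \<open>\<eta>d\<close> indices, and the number of such labellings
  is subexponential as \<open>\<eta> \<rightarrow> 0\<close>.
\<close>

section \<open>Separation numbers\<close>

text \<open>The entropies are defined through quadratic means, but a dynamically generating
  pseudometric separates points only along orbits, so closeness has to be followed index by index.
  Hence the passage back and forth between a small \<open>rms\<close> and a small proportion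
  \<open>few\<close> of exceptional indices: Chebyshev's inequality in one direction, boundedness of
  a pseudometric on a compact space in the other. Exceptional sets add up, survive permutations of
  the indices, and absorb the failure of \<sigma> to be a homomorphism. A second obstacle is one of
  conventions: homomorphisms involve \<open>\<alpha> (inv s)\<close> and the inverse of the
  permutation \<open>\<sigma> i s\<close>, maps involve \<open>\<alpha> s\<close> and
  \<open>\<sigma> i s\<close> itself. They meet because \<open>\<sigma> i (inv s)\<close> inverts
  \<open>\<sigma> i s\<close> at most indices. The common value in the definition of the entropy is
  not presupposed: the growth rate of every generating sequence is shown to equal the 2-entropy of
  the given \<rho>, which mentions no sequence.\<close>

definition separated :: "real \<Rightarrow> ('y \<Rightarrow> 'y \<Rightarrow> real) \<Rightarrow> 'y set \<Rightarrow> bool" where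
  "separated \<epsilon> D A \<longleftrightarrow> (\<forall>x\<in>A. \<forall>y\<in>A. x \<noteq> y \<longrightarrow> \<epsilon> \<le> D x y)"

lemma card_le_sep_num:
  "finite A \<Longrightarrow> A \<subseteq> Y \<Longrightarrow> separated \<epsilon> D A \<Longrightarrow> enat (card A) \<le> sep_num \<epsilon> Y D"
  unfolding sep_num_def separated_def by (intro SUP_upper) auto

lemma sep_num_le:
  assumes "\<And>A. finite A \<Longrightarrow> A \<subseteq> Y \<Longrightarrow> separated \<epsilon> D A \<Longrightarrow> enat (card A) \<le> n"
  shows "sep_num \<epsilon> Y D \<le> n"
  unfolding sep_num_def by (rule SUP_least) (use assms in \<open>auto simp: separated_def\<close>)

lemma sep_num_mono:
  assumes "Y' \<subseteq> Y" and "\<And>x y. x \<in> Y' \<Longrightarrow> y \<in> Y' \<Longrightarrow> \<epsilon> \<le> D' x y \<Longrightarrow> \<epsilon>' \<le> D x y"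
  shows "sep_num \<epsilon> Y' D' \<le> sep_num \<epsilon>' Y D"
proof (rule sep_num_le)
  fix A assume A: "finite A" "A \<subseteq> Y'" "separated \<epsilon> D' A"
  then have "separated \<epsilon>' D A"
    using assms(2) unfolding separated_def by blast
  then show "enat (card A) \<le> sep_num \<epsilon>' Y D"
    using A assms(1) by (intro card_le_sep_num) auto
qed

text \<open>Used with \<open>E = eval_hom d\<close> to count maps instead of homomorphisms.
  Injectivity of \<open>E\<close> is not assumed: points with equal images have distance below
  \<epsilon>, so a separated set never contains two of them.\<close>

lemma sep_num_image:
  assumes "0 < \<epsilon>" and "\<And>y. y \<in> Y \<Longrightarrow> D (E y) (E y) < \<epsilon>"
  shows "sep_num \<epsilon> (E ` Y) D = sep_num \<epsilon> Y (\<lambda>x y. D (E x) (E y))"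
proof (rule antisym)
  show "sep_num \<epsilon> (E ` Y) D \<le> sep_num \<epsilon> Y (\<lambda>x y. D (E x) (E y))"
  proof (rule sep_num_le)
    fix A assume A: "finite A" "A \<subseteq> E ` Y" "separated \<epsilon> D A"
    \<comment> \<open>One preimage for each point of \<open>A\<close>, so that distinct elements of
      \<open>B\<close> have distinct images.\<close>
    then obtain B where B: "B \<subseteq> Y" "finite B" "A = E ` B" "inj_on E B"
      by (metis finite_subset_image finite_imageD subset_image_inj)
    have "separated \<epsilon> (\<lambda>x y. D (E x) (E y)) B"
      using A(3) B(3,4) by (auto simp: separated_def inj_on_def)
    then show "enat (card A) \<le> sep_num \<epsilon> Y (\<lambda>x y. D (E x) (E y))"
      using card_le_sep_num[of B Y \<epsilon>] B by (simp add: card_image)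
  qed
  show "sep_num \<epsilon> Y (\<lambda>x y. D (E x) (E y)) \<le> sep_num \<epsilon> (E ` Y) D"
  proof (rule sep_num_le)
    fix A assume A: "finite A" "A \<subseteq> Y" "separated \<epsilon> (\<lambda>x y. D (E x) (E y)) A"
    have "inj_on E A"
    proof (rule inj_onI, rule ccontr)
      fix x y assume xy: "x \<in> A" "y \<in> A" "E x = E y" "x \<noteq> y"
      then have "\<epsilon> \<le> D (E x) (E x)" using A(3) unfolding separated_def by metis
      then show False using assms(2)[of x] xy A(2) by force
    qed
    moreover have "separated \<epsilon> D (E ` A)" using A(3) by (auto simp: separated_def)
    ultimately show "enat (card A) \<le> sep_num \<epsilon> (E ` Y) D"
      using card_le_sep_num[of "E ` A" "E ` Y" \<epsilon> D] A by (simp add: card_image image_mono)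
  qed
qed

text \<open>A finite supremum in \<open>enat\<close> is a maximum. The set of maximal size is wanted
  because it is also a net at scale \<epsilon>.\<close>

lemma sep_num_attained:
  assumes "sep_num \<epsilon> Y D = enat n"
  obtains B where "finite B" "B \<subseteq> Y" "separated \<epsilon> D B" "card B = n"
proof -
  let ?S = "{A. finite A \<and> A \<subseteq> Y \<and> separated \<epsilon> D A}"
  let ?C = "(\<lambda>A. enat (card A)) ` ?S"
  have eq: "sep_num \<epsilon> Y D = Sup ?C" by (simp add: sep_num_def separated_def)
  have ne: "?C \<noteq> {}" by (auto intro!: exI[of _ "{}"] simp: separated_def)
  have "finite ?C"
    by (rule finite_subset[of _ "enat ` {..n}"])
       (use card_le_sep_num[of _ Y \<epsilon> D] assms in force, simp)
  then have "Sup ?C \<in> ?C" using ne Max_in[of ?C] unfolding Sup_enat_def by presburger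
  then show ?thesis using that eq assms by auto
qed

section \<open>Comparison of growth rates\<close>

lemma log_enat_mono: "m \<le> n \<Longrightarrow> log_enat m \<le> log_enat n"
  unfolding log_enat_def by (cases m; cases n) auto

lemma ereal_divide_mono: "x \<le> y \<Longrightarrow> x / ereal (real n) \<le> y / ereal (real n)"
  unfolding divide_ereal_def by (rule ereal_mult_right_mono) (auto simp: ereal_inverse_nonneg_iff)

lemma INF3_le:
  assumes "\<And>F m \<delta>. F \<in> A \<Longrightarrow> m \<in> B \<Longrightarrow> \<delta> \<in> C \<Longrightarrow>
    \<exists>F'\<in>A'. \<exists>m'\<in>B'. \<exists>\<delta>'\<in>C'. f' F' m' \<delta>' \<le> (f F m \<delta> :: ereal)"
  shows "(INF F\<in>A'. INF m\<in>B'. INF \<delta>\<in>C'. f' F m \<delta>) \<le> (INF F\<in>A. INF m\<in>B. INF \<delta>\<in>C. f F m \<delta>)"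
proof (intro INF_greatest)
  fix F m \<delta> assume "F \<in> A" "m \<in> B" "\<delta> \<in> C"
  then obtain F' m' \<delta>' where k: "F' \<in> A'" "m' \<in> B'" "\<delta>' \<in> C'" "f' F' m' \<delta>' \<le> f F m \<delta>"
    using assms by blast
  show "(INF F\<in>A'. INF m\<in>B'. INF \<delta>\<in>C'. f' F m \<delta>) \<le> f F m \<delta>"
    by (intro INF_lower2[OF k(1)] INF_lower2[OF k(2)] INF_lower2[OF k(3)] k(4))
qed

text \<open>Serves every comparison of entropies that loses no exponential factor. The two parameter
  families have independent types because the middle parameter is a finite set of functions in one
  entropy and a natural number in another. The quantifiers follow the definition: \<epsilon>'
  depends on \<epsilon> alone, the primed parameters on all the others, and the inclusion is
  required only eventually, which is all that a limsup sees.\<close>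

lemma entropy_le:
  fixes Y :: "'k \<Rightarrow> 'l \<Rightarrow> 'm \<Rightarrow> nat \<Rightarrow> 'y set" and Y' :: "'k' \<Rightarrow> 'l' \<Rightarrow> 'm' \<Rightarrow> nat \<Rightarrow> 'y set"
  assumes "\<And>\<epsilon>. 0 < \<epsilon> \<Longrightarrow> \<exists>\<epsilon>'>0. \<forall>F\<in>A. \<forall>m\<in>B. \<forall>\<delta>\<in>C. \<exists>F'\<in>A'. \<exists>m'\<in>B'. \<exists>\<delta>'\<in>C'.
    \<forall>\<^sub>F i in sequentially. Y' F' m' \<delta>' i \<subseteq> Y F m \<delta> i \<and>
      (\<forall>x\<in>Y' F' m' \<delta>' i. \<forall>y\<in>Y' F' m' \<delta>' i. \<epsilon> \<le> D' i x y \<longrightarrow> \<epsilon>' \<le> D i x y)"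
  shows "(SUP \<epsilon>\<in>{0<..}. INF F\<in>A'. INF m\<in>B'. INF \<delta>\<in>C'.
            limsup (\<lambda>i. log_enat (sep_num \<epsilon> (Y' F m \<delta> i) (D' i)) / ereal (real (d i))))
       \<le> (SUP \<epsilon>\<in>{0<..}. INF F\<in>A. INF m\<in>B. INF \<delta>\<in>C.
            limsup (\<lambda>i. log_enat (sep_num \<epsilon> (Y F m \<delta> i) (D i)) / ereal (real (d i))))"
proof (rule SUP_least)
  fix \<epsilon> :: real assume "\<epsilon> \<in> {0<..}"
  then obtain \<epsilon>' where \<epsilon>': "\<epsilon>' > 0" and *: "\<forall>F\<in>A. \<forall>m\<in>B. \<forall>\<delta>\<in>C. \<exists>F'\<in>A'. \<exists>m'\<in>B'. \<exists>\<delta>'\<in>C'.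
    \<forall>\<^sub>F i in sequentially. Y' F' m' \<delta>' i \<subseteq> Y F m \<delta> i \<and>
      (\<forall>x\<in>Y' F' m' \<delta>' i. \<forall>y\<in>Y' F' m' \<delta>' i. \<epsilon> \<le> D' i x y \<longrightarrow> \<epsilon>' \<le> D i x y)"
    using assms[of \<epsilon>] by auto
  show "(INF F\<in>A'. INF m\<in>B'. INF \<delta>\<in>C'.
            limsup (\<lambda>i. log_enat (sep_num \<epsilon> (Y' F m \<delta> i) (D' i)) / ereal (real (d i))))
       \<le> (SUP \<epsilon>\<in>{0<..}. INF F\<in>A. INF m\<in>B. INF \<delta>\<in>C.
            limsup (\<lambda>i. log_enat (sep_num \<epsilon> (Y F m \<delta> i) (D i)) / ereal (real (d i))))"
  proof (rule SUP_upper2[of \<epsilon>'])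
    show "\<epsilon>' \<in> {0<..}" using \<epsilon>' by simp
    show "(INF F\<in>A'. INF m\<in>B'. INF \<delta>\<in>C'.
            limsup (\<lambda>i. log_enat (sep_num \<epsilon> (Y' F m \<delta> i) (D' i)) / ereal (real (d i))))
       \<le> (INF F\<in>A. INF m\<in>B. INF \<delta>\<in>C.
            limsup (\<lambda>i. log_enat (sep_num \<epsilon>' (Y F m \<delta> i) (D i)) / ereal (real (d i))))"
    proof (rule INF3_le)
      fix F m \<delta> assume "F \<in> A" "m \<in> B" "\<delta> \<in> C"
      then obtain F' m' \<delta>' where k: "F' \<in> A'" "m' \<in> B'" "\<delta>' \<in> C'"
        and ev: "\<forall>\<^sub>F i in sequentially. Y' F' m' \<delta>' i \<subseteq> Y F m \<delta> i \<and>
          (\<forall>x\<in>Y' F' m' \<delta>' i. \<forall>y\<in>Y' F' m' \<delta>' i. \<epsilon> \<le> D' i x y \<longrightarrow> \<epsilon>' \<le> D i x y)"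
        using * by meson
      have "limsup (\<lambda>i. log_enat (sep_num \<epsilon> (Y' F' m' \<delta>' i) (D' i)) / ereal (real (d i)))
          \<le> limsup (\<lambda>i. log_enat (sep_num \<epsilon>' (Y F m \<delta> i) (D i)) / ereal (real (d i)))"
        using ev
        by (intro Limsup_mono, elim eventually_mono)
           (intro ereal_divide_mono log_enat_mono sep_num_mono; blast)
      then show "\<exists>F'\<in>A'. \<exists>m'\<in>B'. \<exists>\<delta>'\<in>C'.
            limsup (\<lambda>i. log_enat (sep_num \<epsilon> (Y' F' m' \<delta>' i) (D' i)) / ereal (real (d i)))
          \<le> limsup (\<lambda>i. log_enat (sep_num \<epsilon>' (Y F m \<delta> i) (D i)) / ereal (real (d i)))"
        using k by blast
    qed
  qed
qed

section \<open>Means over \<open>{1..d}\<close>\<close>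

definition rms :: "nat \<Rightarrow> (nat \<Rightarrow> real) \<Rightarrow> real" where
  "rms d u = sqrt ((\<Sum>a\<in>{1..d}. (u a)\<^sup>2) / real d)"

text \<open>The bound on the proportion is multiplied out, so that it also holds for
  \<open>d = 0\<close>.\<close>

definition few :: "nat \<Rightarrow> real \<Rightarrow> (nat \<Rightarrow> bool) \<Rightarrow> bool" where
  "few d \<kappa> P \<longleftrightarrow> real (card {a\<in>{1..d}. P a}) \<le> \<kappa> * real d"

lemma rho_2_eq_rms: "rho_2 \<rho> d \<phi> \<psi> = rms d (\<lambda>a. \<rho> (\<phi> a) (\<psi> a))"
  by (simp add: rho_2_def rms_def)

lemma l2_norm_eq_rms: "l2_norm d f = rms d (\<lambda>a. cmod (f a))"
  by (simp add: l2_norm_def rms_def)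

lemma rms_nonneg: "0 \<le> rms d u"
  by (simp add: rms_def sum_nonneg)

text \<open>A scaled \<open>L2_set\<close>, which makes Minkowski's inequality available.\<close>

lemma rms_L2_set: "rms d u = L2_set u {1..d} / sqrt (real d)"
  by (simp add: rms_def L2_set_def real_sqrt_divide)

lemma rms_mono:
  assumes "\<And>a. a \<in> {1..d} \<Longrightarrow> 0 \<le> u a" "\<And>a. a \<in> {1..d} \<Longrightarrow> u a \<le> v a"
  shows "rms d u \<le> rms d v"
  unfolding rms_L2_set by (intro divide_right_mono L2_set_mono) (use assms in auto)

lemma rms_cong: "(\<And>a. a \<in> {1..d} \<Longrightarrow> u a = v a) \<Longrightarrow> rms d u = rms d v"
  by (simp add: rms_def)

lemma rms_add: "rms d (\<lambda>a. u a + v a) \<le> rms d u + rms d v"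
  unfolding rms_L2_set add_divide_distrib[symmetric]
  by (intro divide_right_mono L2_set_triangle_ineq) auto

lemma rms_scale: "0 \<le> c \<Longrightarrow> rms d (\<lambda>a. c * u a) = c * rms d u"
  unfolding rms_L2_set using L2_set_right_distrib[of c u "{1..d}"] by simp

text \<open>Only an inequality, because the mean over no indices is 0.\<close>

lemma rms_const_le: "0 \<le> c \<Longrightarrow> rms d (\<lambda>a. c) \<le> c"
  by (simp add: rms_def)

lemma rms_sum: "rms d (\<lambda>a. \<Sum>n<N. u n a) \<le> (\<Sum>n<(N::nat). rms d (u n))"
proof (induction N)
  case 0 show ?case by (simp add: rms_def)
next
  case (Suc N)
  then show ?case using rms_add[of d "\<lambda>a. \<Sum>n<N. u n a" "u N"] by simp
qed

lemma few_mono: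
  assumes "few d \<kappa> P" "\<And>a. a \<in> {1..d} \<Longrightarrow> Q a \<Longrightarrow> P a" "\<kappa> \<le> \<kappa>'"
  shows "few d \<kappa>' Q"
proof -
  have "card {a\<in>{1..d}. Q a} \<le> card {a\<in>{1..d}. P a}"
    by (rule card_mono) (use assms(2) in auto)
  moreover have "\<kappa> * real d \<le> \<kappa>' * real d" using assms(3) by (simp add: mult_right_mono)
  ultimately show ?thesis using assms(1) unfolding few_def by linarith
qed

lemma few_disj:
  assumes "few d \<kappa> P" "few d \<kappa>' Q" shows "few d (\<kappa> + \<kappa>') (\<lambda>a. P a \<or> Q a)"
proof -
  have "{a\<in>{1..d}. P a \<or> Q a} = {a\<in>{1..d}. P a} \<union> {a\<in>{1..d}. Q a}" by auto
  then have "card {a\<in>{1..d}. P a \<or> Q a} \<le> card {a\<in>{1..d}. P a} + card {a\<in>{1..d}. Q a}"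
    by (metis card_Un_le)
  then show ?thesis using assms unfolding few_def distrib_right by linarith
qed

lemma few_Bex:
  assumes "finite F" "\<And>s. s \<in> F \<Longrightarrow> few d \<kappa> (P s)"
  shows "few d (real (card F) * \<kappa>) (\<lambda>a. \<exists>s\<in>F. P s a)"
  using assms
proof (induction F rule: finite_induct)
  case empty show ?case by (simp add: few_def)
next
  case (insert s F)
  have "few d (\<kappa> + real (card F) * \<kappa>) (\<lambda>a. P s a \<or> (\<exists>s\<in>F. P s a))"
    using insert by (intro few_disj) auto
  then show ?case by (rule few_mono) (use insert in \<open>auto simp: algebra_simps\<close>)
qed

text \<open>The permutation carries one exceptional set onto the other. In this way an estimate at
  \<open>a\<close> becomes one at \<open>\<sigma> i s a\<close> at no cost.\<close>

lemma few_permute: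
  assumes "\<pi> permutes {1..d}" "few d \<kappa> P" shows "few d \<kappa> (\<lambda>a. P (\<pi> a))"
proof -
  have "bij_betw \<pi> {a\<in>{1..d}. P (\<pi> a)} {a\<in>{1..d}. P a}"
    unfolding bij_betw_def
  proof
    show "inj_on \<pi> {a\<in>{1..d}. P (\<pi> a)}" using assms(1) by (meson inj_on_subset permutes_inj subset_UNIV)
    show "\<pi> ` {a\<in>{1..d}. P (\<pi> a)} = {a\<in>{1..d}. P a}"
    proof (intro equalityI subsetI)
      fix b assume "b \<in> {a\<in>{1..d}. P a}"
      then have b: "b \<in> {1..d}" "P b" by auto
      then obtain a where "a \<in> {1..d}" "b = \<pi> a"
        using permutes_image[OF assms(1)] by (metis imageE)
      then show "b \<in> \<pi> ` {a\<in>{1..d}. P (\<pi> a)}" using b by auto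
    qed (use permutes_in_image[OF assms(1)] in force)
  qed
  then show ?thesis using assms(2) bij_betw_same_card unfolding few_def by fastforce
qed

text \<open>Chebyshev's inequality for the counting measure: each exceptional index adds at least
  \<theta>^2 to the sum of squares.\<close>

lemma few_if_rms_less:
  assumes "rms d u < \<delta>" "0 < \<theta>" "\<And>a. a \<in> {1..d} \<Longrightarrow> 0 \<le> u a"
  shows "few d (\<delta>\<^sup>2 / \<theta>\<^sup>2) (\<lambda>a. \<theta> \<le> u a)"
proof (cases "d = 0")
  case True then show ?thesis by (simp add: few_def)
next
  case False
  let ?B = "{a\<in>{1..d}. \<theta> \<le> u a}"
  have "real (card ?B) * \<theta>\<^sup>2 = (\<Sum>a\<in>?B. \<theta>\<^sup>2)" by simp
  also have "\<dots> \<le> (\<Sum>a\<in>?B. (u a)\<^sup>2)" using assms by (intro sum_mono power_mono) auto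
  also have "\<dots> \<le> (\<Sum>a\<in>{1..d}. (u a)\<^sup>2)" by (intro sum_mono2) auto
  also have "\<dots> = (rms d u)\<^sup>2 * real d" using False by (simp add: rms_def sum_nonneg)
  also have "\<dots> \<le> \<delta>\<^sup>2 * real d"
    using assms(1) rms_nonneg[of d u] by (intro mult_right_mono power_mono) auto
  finally show ?thesis using assms(2) by (simp add: few_def field_simps)
qed

text \<open>The way back from Chebyshev's inequality needs the bound \<open>D\<close>, since each of
  the rare exceptional indices may contribute \<open>D^2\<close>. The thresholds depend on \<eta>
  and \<open>D\<close> only, never on the degree.\<close>

lemma rms_small_if_few:
  assumes "0 < \<eta>" "0 \<le> D"
  obtains \<theta> \<kappa> where "0 < \<theta>" "0 < \<kappa>"
    "\<And>d u. few d \<kappa> (\<lambda>a. \<theta> \<le> u a) \<Longrightarrow> (\<And>a. a \<in> {1..d} \<Longrightarrow> 0 \<le> u a) \<Longrightarrow>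
      (\<And>a. a \<in> {1..d} \<Longrightarrow> u a \<le> D) \<Longrightarrow> rms d u < \<eta>"
proof -
  \<comment> \<open>Ordinary indices contribute at most \<theta>^2 to the mean square and
    exceptional ones at most \<open>\<kappa> * D^2\<close>, together no more than half of \<eta>^2.
    The summand 1 keeps the denominator positive for \<open>D = 0\<close>.\<close>
  define \<theta> where "\<theta> = \<eta> / 2"
  define \<kappa> where "\<kappa> = (\<eta>/2)\<^sup>2 / (D\<^sup>2 + 1)"
  have pos: "0 < \<theta>" "0 < \<kappa>" using assms by (auto simp: \<theta>_def \<kappa>_def intro!: divide_pos_pos add_nonneg_pos)
  have \<kappa>D: "\<kappa> * D\<^sup>2 \<le> (\<eta>/2)\<^sup>2"
  proof -
    have "(\<eta>/2)\<^sup>2 * D\<^sup>2 \<le> (\<eta>/2)\<^sup>2 * (D\<^sup>2 + 1)" by (intro mult_left_mono) auto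
    moreover have "0 < D\<^sup>2 + 1" by (auto intro: add_nonneg_pos)
    ultimately show ?thesis by (simp add: \<kappa>_def pos_divide_le_eq)
  qed
  have "rms d u < \<eta>"
    if few: "few d \<kappa> (\<lambda>a. \<theta> \<le> u a)" and u: "\<And>a. a \<in> {1..d} \<Longrightarrow> 0 \<le> u a"
      "\<And>a. a \<in> {1..d} \<Longrightarrow> u a \<le> D" for d u
  proof (cases "d = 0")
    case True then show ?thesis using assms by (simp add: rms_def)
  next
    case False
    let ?B = "{a\<in>{1..d}. \<theta> \<le> u a}"
    have "(\<Sum>a\<in>{1..d}. (u a)\<^sup>2) \<le> (\<Sum>a\<in>{1..d}. \<theta>\<^sup>2 + (if a \<in> ?B then D\<^sup>2 else 0))"
      using u pos by (intro sum_mono) (auto intro!: power_mono add_increasing)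
    also have "\<dots> = real d * \<theta>\<^sup>2 + (\<Sum>a\<in>{1..d}. if a \<in> ?B then D\<^sup>2 else 0)"
      by (simp add: sum.distrib)
    also have "(\<Sum>a\<in>{1..d}. if a \<in> ?B then D\<^sup>2 else 0) = (\<Sum>a\<in>{1..d} \<inter> ?B. D\<^sup>2)"
      by (rule sum.inter_restrict[symmetric]) simp
    also have "{1..d} \<inter> ?B = ?B" by auto
    also have "(\<Sum>a\<in>?B. D\<^sup>2) = real (card ?B) * D\<^sup>2" by simp
    also have "\<dots> \<le> (\<kappa> * real d) * D\<^sup>2"
      using few unfolding few_def by (intro mult_right_mono) auto
    also have "\<dots> \<le> real d * (\<eta>/2)\<^sup>2"
      using mult_left_mono[OF \<kappa>D, of "real d"] by (simp add: algebra_simps)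
    finally have "(\<Sum>a\<in>{1..d}. (u a)\<^sup>2) \<le> real d * (\<theta>\<^sup>2 + (\<eta>/2)\<^sup>2)" by (simp add: algebra_simps)
    then have "(\<Sum>a\<in>{1..d}. (u a)\<^sup>2) / real d \<le> \<theta>\<^sup>2 + (\<eta>/2)\<^sup>2"
      using False by (simp add: field_simps)
    also have "\<dots> < \<eta>\<^sup>2" using assms(1) by (simp add: \<theta>_def power2_eq_square field_simps)
    finally show ?thesis unfolding rms_def using assms(1) by (intro real_less_lsqrt) auto
  qed
  then show ?thesis using that pos by blast
qed

lemma few_if_rms_small:
  assumes "0 < \<theta>" "0 < \<kappa>"
  obtains \<delta> where "0 < \<delta>"
    "\<And>d u. rms d u < \<delta> \<Longrightarrow> (\<And>a. a \<in> {1..d} \<Longrightarrow> 0 \<le> u a) \<Longrightarrow> few d \<kappa> (\<lambda>a. \<theta> \<le> u a)"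
proof
  \<comment> \<open>With this \<delta> the Chebyshev proportion \<delta>^2 / \<theta>^2 is
    \<kappa>.\<close>
  show "0 < \<theta> * sqrt \<kappa>" using assms by simp
  fix d u assume "rms d u < \<theta> * sqrt \<kappa>" "\<And>a. a \<in> {1..d} \<Longrightarrow> 0 \<le> u a"
  then have "few d ((\<theta> * sqrt \<kappa>)\<^sup>2 / \<theta>\<^sup>2) (\<lambda>a. \<theta> \<le> u a)"
    using assms by (intro few_if_rms_less) auto
  then show "few d \<kappa> (\<lambda>a. \<theta> \<le> u a)" using assms by (simp add: power_mult_distrib)
qed

section \<open>Continuous pseudometrics on compact spaces\<close>

lemma
  assumes "continuous_pseudometric \<rho>"
  shows pm_nonneg: "0 \<le> \<rho> x y" and pm_refl: "\<rho> x x = 0" and pm_sym: "\<rho> x y = \<rho> y x"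
    and pm_triangle: "\<rho> x z \<le> \<rho> x y + \<rho> y z"
  using assms unfolding continuous_pseudometric_def by blast+

lemma pm_continuous_on:
  assumes "continuous_pseudometric \<rho>" "continuous_on S f" "continuous_on S g"
  shows "continuous_on S (\<lambda>x. \<rho> (f x) (g x))"
proof -
  have "continuous_on UNIV (\<lambda>(x, y). \<rho> x y)"
    using assms(1) unfolding continuous_pseudometric_def by blast
  from continuous_on_compose2[OF this continuous_on_Pair[OF assms(2,3)]]
  show ?thesis by simp
qed

lemma pm_bounded:
  fixes \<rho> :: "'x::topological_space \<Rightarrow> 'x \<Rightarrow> real"
  assumes "continuous_pseudometric \<rho>" "compact (UNIV :: 'x set)"
  obtains D where "0 \<le> D" "\<And>x y :: 'x. \<rho> x y \<le> D"
proof -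
  have "compact ((\<lambda>(x, y). \<rho> x y) ` (UNIV \<times> UNIV))"
    using assms unfolding continuous_pseudometric_def
    by (intro compact_continuous_image compact_Times) auto
  then obtain D where "\<And>x y :: 'x. \<bar>\<rho> x y\<bar> \<le> D"
    using compact_imp_bounded bounded_iff[of "(\<lambda>(x, y). \<rho> x y) ` (UNIV \<times> UNIV)"] by fastforce
  then show ?thesis using that[of "max 0 D"] by (metis abs_le_D1 max.cobounded1 max.coboundedI2)
qed

lemma pm_finite_net:
  fixes \<rho> :: "'x::topological_space \<Rightarrow> 'x \<Rightarrow> real"
  assumes "continuous_pseudometric \<rho>" "compact (UNIV :: 'x set)" "0 < e"
  obtains Q :: "'x set" where "finite Q" "\<And>x. \<exists>q\<in>Q. \<rho> q x < e"
proof -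
  have "open {x. \<rho> q x < e}" for q
    by (intro open_Collect_less pm_continuous_on[OF assms(1)] continuous_intros)
  moreover have "UNIV \<subseteq> (\<Union>q\<in>UNIV. {x. \<rho> q x < e})"
    using pm_refl[OF assms(1)] assms(3) by auto
  ultimately obtain Q where "finite Q" "UNIV \<subseteq> (\<Union>q\<in>Q. {x. \<rho> q x < e})"
    using compactE_image[OF assms(2), of UNIV "\<lambda>q. {x. \<rho> q x < e}"] by metis
  then show ?thesis using that[of Q] by auto
qed

text \<open>Points with the same label share a net point within \<open>e / 2\<close>. Labels start
  at 1, which leaves 0 free to mark indices where no label is recorded.\<close>

lemma pm_finite_labelling:
  fixes \<rho> :: "'x::topological_space \<Rightarrow> 'x \<Rightarrow> real"
  assumes "continuous_pseudometric \<rho>" "compact (UNIV :: 'x set)" "0 < e"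
  obtains k :: nat and lab :: "'x \<Rightarrow> nat"
  where "\<And>x. lab x \<in> {1..k}" "\<And>x y. lab x = lab y \<Longrightarrow> \<rho> x y < e"
proof -
  obtain Q :: "'x set" where Q: "finite Q" "\<And>x. \<exists>q\<in>Q. \<rho> q x < e / 2"
    using pm_finite_net[OF assms(1,2), of "e/2"] assms(3) by auto
  obtain k f where f: "f ` Q = {i::nat. i < k}" "inj_on f Q"
    using finite_imp_inj_to_nat_seg[OF Q(1)] by blast
  obtain q where q: "\<And>x. q x \<in> Q" "\<And>x. \<rho> (q x) x < e / 2" using Q(2) by metis
  show ?thesis
  proof
    fix x
    have "f (q x) \<in> f ` Q" using q(1) by blast
    then show "Suc (f (q x)) \<in> {1..k}" using f(1) by auto
  next
    fix x y assume "Suc (f (q x)) = Suc (f (q y))"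
    then have "q x = q y" using f(2) q(1) by (auto dest: inj_onD)
    then show "\<rho> x y < e"
      using pm_triangle[OF assms(1), of x y "q x"] pm_sym[OF assms(1), of x "q x"] q(2)[of x] q(2)[of y]
      by simp
  qed
qed

section \<open>Comparison of the two spatial entropies\<close>

text \<open>Weighting a code by \<open>t\<close> to the number of its nonzero entries turns the sum over all codes
  into a product, which replaces binomial estimates.\<close>

lemma card_sparse_codes_le:
  fixes t \<eta> :: real
  assumes "0 < t" "t \<le> 1"
  shows "real (card {c \<in> {1..d} \<rightarrow>\<^sub>E {0..k}. few d \<eta> (\<lambda>a. c a \<noteq> (0::nat))}) * t powr (\<eta> * real d)
    \<le> (1 + real k * t) ^ d"
proof -
  let ?C = "{c \<in> {1..d} \<rightarrow>\<^sub>E {0..k}. few d \<eta> (\<lambda>a. c a \<noteq> 0)}"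
  define w where "w j = (if j = (0::nat) then 1 else t)" for j
  have wpos: "0 \<le> w j" for j using assms by (simp add: w_def)
  have w: "(\<Sum>j\<in>{0..k}. w j) = 1 + real k * t"
    using sum.atLeast_Suc_atMost[of 0 k w] by (simp add: w_def)
  have "t powr (\<eta> * real d) \<le> (\<Prod>a\<in>{1..d}. w (c a))" if c: "c \<in> ?C" for c
  proof -
    let ?n = "card {a\<in>{1..d}. c a \<noteq> 0}"
    have "real ?n \<le> \<eta> * real d" using c by (simp add: few_def)
    then have "t powr (\<eta> * real d) \<le> t powr (real ?n)" using assms by (intro powr_mono') auto
    also have "\<dots> = t ^ ?n" using assms by (simp add: powr_realpow)
    also have "\<dots> = (\<Prod>a\<in>{a\<in>{1..d}. c a \<noteq> 0}. t)" by simp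
    also have "\<dots> = (\<Prod>a\<in>{1..d}. if c a \<noteq> 0 then t else 1)"
      by (rule prod.inter_filter) simp
    also have "\<dots> = (\<Prod>a\<in>{1..d}. w (c a))" by (intro prod.cong) (auto simp: w_def)
    finally show ?thesis .
  qed
  then have "(\<Sum>c\<in>?C. t powr (\<eta> * real d)) \<le> (\<Sum>c\<in>?C. \<Prod>a\<in>{1..d}. w (c a))"
    by (rule sum_mono)
  also have "\<dots> \<le> (\<Sum>c\<in>{1..d} \<rightarrow>\<^sub>E {0..k}. \<Prod>a\<in>{1..d}. w (c a))"
    by (intro sum_mono2 finite_PiE prod_nonneg) (auto simp: wpos)
  also have "\<dots> = (\<Prod>a\<in>{1..d}. \<Sum>j\<in>{0..k}. w j)" by (rule prod_sum_PiE[symmetric]) auto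
  also have "\<dots> = (1 + real k * t) ^ d" by (simp add: w)
  finally show ?thesis by simp
qed

text \<open>The weighted count bounds the number of codes by
  \<open>exp ((k * t - \<eta> * ln t) * d)\<close>. As \<open>k\<close> is fixed, \<open>t\<close>
  can be chosen to make the first summand small, and after it \<eta> to make the second one
  small.\<close>

lemma sparse_codes_subexponential:
  assumes "0 < (\<kappa>::real)"
  obtains \<eta> where "0 < \<eta>"
    "\<And>d. real (card {c \<in> {1..d} \<rightarrow>\<^sub>E {0..k}. few d \<eta> (\<lambda>a. c a \<noteq> (0::nat))}) \<le> exp (\<kappa> * real d)"
proof -
  \<comment> \<open>Each summand of the exponent receives \<kappa> / 2. The minimum with 1 makes
    \<open>ln t\<close> nonpositive, so \<open>1 - ln t\<close> is positive.\<close>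
  define t where "t = min 1 (\<kappa> / (2 * (real k + 1)))"
  define \<eta> where "\<eta> = \<kappa> / (2 * (1 - ln t))"
  have t: "0 < t" "t \<le> 1" using assms by (auto simp: t_def)
  then have lnt: "ln t \<le> 0" by simp
  have "real k * t \<le> (real k + 1) * (\<kappa> / (2 * (real k + 1)))"
    using t by (intro mult_mono) (auto simp: t_def)
  moreover have "(real k + 1) * (\<kappa> / (2 * (real k + 1))) = \<kappa> / 2" by (simp add: field_simps)
  ultimately have kt: "real k * t \<le> \<kappa> / 2" by linarith
  have \<eta>pos: "0 < \<eta>" using assms lnt by (simp add: \<eta>_def)
  have "- \<eta> * ln t = (\<kappa> / 2) * (- ln t / (1 - ln t))"
    using lnt by (simp add: \<eta>_def field_simps)
  also have "\<dots> \<le> (\<kappa> / 2) * 1"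
  proof (rule mult_left_mono)
    show "- ln t / (1 - ln t) \<le> 1" using lnt by (subst divide_le_eq_1_pos) auto
  qed (use assms in simp)
  finally have \<eta>t: "- \<eta> * ln t \<le> \<kappa> / 2" by simp
  have "real (card {c \<in> {1..d} \<rightarrow>\<^sub>E {0..k}. few d \<eta> (\<lambda>a. c a \<noteq> (0::nat))}) \<le> exp (\<kappa> * real d)"
    (is "real ?n \<le> _") for d
  proof -
    have "t powr (\<eta> * real d) * exp (- \<eta> * ln t * real d) = 1"
      using t by (simp add: powr_def exp_minus field_simps)
    then have "real ?n * t powr (\<eta> * real d) * exp (- \<eta> * ln t * real d) = real ?n * 1"
      unfolding mult.assoc by (rule arg_cong)
    then have "real ?n = real ?n * t powr (\<eta> * real d) * exp (- \<eta> * ln t * real d)"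
      by linarith
    also have "\<dots> \<le> (1 + real k * t) ^ d * exp (- \<eta> * ln t * real d)"
      by (intro mult_right_mono card_sparse_codes_le t) auto
    also have "\<dots> \<le> exp (real k * t) ^ d * exp (- \<eta> * ln t * real d)"
      using t by (intro mult_right_mono power_mono exp_ge_add_one_self) auto
    also have "\<dots> = exp ((real k * t + - \<eta> * ln t) * real d)"
      by (simp add: exp_of_nat_mult[symmetric] exp_add[symmetric] algebra_simps)
    also have "\<dots> \<le> exp (\<kappa> * real d)"
      unfolding exp_le_cancel_iff using kt \<eta>t by (intro mult_right_mono) linarith+
    finally show ?thesis .
  qed
  then show ?thesis using that \<eta>pos by blast
qed

text \<open>A maximal separated set for \<open>rho_2\<close> is a net of \<open>Y\<close>. Each map
  of \<open>Y\<close> is determined, up to \<open>rho_inf\<close>-distance below \<epsilon>, by its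
  net point and by a code listing labels at the indices where the two maps differ by \<epsilon> / 2
  or more. These codes are sparse, so they cost a factor \<open>exp (\<kappa> * d)\<close> only, and
  \<epsilon>' is uniform in \<open>d\<close> and \<open>Y\<close>.\<close>

lemma sep_num_rho_inf_le:
  fixes \<rho> :: "'x::topological_space \<Rightarrow> 'x \<Rightarrow> real"
  assumes \<rho>: "continuous_pseudometric \<rho>" and "compact (UNIV :: 'x set)" and "0 < \<kappa>" "0 < \<epsilon>"
  obtains \<epsilon>' where "0 < \<epsilon>'"
    "\<And>d Y. 1 \<le> d \<Longrightarrow> log_enat (sep_num \<epsilon> Y (rho_inf \<rho> d))
       \<le> log_enat (sep_num \<epsilon>' Y (rho_2 \<rho> d)) + ereal (\<kappa> * real d)"
proof -
  obtain k and lab :: "'x \<Rightarrow> nat" where lab: "\<And>x. lab x \<in> {1..k}"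
    "\<And>x y. lab x = lab y \<Longrightarrow> \<rho> x y < \<epsilon>"
    by (rule pm_finite_labelling[OF \<rho> assms(2,4)]) blast
  obtain \<eta> where \<eta>: "0 < \<eta>"
    "\<And>d. real (card {c \<in> {1..d} \<rightarrow>\<^sub>E {0..k}. few d \<eta> (\<lambda>a. c a \<noteq> (0::nat))}) \<le> exp (\<kappa> * real d)"
    by (rule sparse_codes_subexponential[OF assms(3), where k = k]) blast
  \<comment> \<open>At threshold \<epsilon> / 2, Chebyshev's inequality turns a distance below
    \<epsilon>' into an exceptional proportion of at most \<eta>.\<close>
  define \<epsilon>' where "\<epsilon>' = sqrt \<eta> * (\<epsilon> / 2)"
  have \<epsilon>': "0 < \<epsilon>'" using \<eta>(1) assms(4) by (simp add: \<epsilon>'_def)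
  have "log_enat (sep_num \<epsilon> Y (rho_inf \<rho> d))
       \<le> log_enat (sep_num \<epsilon>' Y (rho_2 \<rho> d)) + ereal (\<kappa> * real d)" if d: "1 \<le> d" for d Y
  proof (cases "sep_num \<epsilon>' Y (rho_2 \<rho> d)")
    case infinity then show ?thesis by (simp add: log_enat_def)
  next
    case (enat n)
    obtain B where B: "finite B" "B \<subseteq> Y" "separated \<epsilon>' (rho_2 \<rho> d) B" "card B = n"
      using sep_num_attained[OF enat] .
    let ?C = "{c \<in> {1..d} \<rightarrow>\<^sub>E {0..k}. few d \<eta> (\<lambda>a. c a \<noteq> (0::nat))}"
    have finC: "finite ?C" by (rule finite_subset[of _ "{1..d} \<rightarrow>\<^sub>E {0..k}"]) (auto intro: finite_PiE)
    \<comment> \<open>A point of \<open>Y\<close> at distance at least \<epsilon>' from all of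
      \<open>B\<close> could be adjoined to \<open>B\<close>, against maximality.\<close>
    have near: "\<exists>b\<in>B. rho_2 \<rho> d \<psi> b < \<epsilon>'" if \<psi>: "\<psi> \<in> Y" for \<psi>
    proof (rule ccontr)
      assume far: "\<not> ?thesis"
      have "rho_2 \<rho> d \<psi> \<psi> < \<epsilon>'" using \<epsilon>' by (simp add: rho_2_def pm_refl[OF \<rho>])
      then have "\<psi> \<notin> B" using far by auto
      moreover have "separated \<epsilon>' (rho_2 \<rho> d) (insert \<psi> B)"
        using B(3) far pm_sym[OF \<rho>] unfolding separated_def rho_2_def by (auto simp: not_less)
      then have "enat (card (insert \<psi> B)) \<le> enat n"
        unfolding enat[symmetric] using B \<psi> by (intro card_le_sep_num) auto
      ultimately show False using B by simp
    qed
    then obtain b where b: "\<And>\<psi>. \<psi> \<in> Y \<Longrightarrow> b \<psi> \<in> B" "\<And>\<psi>. \<psi> \<in> Y \<Longrightarrow> rho_2 \<rho> d \<psi> (b \<psi>) < \<epsilon>'"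
      by metis
    define c where "c \<psi> = (\<lambda>a\<in>{1..d}. if \<rho> (\<psi> a) (b \<psi> a) < \<epsilon> / 2 then 0 else lab (\<psi> a))" for \<psi>
    have cC: "c \<psi> \<in> ?C" if "\<psi> \<in> Y" for \<psi>
    proof -
      have "few d (\<epsilon>'\<^sup>2 / (\<epsilon>/2)\<^sup>2) (\<lambda>a. \<epsilon> / 2 \<le> \<rho> (\<psi> a) (b \<psi> a))"
        using b(2)[OF that] assms(4) pm_nonneg[OF \<rho>] unfolding rho_2_eq_rms
        by (intro few_if_rms_less) auto
      moreover have "\<epsilon>'\<^sup>2 / (\<epsilon>/2)\<^sup>2 = \<eta>" using \<eta>(1) assms(4) unfolding \<epsilon>'_def power_mult_distrib by simp
      ultimately have "few d \<eta> (\<lambda>a. c \<psi> a \<noteq> 0)"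
        by (auto simp: c_def not_less intro: few_mono[of d \<eta>] split: if_splits)
      then show ?thesis using lab(1) by (auto simp: c_def)
    qed
    have "sep_num \<epsilon> Y (rho_inf \<rho> d) \<le> enat (n * card ?C)"
    proof (rule sep_num_le)
      fix A assume A: "finite A" "A \<subseteq> Y" "separated \<epsilon> (rho_inf \<rho> d) A"
      have "inj_on (\<lambda>\<psi>. (b \<psi>, c \<psi>)) A"
      proof (rule inj_onI, rule ccontr)
        fix \<phi> \<psi> assume *: "\<phi> \<in> A" "\<psi> \<in> A" "(b \<phi>, c \<phi>) = (b \<psi>, c \<psi>)" "\<phi> \<noteq> \<psi>"
        have "\<rho> (\<phi> a) (\<psi> a) < \<epsilon>" if a: "a \<in> {1..d}" for a
        proof -
          have eq: "b \<phi> = b \<psi>" "c \<phi> a = c \<psi> a" using * by auto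
          show ?thesis
          proof (cases "c \<phi> a = 0")
            case True
            \<comment> \<open>Labels are at least 1, so the entry 0 can only mean closeness to the
              common net point.\<close>
            then have "\<rho> (\<phi> a) (b \<psi> a) < \<epsilon> / 2" "\<rho> (\<psi> a) (b \<psi> a) < \<epsilon> / 2"
              using a eq lab(1)[of "\<phi> a"] lab(1)[of "\<psi> a"] by (auto simp: c_def split: if_splits)
            then show ?thesis
              using pm_triangle[OF \<rho>, of "\<phi> a" "\<psi> a" "b \<psi> a"] pm_sym[OF \<rho>, of "\<psi> a"] by simp
          next
            case False
            then have "lab (\<phi> a) = lab (\<psi> a)" using a eq by (auto simp: c_def split: if_splits)
            then show ?thesis by (rule lab(2))
          qed
        qed
        then have "rho_inf \<rho> d \<phi> \<psi> < \<epsilon>" using d unfolding rho_inf_def by (subst Max_less_iff) auto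
        then show False using A(3) * unfolding separated_def by force
      qed
      moreover have "(\<lambda>\<psi>. (b \<psi>, c \<psi>)) ` A \<subseteq> B \<times> ?C" using A(2) b(1) cC by blast
      ultimately have "card A \<le> card (B \<times> ?C)"
        using finC B(1) by (intro card_inj_on_le) auto
      then show "enat (card A) \<le> enat (n * card ?C)" using B(4) by (simp add: card_cartesian_product)
    qed
    then have "log_enat (sep_num \<epsilon> Y (rho_inf \<rho> d)) \<le> log_enat (enat (n * card ?C))"
      by (rule log_enat_mono)
    also have "\<dots> \<le> log_enat (enat n) + ereal (\<kappa> * real d)"
    proof (cases "n = 0 \<or> card ?C = 0")
      case True then show ?thesis by (auto simp: log_enat_def)
    next
      case False
      then have "ln (real (card ?C)) \<le> \<kappa> * real d"
        using \<eta>(2)[of d] by (subst ln_exp[symmetric], subst ln_le_cancel_iff) auto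
      then show ?thesis using False by (auto simp: log_enat_def ln_mult)
    qed
    finally show ?thesis using enat by simp
  qed
  then show ?thesis using that \<epsilon>' by blast
qed

lemma ereal_add_const_divide: "0 < d \<Longrightarrow> (x + ereal (\<kappa> * d)) / ereal d = x / ereal d + ereal \<kappa>"
  by (cases x) (auto simp: field_simps)

text \<open>Exchanging the separation distance costs \<kappa> in the growth rate, which
  \<open>entropy_le\<close> cannot express. As \<kappa> is arbitrary, the loss disappears after the
  supremum over scales.\<close>

lemma h_inf_le_h_2:
  fixes \<rho> :: "'x::topological_space \<Rightarrow> 'x \<Rightarrow> real"
  assumes \<rho>: "continuous_pseudometric \<rho>" and "compact (UNIV :: 'x set)"
    and "filterlim d at_top sequentially"
  shows "h_inf G \<alpha> \<mu> d \<sigma> \<rho> \<le> h_2 G \<alpha> \<mu> d \<sigma> \<rho>"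
  unfolding h_inf_def h_2_def h_spatial_def
proof (rule SUP_least)
  fix \<epsilon> :: real assume "\<epsilon> \<in> {0<..}"
  then have \<epsilon>: "0 < \<epsilon>" by simp
  let ?f = "\<lambda>D \<epsilon> F L \<delta>. limsup (\<lambda>i. log_enat (sep_num \<epsilon> (Map_mu \<alpha> \<mu> \<rho> F L \<delta> (d i) (\<sigma> i)) (D (d i)))
                    / ereal (real (d i)))"
  let ?A = "{F. finite F \<and> F \<noteq> {} \<and> F \<subseteq> carrier G}"
  let ?B = "{L. finite L \<and> L \<subseteq> (CX :: ('x \<Rightarrow> complex) set)}"
  let ?C = "{0::real<..}"
  let ?S = "SUP \<epsilon>\<in>{0<..}. INF F\<in>?A. INF L\<in>?B. INF \<delta>\<in>?C. ?f (rho_2 \<rho>) \<epsilon> F L \<delta>"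
  let ?I = "INF F\<in>?A. INF L\<in>?B. INF \<delta>\<in>?C. ?f (rho_inf \<rho>) \<epsilon> F L \<delta>"
  show "?I \<le> ?S"
  proof (rule ereal_le_epsilon2)
    fix \<kappa> :: real assume "0 < \<kappa>"
    then obtain \<epsilon>' where \<epsilon>': "0 < \<epsilon>'"
      "\<And>d Y. 1 \<le> d \<Longrightarrow> log_enat (sep_num \<epsilon> Y (rho_inf \<rho> d))
         \<le> log_enat (sep_num \<epsilon>' Y (rho_2 \<rho> d)) + ereal (\<kappa> * real d)"
      by (rule sep_num_rho_inf_le[OF \<rho> assms(2) _ \<epsilon>]) blast+
    have dpos: "\<forall>\<^sub>F i in sequentially. 1 \<le> d i" using assms(3) by (simp add: filterlim_at_top)
    \<comment> \<open>With the loss on the left, the infima on the right can be treated one set of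
      parameters at a time.\<close>
    have "?I - ereal \<kappa> \<le> (INF F\<in>?A. INF L\<in>?B. INF \<delta>\<in>?C. ?f (rho_2 \<rho>) \<epsilon>' F L \<delta>)"
    proof (intro INF_greatest)
      fix F L \<delta> assume k: "F \<in> ?A" "L \<in> ?B" "\<delta> \<in> ?C"
      have "?I \<le> ?f (rho_inf \<rho>) \<epsilon> F L \<delta>"
        by (intro INF_lower2[OF k(1)] INF_lower2[OF k(2)] INF_lower2[OF k(3)] order_refl)
      also have "\<dots> \<le> limsup (\<lambda>i. log_enat (sep_num \<epsilon>' (Map_mu \<alpha> \<mu> \<rho> F L \<delta> (d i) (\<sigma> i)) (rho_2 \<rho> (d i)))
                    / ereal (real (d i)) + ereal \<kappa>)"
      proof (rule Limsup_mono, use dpos in eventually_elim)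
        fix i assume i: "1 \<le> d i"
        let ?Y = "Map_mu \<alpha> \<mu> \<rho> F L \<delta> (d i) (\<sigma> i)"
        have "log_enat (sep_num \<epsilon> ?Y (rho_inf \<rho> (d i))) / ereal (real (d i))
          \<le> (log_enat (sep_num \<epsilon>' ?Y (rho_2 \<rho> (d i))) + ereal (\<kappa> * real (d i))) / ereal (real (d i))"
          by (rule ereal_divide_mono[OF \<epsilon>'(2)[OF i]])
        also have "\<dots> = log_enat (sep_num \<epsilon>' ?Y (rho_2 \<rho> (d i))) / ereal (real (d i)) + ereal \<kappa>"
          by (rule ereal_add_const_divide) (use i in simp)
        finally show "log_enat (sep_num \<epsilon> ?Y (rho_inf \<rho> (d i))) / ereal (real (d i))
          \<le> log_enat (sep_num \<epsilon>' ?Y (rho_2 \<rho> (d i))) / ereal (real (d i)) + ereal \<kappa>" .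
      qed
      also have "\<dots> = ?f (rho_2 \<rho>) \<epsilon>' F L \<delta> + ereal \<kappa>"
        by (rule Limsup_add_ereal_right) auto
      finally show "?I - ereal \<kappa> \<le> ?f (rho_2 \<rho>) \<epsilon>' F L \<delta>" by (simp add: ereal_minus_le)
    qed
    also have "\<dots> \<le> ?S" by (rule SUP_upper) (use \<epsilon>'(1) in simp)
    finally show "?I \<le> ?S + ereal \<kappa>" by (simp add: ereal_minus_le)
  qed
qed

text \<open>Both entropies count in the same sets of maps, and a quadratic mean is at most the
  maximum. Degrees are taken positive, as the maximum over no indices is unspecified.\<close>

lemma h_2_le_h_inf:
  fixes \<rho> :: "'x::topological_space \<Rightarrow> 'x \<Rightarrow> real"
  assumes \<rho>: "continuous_pseudometric \<rho>" and "filterlim d at_top sequentially"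
  shows "h_2 G \<alpha> \<mu> d \<sigma> \<rho> \<le> h_inf G \<alpha> \<mu> d \<sigma> \<rho>"
  unfolding h_inf_def h_2_def h_spatial_def
proof (rule entropy_le)
  have le: "rho_2 \<rho> n \<phi> \<psi> \<le> rho_inf \<rho> n \<phi> \<psi>" if "1 \<le> n" for n \<phi> \<psi>
  proof -
    have M: "\<rho> (\<phi> a) (\<psi> a) \<le> rho_inf \<rho> n \<phi> \<psi>" if "a \<in> {1..n}" for a
      unfolding rho_inf_def using that by (intro Max_ge) auto
    have "rho_2 \<rho> n \<phi> \<psi> \<le> rms n (\<lambda>a. rho_inf \<rho> n \<phi> \<psi>)"
      unfolding rho_2_eq_rms by (intro rms_mono M pm_nonneg[OF \<rho>]) auto
    also have "\<dots> \<le> rho_inf \<rho> n \<phi> \<psi>"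
      using M[of 1] pm_nonneg[OF \<rho>, of "\<phi> 1" "\<psi> 1"] that by (intro rms_const_le) auto
    finally show ?thesis .
  qed
  have dpos: "\<forall>\<^sub>F i in sequentially. 1 \<le> d i" using assms(2) by (simp add: filterlim_at_top)
  fix \<epsilon> :: real assume "0 < \<epsilon>"
  have "\<forall>\<^sub>F i in sequentially. Map_mu \<alpha> \<mu> \<rho> F L \<delta> (d i) (\<sigma> i) \<subseteq> Map_mu \<alpha> \<mu> \<rho> F L \<delta> (d i) (\<sigma> i) \<and>
      (\<forall>x\<in>Map_mu \<alpha> \<mu> \<rho> F L \<delta> (d i) (\<sigma> i). \<forall>y\<in>Map_mu \<alpha> \<mu> \<rho> F L \<delta> (d i) (\<sigma> i).
        \<epsilon> \<le> rho_2 \<rho> (d i) x y \<longrightarrow> \<epsilon> \<le> rho_inf \<rho> (d i) x y)" for F L \<delta>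
    using dpos by eventually_elim (use le in \<open>auto intro: order_trans\<close>)
  then show "\<exists>\<epsilon>'>0. \<forall>F\<in>{F. finite F \<and> F \<noteq> {} \<and> F \<subseteq> carrier G}. \<forall>L\<in>{L. finite L \<and> L \<subseteq> CX}. \<forall>\<delta>\<in>{0<..}.
    \<exists>F'\<in>{F. finite F \<and> F \<noteq> {} \<and> F \<subseteq> carrier G}. \<exists>L'\<in>{L. finite L \<and> L \<subseteq> CX}. \<exists>\<delta>'\<in>{0<..}.
    \<forall>\<^sub>F i in sequentially. Map_mu \<alpha> \<mu> \<rho> F' L' \<delta>' (d i) (\<sigma> i) \<subseteq> Map_mu \<alpha> \<mu> \<rho> F L \<delta> (d i) (\<sigma> i) \<and>
      (\<forall>x\<in>Map_mu \<alpha> \<mu> \<rho> F' L' \<delta>' (d i) (\<sigma> i). \<forall>y\<in>Map_mu \<alpha> \<mu> \<rho> F' L' \<delta>' (d i) (\<sigma> i).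
        \<epsilon> \<le> rho_2 \<rho> (d i) x y \<longrightarrow> \<epsilon>' \<le> rho_inf \<rho> (d i) x y)"
    using \<open>0 < \<epsilon>\<close> by blast
qed

section \<open>Sofic actions\<close>

locale sofic_pmp_action = group G for G :: "('g, 'r) monoid_scheme" (structure) +
  fixes d :: "nat \<Rightarrow> nat" and \<sigma> :: "nat \<Rightarrow> 'g \<Rightarrow> nat \<Rightarrow> nat"
    and \<alpha> :: "'g \<Rightarrow> 'x \<Rightarrow> 'x::t2_space" and \<mu> :: "'x measure"
  assumes sofic: "sofic_approx G d \<sigma>"
    and compact_X: "compact (UNIV :: 'x set)"
    and action: "continuous_action G \<alpha>"
    and invariant: "invariant_borel_prob G \<alpha> \<mu>"
begin

lemma act_mult: "s \<in> carrier G \<Longrightarrow> t \<in> carrier G \<Longrightarrow> \<alpha> (s \<otimes> t) x = \<alpha> s (\<alpha> t x)"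
  using action group_action.composition_rule[of G UNIV \<alpha> x s t]
  unfolding continuous_action_def by simp

lemma act_one: "\<alpha> \<one> x = x"
  using action group_action.id_eq_one[of G UNIV \<alpha>]
  unfolding continuous_action_def by (metis restrict_UNIV)

lemma act_continuous: "s \<in> carrier G \<Longrightarrow> continuous_on UNIV (\<alpha> s)"
  using action unfolding continuous_action_def by blast

lemma sigma_permutes: "s \<in> carrier G \<Longrightarrow> \<sigma> i s permutes {1..d i}"
  using sofic by (simp add: sofic_approx_def)

lemma sigma_in: "s \<in> carrier G \<Longrightarrow> a \<in> {1..d i} \<Longrightarrow> \<sigma> i s a \<in> {1..d i}"
  using permutes_in_image[OF sigma_permutes] by blast

lemma degrees_at_top: "filterlim d at_top sequentially"
  using sofic by (simp add: sofic_approx_def)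

lemma eventually_degree_pos: "\<forall>\<^sub>F i in sequentially. 1 \<le> d i"
  using degrees_at_top by (simp add: filterlim_at_top)

lemma eventually_sigma_mult:
  assumes "s \<in> carrier G" "t \<in> carrier G" "0 < \<kappa>"
  shows "\<forall>\<^sub>F i in sequentially. few (d i) \<kappa> (\<lambda>a. \<sigma> i (s \<otimes> t) a \<noteq> \<sigma> i s (\<sigma> i t a))"
proof -
  have "(\<lambda>i. real (card {a\<in>{1..d i}. \<sigma> i (s \<otimes> t) a = \<sigma> i s (\<sigma> i t a)}) / real (d i))
      \<longlonglongrightarrow> 1"
    using sofic assms(1,2) by (simp add: sofic_approx_def)
  then have "\<forall>\<^sub>F i in sequentially.
      1 - \<kappa> < real (card {a\<in>{1..d i}. \<sigma> i (s \<otimes> t) a = \<sigma> i s (\<sigma> i t a)}) / real (d i)"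
    by (rule order_tendstoD) (use assms in simp)
  then show ?thesis
    using eventually_degree_pos
  proof eventually_elim
    case (elim i)
    let ?E = "{a\<in>{1..d i}. \<sigma> i (s \<otimes> t) a = \<sigma> i s (\<sigma> i t a)}"
    have "{a\<in>{1..d i}. \<sigma> i (s \<otimes> t) a \<noteq> \<sigma> i s (\<sigma> i t a)} = {1..d i} - ?E" by auto
    moreover have "card ({1..d i} - ?E) = card {1..d i} - card ?E" by (rule card_Diff_subset) auto
    ultimately have "card {a\<in>{1..d i}. \<sigma> i (s \<otimes> t) a \<noteq> \<sigma> i s (\<sigma> i t a)} = card {1..d i} - card ?E"
      by (rule subst[OF sym])
    moreover have "card ?E \<le> card {1..d i}" by (intro card_mono) auto
    ultimately have "real (card {a\<in>{1..d i}. \<sigma> i (s \<otimes> t) a \<noteq> \<sigma> i s (\<sigma> i t a)})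
        = real (d i) - real (card ?E)"
      by simp
    moreover have "(1 - \<kappa>) * real (d i) < real (card ?E)"
      using elim by (simp add: pos_less_divide_eq)
    ultimately show ?case unfolding few_def by (simp add: algebra_simps)
  qed
qed

text \<open>Where \<sigma> multiplies correctly at \<open>s\<close> and \<open>inv s\<close>, the
  permutation \<open>\<sigma> i s\<close> takes \<open>\<sigma> i (inv s) a\<close> to
  \<open>\<sigma> i \<one> a\<close>, which is \<open>a\<close> at most indices. This reconciles the
  inverse permutations in \<open>Hom_mu\<close> with the values of \<sigma> at inverse
  elements.\<close>

lemma eventually_sigma_inv:
  assumes s: "s \<in> carrier G" and "0 < \<kappa>"
  shows "\<forall>\<^sub>F i in sequentially. few (d i) \<kappa> (\<lambda>a. inv_into {1..d i} (\<sigma> i s) a \<noteq> \<sigma> i (inv s) a)"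
proof -
  have "\<forall>\<^sub>F i in sequentially. few (d i) (\<kappa>/2) (\<lambda>a. \<sigma> i (s \<otimes> inv s) a \<noteq> \<sigma> i s (\<sigma> i (inv s) a))"
    using assms by (intro eventually_sigma_mult) auto
  \<comment> \<open>The permutation \<open>\<sigma> i \<one>\<close> need not be the identity;
    multiplicativity at \<open>\<one> \<otimes> \<one>\<close> and injectivity make it fix most
    indices.\<close>
  moreover have "\<forall>\<^sub>F i in sequentially. few (d i) (\<kappa>/2) (\<lambda>a. \<sigma> i (\<one> \<otimes> \<one>) a \<noteq> \<sigma> i \<one> (\<sigma> i \<one> a))"
    using assms by (intro eventually_sigma_mult) auto
  ultimately show ?thesis
  proof eventually_elim
    case (elim i)
    have "few (d i) (\<kappa>/2 + \<kappa>/2) (\<lambda>a. \<sigma> i (s \<otimes> inv s) a \<noteq> \<sigma> i s (\<sigma> i (inv s) a)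
        \<or> \<sigma> i (\<one> \<otimes> \<one>) a \<noteq> \<sigma> i \<one> (\<sigma> i \<one> a))"
      by (intro few_disj elim)
    then show ?case
    proof (rule few_mono)
      fix a assume a: "a \<in> {1..d i}" and ne: "inv_into {1..d i} (\<sigma> i s) a \<noteq> \<sigma> i (inv s) a"
      show "\<sigma> i (s \<otimes> inv s) a \<noteq> \<sigma> i s (\<sigma> i (inv s) a)
        \<or> \<sigma> i (\<one> \<otimes> \<one>) a \<noteq> \<sigma> i \<one> (\<sigma> i \<one> a)"
      proof (rule ccontr)
        assume "\<not> ?thesis"
        then have *: "\<sigma> i s (\<sigma> i (inv s) a) = \<sigma> i \<one> a" "\<sigma> i \<one> (\<sigma> i \<one> a) = \<sigma> i \<one> a"
          using s by auto
        have "\<sigma> i \<one> a = a"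
          using *(2) permutes_inj[OF sigma_permutes[of \<one> i]] by (auto dest: injD)
        then have eq: "\<sigma> i s (\<sigma> i (inv s) a) = a" using * by simp
        have "inv_into {1..d i} (\<sigma> i s) (\<sigma> i s (\<sigma> i (inv s) a)) = \<sigma> i (inv s) a"
          using permutes_inj_on[OF sigma_permutes[OF s]] sigma_in[of "inv s" a i] s a
          by (intro inv_into_f_f) auto
        then show False using eq ne by simp
      qed
    qed simp
  qed
qed

text \<open>The pairs at \<rho>'-distance at least \<eta> form a compact set off the diagonal, where
  \<rho> separates some translate. A finite subcover leaves finitely many translates and one
  positive threshold.\<close>

lemma orbit_pm_controls:
  assumes \<rho>: "continuous_pseudometric \<rho>" and gen: "dyn_generating_pseudometric G \<alpha> \<rho>"
    and \<rho>': "continuous_pseudometric \<rho>'" and "0 < \<eta>"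
  obtains F \<theta> where "finite F" "F \<noteq> {}" "F \<subseteq> carrier G" "0 < \<theta>"
    "\<And>x y. (\<And>s. s \<in> F \<Longrightarrow> \<rho> (\<alpha> s x) (\<alpha> s y) < \<theta>) \<Longrightarrow> \<rho>' x y < \<eta>"
proof -
  define K where "K = {z. \<eta> \<le> \<rho>' (fst z) (snd z)}"
  \<comment> \<open>The index \<open>n\<close> builds a positive lower bound into every member of
    the cover, so that a finite subcover has a common one.\<close>
  define U where "U = (\<lambda>(s, n). {z. 1 / (real n + 1) < \<rho> (\<alpha> s (fst z)) (\<alpha> s (snd z))})"
  have "closed K"
    unfolding K_def by (intro closed_Collect_le pm_continuous_on[OF \<rho>'] continuous_intros)
  moreover have "compact (UNIV :: ('x \<times> 'x) set)"
    using compact_Times[OF compact_X compact_X] by simp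
  ultimately have "compact K" using compact_Int_closed[of UNIV K] by simp
  moreover have "open (U c)" if "c \<in> carrier G \<times> UNIV" for c
    using that unfolding U_def
    by (auto intro!: open_Collect_less pm_continuous_on[OF \<rho>] continuous_intros
        continuous_on_compose2[OF act_continuous])
  moreover have "K \<subseteq> (\<Union>c\<in>carrier G \<times> UNIV. U c)"
  proof
    fix z assume "z \<in> K"
    then have "fst z \<noteq> snd z" using pm_refl[OF \<rho>'] \<open>0 < \<eta>\<close> by (auto simp: K_def)
    then obtain s where s: "s \<in> carrier G" "0 < \<rho> (\<alpha> s (fst z)) (\<alpha> s (snd z))"
      using gen unfolding dyn_generating_pseudometric_def by blast
    obtain n where "1 / (real n + 1) < \<rho> (\<alpha> s (fst z)) (\<alpha> s (snd z))"
      using reals_Archimedean[OF s(2)] by (auto simp: inverse_eq_divide add.commute)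
    then show "z \<in> (\<Union>c\<in>carrier G \<times> UNIV. U c)" using s(1) by (auto simp: U_def)
  qed
  ultimately obtain C where C: "C \<subseteq> carrier G \<times> UNIV" "finite C" "K \<subseteq> (\<Union>c\<in>C. U c)"
    by (rule compactE_image)
  obtain N where N: "\<And>n. n \<in> snd ` C \<Longrightarrow> n \<le> N"
    using C(2) finite_nat_set_iff_bounded_le[of "snd ` C"] by auto
  show ?thesis
  \<comment> \<open>The unit keeps the set nonempty even for an empty subcover; \<open>N\<close>
    dominates all indices \<open>n\<close> that occur in it.\<close>
  proof (rule that[of "insert \<one> (fst ` C)" "1 / (real N + 1)"])
    fix x y assume *: "\<And>s. s \<in> insert \<one> (fst ` C) \<Longrightarrow> \<rho> (\<alpha> s x) (\<alpha> s y) < 1 / (real N + 1)"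
    show "\<rho>' x y < \<eta>"
    proof (rule ccontr)
      assume "\<not> \<rho>' x y < \<eta>"
      then have "(x, y) \<in> K" by (simp add: K_def)
      then obtain s n where sn: "(s, n) \<in> C" "1 / (real n + 1) < \<rho> (\<alpha> s x) (\<alpha> s y)"
        using C(3) by (auto simp: U_def)
      have "s \<in> fst ` C" "n \<in> snd ` C" using sn(1) by force+
      then have "\<rho> (\<alpha> s x) (\<alpha> s y) < 1 / (real N + 1)" "n \<le> N" using * N by auto
      moreover from this have "1 / (real N + 1) \<le> 1 / (real n + 1)" by (simp add: frac_le)
      ultimately show False using sn(2) by simp
    qed
  qed (use C in auto)
qed

text \<open>The compactness statement in averaged form. The hypothesis is stated with exceptional
  sets because those, unlike means, can be collected over all translates.\<close>

lemma rms_small_if_orbits_close: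
  assumes \<rho>: "continuous_pseudometric \<rho>" and gen: "dyn_generating_pseudometric G \<alpha> \<rho>"
    and \<rho>': "continuous_pseudometric \<rho>'" and "0 < \<eta>"
  obtains F \<theta> \<kappa> where "finite F" "F \<noteq> {}" "F \<subseteq> carrier G" "0 < \<theta>" "0 < \<kappa>"
    "\<And>n u v. (\<And>s. s \<in> F \<Longrightarrow> few n \<kappa> (\<lambda>a. \<theta> \<le> \<rho> (\<alpha> s (u a)) (\<alpha> s (v a)))) \<Longrightarrow> rho_2 \<rho>' n u v < \<eta>"
proof -
  obtain D where D: "0 \<le> D" "\<And>x y. \<rho>' x y \<le> D"
    using pm_bounded[OF \<rho>' compact_X] by blast
  obtain \<theta>' \<kappa> where \<kappa>: "0 < \<theta>'" "0 < \<kappa>" "\<And>d u. few d \<kappa> (\<lambda>a. \<theta>' \<le> u a) \<Longrightarrow>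
      (\<And>a. a \<in> {1..d} \<Longrightarrow> 0 \<le> u a) \<Longrightarrow> (\<And>a. a \<in> {1..d} \<Longrightarrow> u a \<le> D) \<Longrightarrow> rms d u < \<eta>"
    by (rule rms_small_if_few[OF \<open>0 < \<eta>\<close> D(1)]) blast
  obtain F \<theta> where F: "finite F" "F \<noteq> {}" "F \<subseteq> carrier G" "0 < \<theta>"
    "\<And>x y. (\<And>s. s \<in> F \<Longrightarrow> \<rho> (\<alpha> s x) (\<alpha> s y) < \<theta>) \<Longrightarrow> \<rho>' x y < \<theta>'"
    by (rule orbit_pm_controls[OF \<rho> gen \<rho>' \<kappa>(1)]) blast
  have cF: "0 < real (card F)" using F by (simp add: card_gt_0_iff)
  show ?thesis
  \<comment> \<open>The division pays for the union bound over \<open>F\<close>.\<close>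
  proof (rule that[OF F(1-4), of "\<kappa> / real (card F)"])
    fix n u v
    assume "\<And>s. s \<in> F \<Longrightarrow> few n (\<kappa> / real (card F)) (\<lambda>a. \<theta> \<le> \<rho> (\<alpha> s (u a)) (\<alpha> s (v a)))"
    then have "few n (real (card F) * (\<kappa> / real (card F))) (\<lambda>a. \<exists>s\<in>F. \<theta> \<le> \<rho> (\<alpha> s (u a)) (\<alpha> s (v a)))"
      by (intro few_Bex F(1))
    then have "few n \<kappa> (\<lambda>a. \<theta>' \<le> \<rho>' (u a) (v a))"
    proof (rule few_mono)
      fix a assume "\<theta>' \<le> \<rho>' (u a) (v a)"
      then show "\<exists>s\<in>F. \<theta> \<le> \<rho> (\<alpha> s (u a)) (\<alpha> s (v a))" using F(5)[of "u a" "v a"] by force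
    qed (use cF in simp)
    then show "rho_2 \<rho>' n u v < \<eta>"
      unfolding rho_2_eq_rms by (rule \<kappa>(3)) (use D pm_nonneg[OF \<rho>'] in auto)
  qed (use \<kappa> cF in auto)
qed

text \<open>For \<open>t\<close> in \<open>F0\<close> and \<open>s\<close> in \<open>F'\<close>, the
  point \<open>\<alpha> t (\<phi> (\<sigma> i s a))\<close> is close to
  \<open>\<phi> (\<sigma> i t (\<sigma> i s a))\<close>, which is mostly
  \<open>\<phi> (\<sigma> i (t \<otimes> s) a)\<close>, which is close to
  \<open>\<alpha> t (\<alpha> s (\<phi> a))\<close>. So equivariance is required at \<open>t\<close>
  and at \<open>t \<otimes> s\<close>. Where \<sigma> fails to multiply does not depend on \<phi>,
  so the same late \<open>i\<close> serve all maps.\<close>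

lemma equivariance_transfer:
  assumes \<rho>: "continuous_pseudometric \<rho>" and gen: "dyn_generating_pseudometric G \<alpha> \<rho>"
    and \<rho>': "continuous_pseudometric \<rho>'" and "0 < \<delta>'" and F': "finite F'" "F' \<subseteq> carrier G"
  obtains F \<delta> where "finite F" "F \<noteq> {}" "F \<subseteq> carrier G" "0 < \<delta>"
    "\<forall>\<^sub>F i in sequentially. \<forall>\<phi>.
       (\<forall>s\<in>F. rho_2 \<rho> (d i) (\<lambda>a. \<phi> (\<sigma> i s a)) (\<lambda>a. \<alpha> s (\<phi> a)) < \<delta>) \<longrightarrow>
       (\<forall>s\<in>F'. rho_2 \<rho>' (d i) (\<lambda>a. \<phi> (\<sigma> i s a)) (\<lambda>a. \<alpha> s (\<phi> a)) < \<delta>')"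
proof -
  obtain F0 \<theta> \<kappa> where F0: "finite F0" "F0 \<noteq> {}" "F0 \<subseteq> carrier G" "0 < \<theta>" "0 < \<kappa>"
    "\<And>n u v. (\<And>s. s \<in> F0 \<Longrightarrow> few n \<kappa> (\<lambda>a. \<theta> \<le> \<rho> (\<alpha> s (u a)) (\<alpha> s (v a)))) \<Longrightarrow> rho_2 \<rho>' n u v < \<delta>'"
    by (rule rms_small_if_orbits_close[OF \<rho> gen \<rho>' \<open>0 < \<delta>'\<close>]) blast
  \<comment> \<open>Two approximations share \<theta>, three exceptional sets share
    \<kappa>.\<close>
  obtain \<delta> where \<delta>: "0 < \<delta>" "\<And>d u. rms d u < \<delta> \<Longrightarrow> (\<And>a. a \<in> {1..d} \<Longrightarrow> 0 \<le> u a) \<Longrightarrow>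
      few d (\<kappa>/3) (\<lambda>a. \<theta>/2 \<le> u a)"
    by (rule few_if_rms_small[of "\<theta>/2" "\<kappa>/3"]) (use F0 in auto)
  let ?F = "F0 \<union> (\<lambda>(t, s). t \<otimes> s) ` (F0 \<times> F')"
  have "\<forall>\<^sub>F i in sequentially. \<forall>t\<in>F0. \<forall>s\<in>F'.
      few (d i) (\<kappa>/3) (\<lambda>a. \<sigma> i (t \<otimes> s) a \<noteq> \<sigma> i t (\<sigma> i s a))"
    using F0 F' by (intro eventually_ball_finite ballI eventually_sigma_mult) auto
  then have "\<forall>\<^sub>F i in sequentially. \<forall>\<phi>.
       (\<forall>s\<in>?F. rho_2 \<rho> (d i) (\<lambda>a. \<phi> (\<sigma> i s a)) (\<lambda>a. \<alpha> s (\<phi> a)) < \<delta>) \<longrightarrow>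
       (\<forall>s\<in>F'. rho_2 \<rho>' (d i) (\<lambda>a. \<phi> (\<sigma> i s a)) (\<lambda>a. \<alpha> s (\<phi> a)) < \<delta>')"
  proof (rule eventually_mono, intro allI impI ballI)
    fix i \<phi> s
    assume mult: "\<forall>t\<in>F0. \<forall>s\<in>F'. few (d i) (\<kappa>/3) (\<lambda>a. \<sigma> i (t \<otimes> s) a \<noteq> \<sigma> i t (\<sigma> i s a))"
      and \<phi>: "\<forall>s\<in>?F. rho_2 \<rho> (d i) (\<lambda>a. \<phi> (\<sigma> i s a)) (\<lambda>a. \<alpha> s (\<phi> a)) < \<delta>"
      and s: "s \<in> F'"
    have bad: "few (d i) (\<kappa>/3) (\<lambda>a. \<theta>/2 \<le> \<rho> (\<phi> (\<sigma> i t a)) (\<alpha> t (\<phi> a)))" if "t \<in> ?F" for t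
      using \<phi> that unfolding rho_2_eq_rms by (intro \<delta>(2) pm_nonneg[OF \<rho>]) auto
    show "rho_2 \<rho>' (d i) (\<lambda>a. \<phi> (\<sigma> i s a)) (\<lambda>a. \<alpha> s (\<phi> a)) < \<delta>'"
    proof (rule F0(6))
      fix t assume t: "t \<in> F0"
      have sG: "s \<in> carrier G" and tG: "t \<in> carrier G" using s t F' F0 by auto
      \<comment> \<open>Equivariance at \<open>t\<close> is applied at the permuted index
        \<open>\<sigma> i s a\<close>.\<close>
      have "few (d i) (\<kappa>/3) (\<lambda>a. \<theta>/2 \<le> \<rho> (\<phi> (\<sigma> i t (\<sigma> i s a))) (\<alpha> t (\<phi> (\<sigma> i s a))))"
        by (rule few_permute[OF sigma_permutes[OF sG] bad]) (use t in auto)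
      moreover have "few (d i) (\<kappa>/3) (\<lambda>a. \<sigma> i (t \<otimes> s) a \<noteq> \<sigma> i t (\<sigma> i s a))"
        using mult s t by blast
      moreover have "few (d i) (\<kappa>/3) (\<lambda>a. \<theta>/2 \<le> \<rho> (\<phi> (\<sigma> i (t \<otimes> s) a)) (\<alpha> (t \<otimes> s) (\<phi> a)))"
        by (rule bad) (use s t in auto)
      ultimately have "few (d i) (\<kappa>/3 + (\<kappa>/3 + \<kappa>/3))
          (\<lambda>a. \<theta>/2 \<le> \<rho> (\<phi> (\<sigma> i t (\<sigma> i s a))) (\<alpha> t (\<phi> (\<sigma> i s a))) \<or>
               \<sigma> i (t \<otimes> s) a \<noteq> \<sigma> i t (\<sigma> i s a) \<or>
               \<theta>/2 \<le> \<rho> (\<phi> (\<sigma> i (t \<otimes> s) a)) (\<alpha> (t \<otimes> s) (\<phi> a)))"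
        by (intro few_disj)
      then show "few (d i) \<kappa> (\<lambda>a. \<theta> \<le> \<rho> (\<alpha> t (\<phi> (\<sigma> i s a))) (\<alpha> t (\<alpha> s (\<phi> a))))"
      proof (rule few_mono)
        fix a assume *: "\<theta> \<le> \<rho> (\<alpha> t (\<phi> (\<sigma> i s a))) (\<alpha> t (\<alpha> s (\<phi> a)))"
        show "\<theta>/2 \<le> \<rho> (\<phi> (\<sigma> i t (\<sigma> i s a))) (\<alpha> t (\<phi> (\<sigma> i s a))) \<or>
               \<sigma> i (t \<otimes> s) a \<noteq> \<sigma> i t (\<sigma> i s a) \<or>
               \<theta>/2 \<le> \<rho> (\<phi> (\<sigma> i (t \<otimes> s) a)) (\<alpha> (t \<otimes> s) (\<phi> a))"
          using * act_mult[OF tG sG, of "\<phi> a"]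
            pm_triangle[OF \<rho>, of "\<alpha> t (\<phi> (\<sigma> i s a))" "\<alpha> t (\<alpha> s (\<phi> a))" "\<phi> (\<sigma> i t (\<sigma> i s a))"]
            pm_sym[OF \<rho>, of "\<alpha> t (\<phi> (\<sigma> i s a))" "\<phi> (\<sigma> i t (\<sigma> i s a))"]
          by (cases "\<sigma> i (t \<otimes> s) a = \<sigma> i t (\<sigma> i s a)") auto
      qed simp
    qed
  qed
  then show ?thesis
    by (rule that[of ?F \<delta>, rotated -1]) (use F0 F' \<delta> in auto)
qed

text \<open>The chain \<open>\<alpha> s (\<phi> a)\<close>, \<open>\<phi> (\<sigma> i s a)\<close>,
  \<open>\<psi> (\<sigma> i s a)\<close>, \<open>\<alpha> s (\<psi> a)\<close> has three short
  links, the middle one being the assumed closeness at a permuted index. No product of group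
  elements occurs, so the estimate holds at each \<open>i\<close> and not just eventually.\<close>

lemma distance_transfer:
  assumes \<rho>: "continuous_pseudometric \<rho>" and gen: "dyn_generating_pseudometric G \<alpha> \<rho>"
    and \<rho>': "continuous_pseudometric \<rho>'" and "0 < \<epsilon>"
  obtains F \<delta> where "finite F" "F \<noteq> {}" "F \<subseteq> carrier G" "0 < \<delta>"
    "\<And>i \<phi> \<psi>. (\<And>s. s \<in> F \<Longrightarrow> rho_2 \<rho> (d i) (\<lambda>a. \<phi> (\<sigma> i s a)) (\<lambda>a. \<alpha> s (\<phi> a)) < \<delta>) \<Longrightarrow>
       (\<And>s. s \<in> F \<Longrightarrow> rho_2 \<rho> (d i) (\<lambda>a. \<psi> (\<sigma> i s a)) (\<lambda>a. \<alpha> s (\<psi> a)) < \<delta>) \<Longrightarrow>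
       rho_2 \<rho> (d i) \<phi> \<psi> < \<delta> \<Longrightarrow> rho_2 \<rho>' (d i) \<phi> \<psi> < \<epsilon>"
proof -
  obtain F \<theta> \<kappa> where F: "finite F" "F \<noteq> {}" "F \<subseteq> carrier G" "0 < \<theta>" "0 < \<kappa>"
    "\<And>n u v. (\<And>s. s \<in> F \<Longrightarrow> few n \<kappa> (\<lambda>a. \<theta> \<le> \<rho> (\<alpha> s (u a)) (\<alpha> s (v a)))) \<Longrightarrow> rho_2 \<rho>' n u v < \<epsilon>"
    by (rule rms_small_if_orbits_close[OF \<rho> gen \<rho>' \<open>0 < \<epsilon>\<close>]) blast
  obtain \<delta> where \<delta>: "0 < \<delta>" "\<And>d u. rms d u < \<delta> \<Longrightarrow> (\<And>a. a \<in> {1..d} \<Longrightarrow> 0 \<le> u a) \<Longrightarrow>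
      few d (\<kappa>/3) (\<lambda>a. \<theta>/3 \<le> u a)"
    by (rule few_if_rms_small[of "\<theta>/3" "\<kappa>/3"]) (use F in auto)
  show ?thesis
  proof (rule that[OF F(1-3) \<delta>(1)])
    fix i \<phi> \<psi>
    assume \<phi>: "\<And>s. s \<in> F \<Longrightarrow> rho_2 \<rho> (d i) (\<lambda>a. \<phi> (\<sigma> i s a)) (\<lambda>a. \<alpha> s (\<phi> a)) < \<delta>"
      and \<psi>: "\<And>s. s \<in> F \<Longrightarrow> rho_2 \<rho> (d i) (\<lambda>a. \<psi> (\<sigma> i s a)) (\<lambda>a. \<alpha> s (\<psi> a)) < \<delta>"
      and \<phi>\<psi>: "rho_2 \<rho> (d i) \<phi> \<psi> < \<delta>"
    show "rho_2 \<rho>' (d i) \<phi> \<psi> < \<epsilon>"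
    proof (rule F(6))
      fix s assume s: "s \<in> F"
      then have sG: "s \<in> carrier G" using F by auto
      have "few (d i) (\<kappa>/3) (\<lambda>a. \<theta>/3 \<le> \<rho> (\<phi> a) (\<psi> a))"
        using \<phi>\<psi> unfolding rho_2_eq_rms by (intro \<delta>(2) pm_nonneg[OF \<rho>])
      then have "few (d i) (\<kappa>/3) (\<lambda>a. \<theta>/3 \<le> \<rho> (\<phi> (\<sigma> i s a)) (\<psi> (\<sigma> i s a)))"
        by (rule few_permute[OF sigma_permutes[OF sG]])
      moreover have "few (d i) (\<kappa>/3) (\<lambda>a. \<theta>/3 \<le> \<rho> (\<phi> (\<sigma> i s a)) (\<alpha> s (\<phi> a)))"
        "few (d i) (\<kappa>/3) (\<lambda>a. \<theta>/3 \<le> \<rho> (\<psi> (\<sigma> i s a)) (\<alpha> s (\<psi> a)))"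
        using \<phi>[OF s] \<psi>[OF s] unfolding rho_2_eq_rms by (intro \<delta>(2) pm_nonneg[OF \<rho>]; simp)+
      ultimately have "few (d i) (\<kappa>/3 + (\<kappa>/3 + \<kappa>/3))
          (\<lambda>a. \<theta>/3 \<le> \<rho> (\<phi> (\<sigma> i s a)) (\<psi> (\<sigma> i s a)) \<or> \<theta>/3 \<le> \<rho> (\<phi> (\<sigma> i s a)) (\<alpha> s (\<phi> a)) \<or>
               \<theta>/3 \<le> \<rho> (\<psi> (\<sigma> i s a)) (\<alpha> s (\<psi> a)))"
        by (intro few_disj)
      then show "few (d i) \<kappa> (\<lambda>a. \<theta> \<le> \<rho> (\<alpha> s (\<phi> a)) (\<alpha> s (\<psi> a)))"
      proof (rule few_mono)
        fix a assume *: "\<theta> \<le> \<rho> (\<alpha> s (\<phi> a)) (\<alpha> s (\<psi> a))"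
        show "\<theta>/3 \<le> \<rho> (\<phi> (\<sigma> i s a)) (\<psi> (\<sigma> i s a)) \<or> \<theta>/3 \<le> \<rho> (\<phi> (\<sigma> i s a)) (\<alpha> s (\<phi> a)) \<or>
               \<theta>/3 \<le> \<rho> (\<psi> (\<sigma> i s a)) (\<alpha> s (\<psi> a))"
          using * pm_triangle[OF \<rho>, of "\<alpha> s (\<phi> a)" "\<alpha> s (\<psi> a)" "\<phi> (\<sigma> i s a)"]
            pm_triangle[OF \<rho>, of "\<phi> (\<sigma> i s a)" "\<alpha> s (\<psi> a)" "\<psi> (\<sigma> i s a)"]
            pm_sym[OF \<rho>, of "\<alpha> s (\<phi> a)" "\<phi> (\<sigma> i s a)"]
          by linarith
      qed simp
    qed
  qed
qed

text \<open>Generation enters twice: \<open>gen\<close> bounds \<rho>'-distances of almost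
  equivariant maps by \<rho>-distances, and \<open>gen'\<close> turns almost equivariance for
  \<rho>' into that for \<rho>. Moments do not involve a pseudometric, so \<open>L\<close> stays the
  same.\<close>

lemma h_2_le_of_generating:
  assumes \<rho>: "continuous_pseudometric \<rho>" and gen: "dyn_generating_pseudometric G \<alpha> \<rho>"
    and \<rho>': "continuous_pseudometric \<rho>'" and gen': "dyn_generating_pseudometric G \<alpha> \<rho>'"
  shows "h_2 G \<alpha> \<mu> d \<sigma> \<rho>' \<le> h_2 G \<alpha> \<mu> d \<sigma> \<rho>"
  unfolding h_2_def h_spatial_def
proof (rule entropy_le)
  fix \<epsilon> :: real assume "0 < \<epsilon>"
  then obtain F0 \<delta>0 where F0: "finite F0" "F0 \<noteq> {}" "F0 \<subseteq> carrier G" "0 < \<delta>0"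
    "\<And>i \<phi> \<psi>. (\<And>s. s \<in> F0 \<Longrightarrow> rho_2 \<rho> (d i) (\<lambda>a. \<phi> (\<sigma> i s a)) (\<lambda>a. \<alpha> s (\<phi> a)) < \<delta>0) \<Longrightarrow>
       (\<And>s. s \<in> F0 \<Longrightarrow> rho_2 \<rho> (d i) (\<lambda>a. \<psi> (\<sigma> i s a)) (\<lambda>a. \<alpha> s (\<psi> a)) < \<delta>0) \<Longrightarrow>
       rho_2 \<rho> (d i) \<phi> \<psi> < \<delta>0 \<Longrightarrow> rho_2 \<rho>' (d i) \<phi> \<psi> < \<epsilon>"
    by (rule distance_transfer[OF \<rho> gen \<rho>']) blast
  show "\<exists>\<epsilon>'>0. \<forall>F\<in>{F. finite F \<and> F \<noteq> {} \<and> F \<subseteq> carrier G}. \<forall>L\<in>{L. finite L \<and> L \<subseteq> CX}. \<forall>\<delta>\<in>{0<..}.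
    \<exists>F'\<in>{F. finite F \<and> F \<noteq> {} \<and> F \<subseteq> carrier G}. \<exists>L'\<in>{L. finite L \<and> L \<subseteq> CX}. \<exists>\<delta>'\<in>{0<..}.
    \<forall>\<^sub>F i in sequentially. Map_mu \<alpha> \<mu> \<rho>' F' L' \<delta>' (d i) (\<sigma> i) \<subseteq> Map_mu \<alpha> \<mu> \<rho> F L \<delta> (d i) (\<sigma> i) \<and>
      (\<forall>x\<in>Map_mu \<alpha> \<mu> \<rho>' F' L' \<delta>' (d i) (\<sigma> i). \<forall>y\<in>Map_mu \<alpha> \<mu> \<rho>' F' L' \<delta>' (d i) (\<sigma> i).
        \<epsilon> \<le> rho_2 \<rho>' (d i) x y \<longrightarrow> \<epsilon>' \<le> rho_2 \<rho> (d i) x y)"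
  proof (intro exI[of _ \<delta>0] conjI ballI)
    fix F and L :: "('x \<Rightarrow> complex) set" and \<delta>
    assume k: "F \<in> {F. finite F \<and> F \<noteq> {} \<and> F \<subseteq> carrier G}" "L \<in> {L. finite L \<and> L \<subseteq> CX}" "\<delta> \<in> {0::real<..}"
    \<comment> \<open>Equivariance is also demanded on \<open>F0\<close> at level
      \<open>\<delta>0\<close>, because distances are comparable only for maps that satisfy it
      there.\<close>
    obtain F' \<delta>1 where F': "finite F'" "F' \<noteq> {}" "F' \<subseteq> carrier G" "0 < \<delta>1"
      "\<forall>\<^sub>F i in sequentially. \<forall>\<phi>.
       (\<forall>s\<in>F'. rho_2 \<rho>' (d i) (\<lambda>a. \<phi> (\<sigma> i s a)) (\<lambda>a. \<alpha> s (\<phi> a)) < \<delta>1) \<longrightarrow>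
       (\<forall>s\<in>F \<union> F0. rho_2 \<rho> (d i) (\<lambda>a. \<phi> (\<sigma> i s a)) (\<lambda>a. \<alpha> s (\<phi> a)) < min \<delta> \<delta>0)"
      by (rule equivariance_transfer[OF \<rho>' gen' \<rho>, of "min \<delta> \<delta>0" "F \<union> F0"]) (use k F0 in auto)
    let ?Y = "\<lambda>i. Map_mu \<alpha> \<mu> \<rho>' F' L (min \<delta> \<delta>1) (d i) (\<sigma> i)"
    have "\<forall>\<^sub>F i in sequentially. ?Y i \<subseteq> Map_mu \<alpha> \<mu> \<rho> F L \<delta> (d i) (\<sigma> i) \<and>
      (\<forall>x\<in>?Y i. \<forall>y\<in>?Y i. \<epsilon> \<le> rho_2 \<rho>' (d i) x y \<longrightarrow> \<delta>0 \<le> rho_2 \<rho> (d i) x y)"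
      using F'(5)
    proof eventually_elim
      case (elim i)
      have *: "rho_2 \<rho> (d i) (\<lambda>a. \<phi> (\<sigma> i s a)) (\<lambda>a. \<alpha> s (\<phi> a)) < min \<delta> \<delta>0"
        if "\<phi> \<in> ?Y i" "s \<in> F \<union> F0" for \<phi> s
        using elim that unfolding Map_mu_def by auto
      have "\<delta>0 \<le> rho_2 \<rho> (d i) x y" if "x \<in> ?Y i" "y \<in> ?Y i" "\<epsilon> \<le> rho_2 \<rho>' (d i) x y" for x y
      proof (rule ccontr)
        assume "\<not> ?thesis"
        then have "rho_2 \<rho>' (d i) x y < \<epsilon>"
          using *[OF that(1)] *[OF that(2)] by (intro F0(5)) auto
        then show False using that(3) by simp
      qed
      moreover have "?Y i \<subseteq> Map_mu \<alpha> \<mu> \<rho> F L \<delta> (d i) (\<sigma> i)"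
        using * unfolding Map_mu_def by auto
      ultimately show ?case by blast
    qed
    then show "\<exists>F'\<in>{F. finite F \<and> F \<noteq> {} \<and> F \<subseteq> carrier G}. \<exists>L'\<in>{L. finite L \<and> L \<subseteq> CX}. \<exists>\<delta>'\<in>{0<..}.
    \<forall>\<^sub>F i in sequentially. Map_mu \<alpha> \<mu> \<rho>' F' L' \<delta>' (d i) (\<sigma> i) \<subseteq> Map_mu \<alpha> \<mu> \<rho> F L \<delta> (d i) (\<sigma> i) \<and>
      (\<forall>x\<in>Map_mu \<alpha> \<mu> \<rho>' F' L' \<delta>' (d i) (\<sigma> i). \<forall>y\<in>Map_mu \<alpha> \<mu> \<rho>' F' L' \<delta>' (d i) (\<sigma> i).
        \<epsilon> \<le> rho_2 \<rho>' (d i) x y \<longrightarrow> \<delta>0 \<le> rho_2 \<rho> (d i) x y)"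
      using F' k by (intro bexI[of _ F'] bexI[of _ L] bexI[of _ "min \<delta> \<delta>1"]) auto
  qed (use F0 in auto)
qed

end

section \<open>Continuous functions\<close>

lemma
  shows CX_const: "(\<lambda>x. c) \<in> CX"
    and CX_scale: "f \<in> CX \<Longrightarrow> (\<lambda>x. c * f x) \<in> CX"
    and CX_add: "f \<in> CX \<Longrightarrow> g \<in> CX \<Longrightarrow> (\<lambda>x. f x + g x) \<in> CX"
    and CX_mult: "f \<in> CX \<Longrightarrow> g \<in> CX \<Longrightarrow> (\<lambda>x. f x * g x) \<in> CX"
    and CX_cnj: "f \<in> CX \<Longrightarrow> (\<lambda>x. cnj (f x)) \<in> CX"
  by (auto simp: CX_def intro!: continuous_intros)

lemma CX_prod: "(\<And>k. k \<in> K \<Longrightarrow> f k \<in> CX) \<Longrightarrow> (\<lambda>x. \<Prod>k\<in>K. f k x) \<in> CX"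
  by (auto simp: CX_def intro!: continuous_intros)

lemma CX_uniform_closed:
  assumes "\<And>e. 0 < e \<Longrightarrow> \<exists>g\<in>CX. \<forall>x. cmod (f x - g x) < e"
  shows "f \<in> CX"
proof -
  have "\<exists>g\<in>CX. \<forall>x. cmod (f x - g x) < 1 / (real n + 1)" for n
    by (rule assms) simp
  then obtain g where g: "\<And>n. g n \<in> CX" "\<And>n x. cmod (f x - g n x) < 1 / (real n + 1)"
    by metis
  have lim: "uniform_limit UNIV g f sequentially"
  proof (rule uniform_limitI)
    fix e :: real assume "0 < e"
    then obtain N where N: "1 / (real N + 1) < e"
      using reals_Archimedean[of e] by (auto simp: inverse_eq_divide add.commute)
    have "dist (g n x) (f x) < e" if "N \<le> n" for n x
    proof -
      have "1 / (real n + 1) \<le> 1 / (real N + 1)" using that by (simp add: frac_le)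
      then show ?thesis using g(2)[of x n] N by (simp add: dist_norm norm_minus_commute)
    qed
    then show "\<forall>\<^sub>F n in sequentially. \<forall>x\<in>UNIV. dist (g n x) (f x) < e"
      unfolding eventually_sequentially by blast
  qed
  show ?thesis
    using uniform_limit_theorem[OF _ lim] g(1) by (simp add: CX_def)
qed

lemma CX_bounded:
  assumes "f \<in> CX" "compact (UNIV :: 'x::topological_space set)"
  obtains B where "0 \<le> B" "\<And>x :: 'x. cmod (f x) \<le> B"
proof -
  have "bounded (range f)"
    using assms by (intro compact_imp_bounded compact_continuous_image) (auto simp: CX_def)
  then obtain B where "\<And>x. cmod (f x) \<le> B" by (auto simp: bounded_iff)
  then show ?thesis using that[of "max 0 B"] by (simp add: le_max_iff_disj)
qed

section \<open>Unital homomorphisms are evaluations\<close>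

text \<open>If \<open>\<xi>\<close> were not an evaluation, its kernel would contain a function without zeros, of the form
  \<open>\<Sum>\<^sub>x |g\<^sub>x|\<^sup>2\<close>.\<close>

lemma unital_hom_is_evaluation:
  fixes \<xi> :: "('x::topological_space \<Rightarrow> complex) \<Rightarrow> complex"
  assumes "compact (UNIV :: 'x set)"
    and one: "\<xi> (\<lambda>x. 1) = 1"
    and scale: "\<And>f c. f \<in> CX \<Longrightarrow> \<xi> (\<lambda>x. c * f x) = c * \<xi> f"
    and add: "\<And>f g. f \<in> CX \<Longrightarrow> g \<in> CX \<Longrightarrow> \<xi> (\<lambda>x. f x + g x) = \<xi> f + \<xi> g"
    and mult: "\<And>f g. f \<in> CX \<Longrightarrow> g \<in> CX \<Longrightarrow> \<xi> (\<lambda>x. f x * g x) = \<xi> f * \<xi> g"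
  shows "\<exists>x. \<forall>f\<in>CX. \<xi> f = f x"
proof (rule ccontr)
  assume "\<not> ?thesis"
  then obtain f where f: "\<And>x. f x \<in> CX" "\<And>x. \<xi> (f x) \<noteq> f x x" by metis
  \<comment> \<open>The constant is written as a multiple of 1 so that linearity and unitality of
    \<xi> show \<open>\<xi> (g x) = 0\<close>.\<close>
  define g where "g x = (\<lambda>y. f x y + (- \<xi> (f x)) * 1)" for x
  have gC: "g x \<in> CX" for x
    unfolding g_def by (intro CX_add CX_scale CX_const f)
  have g0: "\<xi> (g x) = 0" for x
    unfolding g_def by (subst add[OF f(1) CX_scale[OF CX_const]], subst scale[OF CX_const]) (simp add: one)
  have "open {y. g x y \<noteq> 0}" for x
    using gC[of x] unfolding CX_def by (intro open_Collect_neq continuous_intros) auto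
  moreover have "g y y \<noteq> 0" for y
    using f(2)[of y] by (simp add: g_def)
  then have "UNIV \<subseteq> (\<Union>x\<in>UNIV. {y. g x y \<noteq> 0})" by blast
  ultimately obtain C where C: "finite C" "UNIV \<subseteq> (\<Union>x\<in>C. {y. g x y \<noteq> 0})"
    using compactE_image[OF assms(1), of UNIV "\<lambda>x. {y. g x y \<noteq> 0}"] by metis
  \<comment> \<open>Nothing is assumed about \<xi> and conjugation: the factor \<open>g x\<close>
    alone puts each product into the kernel.\<close>
  define h where "h K = (\<lambda>y. \<Sum>x\<in>K. cnj (g x y) * g x y)" for K
  have h: "h K \<in> CX \<and> \<xi> (h K) = 0" if "finite K" for K
    using that
  proof (induction K rule: finite_induct)
    case empty
    show ?case using scale[OF CX_const, of 0 1] CX_const[of 0] by (simp add: h_def)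
  next
    case (insert x K)
    have "h (insert x K) = (\<lambda>y. cnj (g x y) * g x y + h K y)"
      using insert by (simp add: h_def)
    then show ?case
      using add[OF CX_mult[OF CX_cnj[OF gC] gC], of "h K" x x] insert
        mult[OF CX_cnj[OF gC] gC, of x x] g0 CX_add[OF CX_mult[OF CX_cnj[OF gC] gC]] by simp
  qed
  have h_pos: "h C y \<noteq> 0" for y
  proof -
    obtain x where x: "x \<in> C" "g x y \<noteq> 0" using C(2) by auto
    have "h C y = complex_of_real (\<Sum>x\<in>C. (cmod (g x y))\<^sup>2)"
      unfolding h_def of_real_sum
      by (intro sum.cong refl) (metis complex_norm_square mult.commute)
    moreover have "(\<Sum>x\<in>C. (cmod (g x y))\<^sup>2) > 0"
      using x C(1) by (intro sum_pos2[of _ x]) auto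
    ultimately show ?thesis by (metis less_irrefl of_real_eq_0_iff)
  qed
  have "(\<lambda>y. 1 / h C y) \<in> CX"
    using h[OF C(1)] h_pos unfolding CX_def by (auto intro!: continuous_intros)
  \<comment> \<open>The kernel is an ideal, and now it contains an invertible function, hence
    1.\<close>
  have "\<xi> (\<lambda>y. 1 / h C y * h C y) = 0"
    unfolding mult[OF \<open>(\<lambda>y. 1 / h C y) \<in> CX\<close> conjunct1[OF h[OF C(1)]]]
    using h[OF C(1)] by simp
  then show False using h_pos one by simp
qed

section \<open>From homomorphisms to maps into the space\<close>

lemma Collect_mem_image: "{y \<in> f ` A. P y} = f ` {x \<in> A. P (f x)}"
  by auto

text \<open>The two restrictions match the extensional encoding of \<open>unital_homs\<close>, so
  that evaluations are literally its elements.\<close>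

definition eval_hom :: "nat \<Rightarrow> (nat \<Rightarrow> 'x::topological_space) \<Rightarrow> ('x \<Rightarrow> complex) \<Rightarrow> nat \<Rightarrow> complex" where
  "eval_hom d x = (\<lambda>f\<in>CX. \<lambda>a\<in>{1..d}. f (x a))"

lemma eval_hom_apply: "f \<in> CX \<Longrightarrow> a \<in> {1..d} \<Longrightarrow> eval_hom d x f a = f (x a)"
  by (simp add: eval_hom_def)

lemma unital_homs_eq_evaluations:
  assumes "compact (UNIV :: 'x::topological_space set)"
  shows "unital_homs d = eval_hom d ` ({1..d} \<rightarrow>\<^sub>E (UNIV :: 'x set))"
proof (intro equalityI subsetI)
  fix \<phi> :: "('x \<Rightarrow> complex) \<Rightarrow> nat \<Rightarrow> complex"
  assume \<phi>: "\<phi> \<in> unital_homs d"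
  have "\<exists>x. \<forall>f\<in>CX. \<phi> f a = f x" if "a \<in> {1..d}" for a
    using \<phi> that unfolding unital_homs_def
    by (intro unital_hom_is_evaluation[where \<xi> = "\<lambda>f. \<phi> f a", OF assms]) auto
  then obtain x where x: "\<And>a f. a \<in> {1..d} \<Longrightarrow> f \<in> CX \<Longrightarrow> \<phi> f a = f (x a)" by metis
  have "\<phi> = eval_hom d (restrict x {1..d})"
  proof (intro ext)
    fix f a
    have "\<phi> \<in> CX \<rightarrow>\<^sub>E ({1..d} \<rightarrow>\<^sub>E UNIV)" using \<phi> by (simp add: unital_homs_def)
    then have *: "f \<notin> CX \<Longrightarrow> \<phi> f = undefined" "f \<in> CX \<Longrightarrow> a \<notin> {1..d} \<Longrightarrow> \<phi> f a = undefined"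
      by (auto simp: PiE_def extensional_def Pi_def)
    show "\<phi> f a = eval_hom d (restrict x {1..d}) f a"
    proof (cases "f \<in> CX \<and> a \<in> {1..d}")
      case True then show ?thesis using x by (simp add: eval_hom_def)
    next
      case False then show ?thesis using * by (auto simp: eval_hom_def)
    qed
  qed
  then show "\<phi> \<in> eval_hom d ` ({1..d} \<rightarrow>\<^sub>E UNIV)" by auto
next
  fix \<phi> :: "('x \<Rightarrow> complex) \<Rightarrow> nat \<Rightarrow> complex"
  assume "\<phi> \<in> eval_hom d ` ({1..d} \<rightarrow>\<^sub>E UNIV)"
  then obtain x where "\<phi> = eval_hom d x" by auto
  then show "\<phi> \<in> unital_homs d"
    by (auto simp: unital_homs_def eval_hom_def CX_const CX_scale CX_add CX_mult)
qed

text \<open>The conditions of \<open>Hom_mu\<close> read on the representing maps;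
  \<open>inv s\<close> comes from the convention for the action on functions.\<close>

definition Hom_maps ::
  "('g, 'r) monoid_scheme \<Rightarrow> ('g \<Rightarrow> 'x \<Rightarrow> 'x::topological_space) \<Rightarrow> 'x measure \<Rightarrow>
   (nat \<Rightarrow> 'x \<Rightarrow> complex) \<Rightarrow> 'g set \<Rightarrow> nat \<Rightarrow> real \<Rightarrow> nat \<Rightarrow> ('g \<Rightarrow> nat \<Rightarrow> nat) \<Rightarrow> (nat \<Rightarrow> 'x) set" where
  "Hom_maps G \<alpha> \<mu> p F m \<delta> d \<sigma> = {x \<in> {1..d} \<rightarrow>\<^sub>E UNIV.
     (\<forall>f\<in>S_products G \<alpha> p F m. cmod ((\<Sum>a\<in>{1..d}. f (x a)) / of_nat d - (\<integral>x. f x \<partial>\<mu>)) < \<delta>) \<and>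
     (\<forall>s\<in>F. \<forall>n<m.
        rms d (\<lambda>a. cmod (p n (\<alpha> (inv\<^bsub>G\<^esub> s) (x a)) - p n (x (inv_into {1..d} (\<sigma> s) a)))) < \<delta>)}"

text \<open>The pullback of \<open>rho_S2\<close>. It is a sum of quadratic means, whereas
  \<open>rho_2 (seq_pm p)\<close> will be a quadratic mean of sums.\<close>

definition seq_dist :: "(nat \<Rightarrow> 'x \<Rightarrow> complex) \<Rightarrow> nat \<Rightarrow> (nat \<Rightarrow> 'x) \<Rightarrow> (nat \<Rightarrow> 'x) \<Rightarrow> real" where
  "seq_dist p d x y = (\<Sum>n. (1/2) ^ Suc n * rms d (\<lambda>a. cmod (p n (x a) - p n (y a))))"

lemma S_productsE:
  assumes "h \<in> S_products G \<alpha> p F m"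
  obtains j s f where "h = (\<lambda>x. \<Prod>k<j. induced G \<alpha> (s k) (f k) x)" "1 \<le> j" "j \<le> m"
    "\<forall>k<j. s k \<in> F \<and> f k \<in> p ` {..<m}"
proof -
  have "\<exists>j s f. h = (\<lambda>x. \<Prod>k<j. induced G \<alpha> (s k) (f k) x) \<and>
      1 \<le> j \<and> j \<le> m \<and> (\<forall>k<j. s k \<in> F \<and> f k \<in> p ` {..<m})"
    using assms unfolding S_products_def by (rule CollectD)
  then show ?thesis using that by (elim exE conjE)
qed

lemma S_productsI:
  assumes "1 \<le> j" "j \<le> m" "\<forall>k<j. s k \<in> F \<and> f k \<in> p ` {..<m}"
  shows "(\<lambda>x. \<Prod>k<j. induced G \<alpha> (s k) (f k) x) \<in> S_products G \<alpha> p F m"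
  unfolding S_products_def
  by (rule CollectI, rule exI[of _ j], rule exI[of _ s], rule exI[of _ f]) (use assms in simp)

context sofic_pmp_action
begin

lemma induced_CX: "s \<in> carrier G \<Longrightarrow> f \<in> CX \<Longrightarrow> induced G \<alpha> s f \<in> CX"
  using continuous_on_compose2[OF _ act_continuous[of "inv s"], of UNIV f]
  by (simp add: CX_def induced_def)

lemma S_products_CX:
  assumes "F \<subseteq> carrier G" "range p \<subseteq> CX"
  shows "S_products G \<alpha> p F m \<subseteq> CX"
proof
  fix f assume "f \<in> S_products G \<alpha> p F m"
  then show "f \<in> CX"
  proof (rule S_productsE)
    fix j s g
    assume "f = (\<lambda>x. \<Prod>k<j. induced G \<alpha> (s k) (g k) x)" and "\<forall>k<j. s k \<in> F \<and> g k \<in> p ` {..<m}"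
    moreover have "p ` {..<m} \<subseteq> CX" using assms(2) by blast
    ultimately show "f \<in> CX" using assms(1) by (auto intro!: CX_prod induced_CX)
  qed
qed

lemma Hom_mu_eq_evaluations:
  assumes F: "F \<subseteq> carrier G" and p: "range p \<subseteq> CX"
  shows "Hom_mu G \<alpha> \<mu> p F m \<delta> (d i) (\<sigma> i) = eval_hom (d i) ` Hom_maps G \<alpha> \<mu> p F m \<delta> (d i) (\<sigma> i)"
proof -
  have sum: "(\<Sum>a\<in>{1..d i}. eval_hom (d i) x f a) = (\<Sum>a\<in>{1..d i}. f (x a))"
    if "f \<in> S_products G \<alpha> p F m" for f x
  proof -
    have "f \<in> CX" using S_products_CX[OF F p, of m] that by blast
    then show ?thesis by (intro sum.cong eval_hom_apply) auto
  qed
  have norm: "l2_norm (d i) (\<lambda>a. eval_hom (d i) x (induced G \<alpha> s (p n)) a -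
      eval_hom (d i) x (p n) (inv_into {1..d i} (\<sigma> i s) a))
    = rms (d i) (\<lambda>a. cmod (p n (\<alpha> (inv s) (x a)) - p n (x (inv_into {1..d i} (\<sigma> i s) a))))"
    if "s \<in> F" for s n x
    unfolding l2_norm_eq_rms
  proof (rule rms_cong)
    fix a assume a: "a \<in> {1..d i}"
    have "s \<in> carrier G" using that F by auto
    \<comment> \<open>The permuted index stays in the range where \<open>eval_hom\<close> evaluates
      and is not \<open>undefined\<close>.\<close>
    moreover from this have "inv_into {1..d i} (\<sigma> i s) a \<in> {1..d i}"
      using a permutes_image[OF sigma_permutes] by (intro inv_into_into) auto
    ultimately show "cmod (eval_hom (d i) x (induced G \<alpha> s (p n)) a -
        eval_hom (d i) x (p n) (inv_into {1..d i} (\<sigma> i s) a))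
      = cmod (p n (\<alpha> (inv s) (x a)) - p n (x (inv_into {1..d i} (\<sigma> i s) a)))"
      using a p by (simp add: eval_hom_apply induced_CX range_subsetD) (simp add: induced_def)
  qed
  show ?thesis
    unfolding Hom_mu_def Hom_maps_def unital_homs_eq_evaluations[OF compact_X] Collect_mem_image
    by (intro arg_cong[where f = "image (eval_hom (d i))"] Collect_cong conj_cong refl)
       (auto simp: sum norm simp del: One_nat_def)
qed

lemma rho_S2_eval_hom:
  assumes "range p \<subseteq> CX"
  shows "rho_S2 n p (eval_hom n x) (eval_hom n y) = seq_dist p n x y"
  unfolding rho_S2_def seq_dist_def l2_norm_eq_rms
  using assms by (intro arg_cong[where f = suminf] ext arg_cong2[where f = "(*)"] refl rms_cong)
    (simp add: eval_hom_apply range_subsetD)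

lemma h_bar_eq_Hom_maps:
  assumes p: "range p \<subseteq> CX"
  shows "h_bar G \<alpha> \<mu> d \<sigma> p =
     (SUP \<epsilon>\<in>{0<..}. INF F\<in>{F. finite F \<and> F \<noteq> {} \<and> F \<subseteq> carrier G}. INF m\<in>{1..}. INF \<delta>\<in>{0<..}.
        limsup (\<lambda>i. log_enat (sep_num \<epsilon> (Hom_maps G \<alpha> \<mu> p F m \<delta> (d i) (\<sigma> i)) (seq_dist p (d i)))
                    / ereal (real (d i))))"
  unfolding h_bar_def
proof (intro SUP_cong INF_cong refl arg_cong[where f = limsup] ext)
  fix \<epsilon> :: real and F m and \<delta> :: real and i
  assume \<epsilon>: "\<epsilon> \<in> {0<..}" and F: "F \<in> {F. finite F \<and> F \<noteq> {} \<and> F \<subseteq> carrier G}"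
  let ?Y = "Hom_maps G \<alpha> \<mu> p F m \<delta> (d i) (\<sigma> i)"
  have z: "rho_S2 (d i) p (eval_hom (d i) y) (eval_hom (d i) y) < \<epsilon>" for y :: "nat \<Rightarrow> 'x"
    using \<epsilon> by (simp add: rho_S2_eval_hom[OF p] seq_dist_def rms_def)
  have "sep_num \<epsilon> (eval_hom (d i) ` ?Y) (rho_S2 (d i) p)
      = sep_num \<epsilon> ?Y (\<lambda>x y. rho_S2 (d i) p (eval_hom (d i) x) (eval_hom (d i) y))"
    by (rule sep_num_image) (use \<epsilon> z in auto)
  also have "(\<lambda>x y. rho_S2 (d i) p (eval_hom (d i) x) (eval_hom (d i) y)) = seq_dist p (d i)"
    by (intro ext rho_S2_eval_hom p)
  finally have "sep_num \<epsilon> (Hom_mu G \<alpha> \<mu> p F m \<delta> (d i) (\<sigma> i)) (rho_S2 (d i) p)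
      = sep_num \<epsilon> ?Y (seq_dist p (d i))"
    using Hom_mu_eq_evaluations[OF _ p, of F] F by simp
  then show "log_enat (sep_num \<epsilon> (Hom_mu G \<alpha> \<mu> p F m \<delta> (d i) (\<sigma> i)) (rho_S2 (d i) p)) / ereal (real (d i))
    = log_enat (sep_num \<epsilon> (Hom_maps G \<alpha> \<mu> p F m \<delta> (d i) (\<sigma> i)) (seq_dist p (d i))) / ereal (real (d i))"
    by simp
qed

end

section \<open>Moments of generating sequences\<close>

text \<open>Unlike \<open>S_products\<close>, these include the empty product, as a unital algebra
  requires, and have no bound on their length or on the indices involved.\<close>

inductive_set orbit_monomials ::
  "('g, 'r) monoid_scheme \<Rightarrow> ('g \<Rightarrow> 'x \<Rightarrow> 'x) \<Rightarrow> (nat \<Rightarrow> 'x \<Rightarrow> complex) \<Rightarrow> ('x \<Rightarrow> complex) set"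
  for G :: "('g, 'r) monoid_scheme" and \<alpha> :: "'g \<Rightarrow> 'x \<Rightarrow> 'x" and p :: "nat \<Rightarrow> 'x \<Rightarrow> complex" where
  mono_one: "(\<lambda>x. 1) \<in> orbit_monomials G \<alpha> p"
| mono_mult: "g \<in> orbit_monomials G \<alpha> p \<Longrightarrow> s \<in> carrier G \<Longrightarrow>
    (\<lambda>x. g x * induced G \<alpha> s (p n) x) \<in> orbit_monomials G \<alpha> p"

text \<open>The unital algebra generated by all translates of the sequence; products need no clause,
  since monomials are already closed under them.\<close>

inductive_set orbit_span ::
  "('g, 'r) monoid_scheme \<Rightarrow> ('g \<Rightarrow> 'x \<Rightarrow> 'x) \<Rightarrow> (nat \<Rightarrow> 'x \<Rightarrow> complex) \<Rightarrow> ('x \<Rightarrow> complex) set"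
  for G :: "('g, 'r) monoid_scheme" and \<alpha> :: "'g \<Rightarrow> 'x \<Rightarrow> 'x" and p :: "nat \<Rightarrow> 'x \<Rightarrow> complex" where
  span_mono: "g \<in> orbit_monomials G \<alpha> p \<Longrightarrow> g \<in> orbit_span G \<alpha> p"
| span_add: "g \<in> orbit_span G \<alpha> p \<Longrightarrow> h \<in> orbit_span G \<alpha> p \<Longrightarrow> (\<lambda>x. g x + h x) \<in> orbit_span G \<alpha> p"
| span_scale: "g \<in> orbit_span G \<alpha> p \<Longrightarrow> (\<lambda>x. c * g x) \<in> orbit_span G \<alpha> p"

lemma orbit_monomials_mult:
  assumes "h \<in> orbit_monomials G \<alpha> p" "g \<in> orbit_monomials G \<alpha> p"
  shows "(\<lambda>x. g x * h x) \<in> orbit_monomials G \<alpha> p"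
  using assms(1)
proof (induction h rule: orbit_monomials.induct)
  case mono_one then show ?case using assms(2) by simp
next
  case (mono_mult h s n)
  then show ?case
    using orbit_monomials.mono_mult[of "\<lambda>x. g x * h x" G \<alpha> p s n] by (simp add: mult.assoc)
qed

lemma orbit_span_mult:
  assumes "g \<in> orbit_span G \<alpha> p" "h \<in> orbit_span G \<alpha> p"
  shows "(\<lambda>x. g x * h x) \<in> orbit_span G \<alpha> p"
  using assms(1)
proof (induction g rule: orbit_span.induct)
  case (span_mono g)
  show ?case using assms(2)
  proof (induction h rule: orbit_span.induct)
    case (span_mono h)
    then show ?case using \<open>g \<in> orbit_monomials G \<alpha> p\<close>
      by (intro orbit_span.span_mono orbit_monomials_mult)
  next
    case (span_add h h')
    then show ?case using orbit_span.span_add[OF span_add.IH] by (simp add: distrib_left)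
  next
    case (span_scale h c)
    then show ?case using orbit_span.span_scale[OF span_scale.IH, of c] by (simp add: mult.left_commute)
  qed
next
  case (span_add g g')
  then show ?case using orbit_span.span_add[OF span_add.IH] by (simp add: distrib_right)
next
  case (span_scale g c)
  then show ?case using orbit_span.span_scale[OF span_scale.IH, of c] by (simp add: mult.assoc)
qed

text \<open>Real generators make every monomial its own conjugate, so only scalars change.\<close>

lemma orbit_span_cnj:
  assumes "\<And>n x. p n x \<in> \<real>" "g \<in> orbit_span G \<alpha> p"
  shows "(\<lambda>x. cnj (g x)) \<in> orbit_span G \<alpha> p"
  using assms(2)
proof (induction g rule: orbit_span.induct)
  case (span_mono g)
  then have "(\<lambda>x. cnj (g x)) = g"
  proof (induction g rule: orbit_monomials.induct)
    case (mono_mult g s n)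
    then show ?case using assms(1) by (auto simp: fun_eq_iff induced_def Reals_cnj_iff)
  qed simp
  then show ?case using span_mono by (simp add: orbit_span.span_mono)
next
  case (span_add g g')
  then show ?case using orbit_span.span_add[OF span_add.IH] by simp
next
  case (span_scale g c)
  then show ?case using orbit_span.span_scale[OF span_scale.IH, of "cnj c"] by simp
qed

lemma S_products_mono:
  assumes "F \<subseteq> F'" "m \<le> m'"
  shows "S_products G \<alpha> p F m \<subseteq> S_products G \<alpha> p F' m'"
proof
  fix h assume "h \<in> S_products G \<alpha> p F m"
  then obtain j s f where h: "h = (\<lambda>x. \<Prod>k<j. induced G \<alpha> (s k) (f k) x)"
    and j: "1 \<le> j" "j \<le> m" "\<forall>k<j. s k \<in> F \<and> f k \<in> p ` {..<m}"
    by (rule S_productsE)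
  have "p ` {..<m} \<subseteq> p ` {..<m'}" using assms by (intro image_mono) auto
  then show "h \<in> S_products G \<alpha> p F' m'"
    unfolding h using j assms by (intro S_productsI) auto
qed

text \<open>Makes the products admissible as a finite set \<open>L\<close> of test functions. A
  product sees only the first \<open>j\<close> values of its two choice functions, and restricted to
  these there are finitely many choices.\<close>

lemma finite_S_products:
  assumes "finite F" shows "finite (S_products G \<alpha> p F m)"
proof -
  let ?E = "\<lambda>j (s, f). (\<lambda>x. \<Prod>k<j. induced G \<alpha> (s k) (f k) x)"
  have "S_products G \<alpha> p F m \<subseteq>
    (\<Union>j\<in>{..m}. ?E j ` (({..<j} \<rightarrow>\<^sub>E F) \<times> ({..<j} \<rightarrow>\<^sub>E p ` {..<m})))"
  proof
    fix h assume "h \<in> S_products G \<alpha> p F m"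
    then obtain j s f where h: "h = (\<lambda>x. \<Prod>k<j. induced G \<alpha> (s k) (f k) x)"
      and j: "j \<le> m" "\<forall>k<j. s k \<in> F \<and> f k \<in> p ` {..<m}"
      by (rule S_productsE)
    have "h = ?E j (restrict s {..<j}, restrict f {..<j})"
      unfolding h by (auto simp: fun_eq_iff intro!: prod.cong)
    moreover have "(restrict s {..<j}, restrict f {..<j}) \<in> ({..<j} \<rightarrow>\<^sub>E F) \<times> ({..<j} \<rightarrow>\<^sub>E p ` {..<m})"
      using j by auto
    ultimately show "h \<in> (\<Union>j\<in>{..m}. ?E j ` (({..<j} \<rightarrow>\<^sub>E F) \<times> ({..<j} \<rightarrow>\<^sub>E p ` {..<m})))"
      using j(1) by blast
  qed
  then show ?thesis
    by (rule finite_subset)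
       (use assms in \<open>auto intro!: finite_UN_I finite_imageI finite_cartesian_product finite_PiE\<close>)
qed

text \<open>The constant 1 stands apart because every member of \<open>S_products\<close> has at
  least one factor.\<close>

lemma orbit_monomials_S_products:
  assumes "h \<in> orbit_monomials G \<alpha> p"
  shows "h = (\<lambda>x. 1) \<or> (\<exists>F m. finite F \<and> F \<noteq> {} \<and> F \<subseteq> carrier G \<and> 1 \<le> m \<and> h \<in> S_products G \<alpha> p F m)"
  using assms
proof (induction h rule: orbit_monomials.induct)
  case (mono_mult g t n)
  obtain j s f F m where g: "g = (\<lambda>x. \<Prod>k<j. induced G \<alpha> (s k) (f k) x)" "j \<le> m"
      "\<forall>k<j. s k \<in> F \<and> f k \<in> p ` {..<m}" "finite F" "F \<subseteq> carrier G"
  proof -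
    from mono_mult.IH consider "g = (\<lambda>x. 1)"
      | F m where "finite F" "F \<subseteq> carrier G" "g \<in> S_products G \<alpha> p F m" by blast
    then show ?thesis
    proof cases
      case 1
      \<comment> \<open>As an empty product, 1 also fits the form to which one more factor is
        appended below.\<close>
      then show ?thesis by (intro that[where j = 0 and m = 0 and F = "{}"]) auto
    next
      case (2 F m)
      then obtain j s f where "g = (\<lambda>x. \<Prod>k<j. induced G \<alpha> (s k) (f k) x)" "j \<le> m"
        "\<forall>k<j. s k \<in> F \<and> f k \<in> p ` {..<m}" by (elim S_productsE)
      then show ?thesis using 2 by (intro that)
    qed
  qed
  define s' where "s' = s(j := t)"
  define f' where "f' = f(j := p n)"
  \<comment> \<open>Large enough for the new length \<open>Suc j\<close> and for the index
    \<open>n\<close>.\<close>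
  define m' where "m' = Suc (m + n)"
  have "\<forall>k<Suc j. s' k \<in> insert t F \<and> f' k \<in> p ` {..<m'}"
  proof (intro allI impI)
    fix k assume "k < Suc j"
    then consider "k = j" | "k < j" by linarith
    then show "s' k \<in> insert t F \<and> f' k \<in> p ` {..<m'}"
    proof cases
      case 1 then show ?thesis by (simp add: s'_def f'_def m'_def)
    next
      case 2
      have "p ` {..<m} \<subseteq> p ` {..<m'}" by (intro image_mono) (auto simp: m'_def)
      then show ?thesis using 2 g(3) by (auto simp: s'_def f'_def)
    qed
  qed
  then have "(\<lambda>x. \<Prod>k<Suc j. induced G \<alpha> (s' k) (f' k) x) \<in> S_products G \<alpha> p (insert t F) m'"
    using g(2) by (intro S_productsI) (auto simp: m'_def)
  moreover have "(\<lambda>x. g x * induced G \<alpha> t (p n) x) = (\<lambda>x. \<Prod>k<Suc j. induced G \<alpha> (s' k) (f' k) x)"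
    by (simp add: g(1) s'_def f'_def fun_eq_iff)
  ultimately have "(\<lambda>x. g x * induced G \<alpha> t (p n) x) \<in> S_products G \<alpha> p (insert t F) m'"
    by simp
  moreover have "finite (insert t F)" "insert t F \<noteq> {}" "insert t F \<subseteq> carrier G" "1 \<le> m'"
    using g mono_mult by (auto simp: m'_def)
  ultimately show ?case by blast
qed simp

section \<open>Density of the generated algebra\<close>

context sofic_pmp_action
begin

lemma induced_induced:
  assumes "s \<in> carrier G" "t \<in> carrier G"
  shows "induced G \<alpha> s (induced G \<alpha> t f) = induced G \<alpha> (s \<otimes> t) f"
  using assms act_mult[of "inv t" "inv s"] by (simp add: induced_def fun_eq_iff inv_mult_group)

lemma orbit_span_induced:
  assumes s: "s \<in> carrier G" and "g \<in> orbit_span G \<alpha> p"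
  shows "induced G \<alpha> s g \<in> orbit_span G \<alpha> p"
  using assms(2)
proof (induction g rule: orbit_span.induct)
  case (span_mono g)
  then have "induced G \<alpha> s g \<in> orbit_monomials G \<alpha> p"
  proof (induction g rule: orbit_monomials.induct)
    case mono_one
    then show ?case using orbit_monomials.mono_one by (simp add: induced_def)
  next
    case (mono_mult g t n)
    have "induced G \<alpha> s (\<lambda>x. g x * induced G \<alpha> t (p n) x)
        = (\<lambda>x. induced G \<alpha> s g x * induced G \<alpha> (s \<otimes> t) (p n) x)"
      using induced_induced[OF s mono_mult(2), of "p n"] by (simp add: induced_def fun_eq_iff)
    then show ?case
      using orbit_monomials.mono_mult[OF mono_mult.IH, of "s \<otimes> t" n] s mono_mult(2) by simp
  qed
  then show ?case by (rule orbit_span.span_mono)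
next
  case (span_add g g')
  then show ?case using orbit_span.span_add[OF span_add.IH] by (simp add: induced_def)
next
  case (span_scale g c)
  then show ?case using orbit_span.span_scale[OF span_scale.IH, of c] by (simp add: induced_def)
qed

lemma orbit_span_CX:
  assumes "range p \<subseteq> CX" "g \<in> orbit_span G \<alpha> p"
  shows "g \<in> CX"
  using assms(2)
proof (induction g rule: orbit_span.induct)
  case (span_mono g)
  then show ?case
    by (induction g rule: orbit_monomials.induct) (use assms(1) in \<open>auto intro: CX_const CX_mult induced_CX\<close>)
qed (auto intro: CX_add CX_scale)

text \<open>Generation speaks about invariant C*-subalgebras. The uniform closure \<open>A\<close>
  of the orbit span is one and contains the sequence, so it is everything.\<close>

lemma orbit_span_dense:
  assumes p: "dyn_generating_seq G \<alpha> p" and "f \<in> CX" "0 < e"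
  obtains g where "g \<in> orbit_span G \<alpha> p" "\<And>x. cmod (f x - g x) < e"
proof -
  have pC: "range p \<subseteq> CX" and pR: "\<And>n x. p n x \<in> \<real>"
    using p by (auto simp: dyn_generating_seq_def)
  note span_CX = orbit_span_CX[OF pC]
  define A where "A = {f \<in> CX. \<forall>e>0. \<exists>g\<in>orbit_span G \<alpha> p. \<forall>x. cmod (f x - g x) < e}"
  have AI: "f \<in> A" if "\<And>e. 0 < e \<Longrightarrow> \<exists>g\<in>orbit_span G \<alpha> p. \<forall>x. cmod (f x - g x) < e" for f
    using that CX_uniform_closed[of f] span_CX unfolding A_def by blast
  have AE: "\<exists>g\<in>orbit_span G \<alpha> p. \<forall>x. cmod (f x - g x) < e" if "f \<in> A" "0 < e" for f e
    using that unfolding A_def by blast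
  have span_A: "g \<in> A" if "g \<in> orbit_span G \<alpha> p" for g
    using that by (intro AI bexI[of _ g]) auto
  have scale_A: "(\<lambda>x. c * f x) \<in> A" if f: "f \<in> A" for f c
  proof (rule AI)
    fix e :: real assume "0 < e"
    \<comment> \<open>The added 1 covers \<open>c = 0\<close>.\<close>
    then have e': "0 < e / (cmod c + 1)" by (intro divide_pos_pos) (auto intro: add_nonneg_pos)
    from AE[OF f this] obtain g where
      g: "g \<in> orbit_span G \<alpha> p" "\<And>x. cmod (f x - g x) < e / (cmod c + 1)" by blast
    have "cmod (c * f x - c * g x) < e" for x
    proof -
      have "cmod (c * f x - c * g x) \<le> cmod c * (e / (cmod c + 1))"
        unfolding right_diff_distrib[symmetric] norm_mult
        using g(2)[of x] by (intro mult_left_mono) auto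
      also have "\<dots> < (cmod c + 1) * (e / (cmod c + 1))"
        using e' by (intro mult_strict_right_mono) auto
      also have "\<dots> = e" using norm_ge_zero[of c] by (simp add: add_nonneg_eq_0_iff)
      finally show ?thesis .
    qed
    then show "\<exists>g\<in>orbit_span G \<alpha> p. \<forall>x. cmod (c * f x - g x) < e"
      by (intro bexI[of _ "\<lambda>x. c * g x"]) (auto intro: orbit_span.span_scale g)
  qed
  have add_A: "(\<lambda>x. f x + f' x) \<in> A" if f: "f \<in> A" "f' \<in> A" for f f'
  proof (rule AI)
    fix e :: real assume "0 < e"
    then have e': "0 < e / 2" by simp
    obtain g g' where g: "g \<in> orbit_span G \<alpha> p" "\<And>x. cmod (f x - g x) < e / 2"
      "g' \<in> orbit_span G \<alpha> p" "\<And>x. cmod (f' x - g' x) < e / 2"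
      using AE[OF f(1) e'] AE[OF f(2) e'] by blast
    have "cmod (f x + f' x - (g x + g' x)) < e" for x
      using norm_diff_triangle_ineq[of "f x" "f' x" "g x" "g' x"] g(2)[of x] g(4)[of x] by simp
    then show "\<exists>g\<in>orbit_span G \<alpha> p. \<forall>x. cmod (f x + f' x - g x) < e"
      by (intro bexI[of _ "\<lambda>x. g x + g' x"]) (auto intro: orbit_span.span_add g)
  qed
  have mult_A: "(\<lambda>x. f x * f' x) \<in> A" if f: "f \<in> A" "f' \<in> A" for f f'
  proof (rule AI)
    fix e :: real assume e: "0 < e"
    obtain B where B: "0 \<le> B" "\<And>x. cmod (f x) \<le> B"
      by (rule CX_bounded[OF _ compact_X, of f]) (use f in \<open>auto simp: A_def\<close>)
    obtain B' where B': "0 \<le> B'" "\<And>x. cmod (f' x) \<le> B'"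
      by (rule CX_bounded[OF _ compact_X, of f']) (use f in \<open>auto simp: A_def\<close>)
    \<comment> \<open>As \<eta> is at most 1, the approximant of \<open>f\<close> is bounded by
      \<open>B + 1\<close>, and the error of the product is at most
      \<open>\<eta> * (B + B' + 1)\<close>.\<close>
    define \<eta> where "\<eta> = min 1 (e / (B + B' + 2))"
    have \<eta>: "0 < \<eta>" "\<eta> \<le> 1" using e B(1) B'(1) by (auto simp: \<eta>_def)
    have "\<eta> * (B + B' + 1) < \<eta> * (B + B' + 2)" using \<eta>(1) by (intro mult_strict_left_mono) auto
    also have "\<dots> \<le> e / (B + B' + 2) * (B + B' + 2)"
      using B(1) B'(1) by (intro mult_right_mono) (auto simp: \<eta>_def)
    also have "\<dots> = e" using B(1) B'(1) by simp
    finally have \<eta>e: "\<eta> * (B + B' + 1) < e" .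
    obtain g g' where g: "g \<in> orbit_span G \<alpha> p" "\<And>x. cmod (f x - g x) < \<eta>"
      "g' \<in> orbit_span G \<alpha> p" "\<And>x. cmod (f' x - g' x) < \<eta>"
      using AE[OF f(1) \<eta>(1)] AE[OF f(2) \<eta>(1)] by blast
    have "cmod (f x * f' x - g x * g' x) < e" for x
    proof -
      have "cmod (g x) \<le> cmod (f x) + cmod (f x - g x)"
        using norm_triangle_sub[of "g x" "f x"] by (simp add: norm_minus_commute)
      then have gB: "cmod (g x) \<le> B + 1" using B(2)[of x] g(2)[of x] \<eta>(2) by linarith
      have "f x * f' x - g x * g' x = (f x - g x) * f' x + g x * (f' x - g' x)"
        by (simp add: algebra_simps)
      then have "cmod (f x * f' x - g x * g' x) \<le> cmod (f x - g x) * cmod (f' x) + cmod (g x) * cmod (f' x - g' x)"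
        by (metis norm_mult norm_triangle_ineq)
      also have "\<dots> \<le> \<eta> * B' + (B + 1) * \<eta>"
        using g(2)[of x] g(4)[of x] gB B'(2)[of x] \<eta> B by (intro add_mono mult_mono) auto
      also have "\<dots> = \<eta> * (B + B' + 1)" by (simp add: algebra_simps)
      finally show ?thesis using \<eta>e by simp
    qed
    then show "\<exists>g\<in>orbit_span G \<alpha> p. \<forall>x. cmod (f x * f' x - g x) < e"
      by (intro bexI[of _ "\<lambda>x. g x * g' x"]) (auto intro: orbit_span_mult g)
  qed
  have cnj_A: "(\<lambda>x. cnj (f x)) \<in> A" if f: "f \<in> A" for f
  proof (rule AI)
    fix e :: real assume "0 < e"
    from AE[OF f this] obtain g where g: "g \<in> orbit_span G \<alpha> p" "\<And>x. cmod (f x - g x) < e" by blast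
    have "cmod (cnj (f x) - cnj (g x)) < e" for x
      using g(2)[of x] by (metis complex_cnj_diff complex_mod_cnj)
    then show "\<exists>g\<in>orbit_span G \<alpha> p. \<forall>x. cmod (cnj (f x) - g x) < e"
      by (intro bexI[of _ "\<lambda>x. cnj (g x)"]) (auto intro: orbit_span_cnj pR g)
  qed
  have limit_A: "f \<in> A" if u: "\<And>n. u n \<in> A" and lim: "uniform_limit UNIV u f sequentially" for u f
  proof (rule AI)
    fix e :: real assume "0 < e"
    then have e': "0 < e / 2" by simp
    from uniform_limitD[OF lim this] obtain n where n: "\<And>x. dist (u n x) (f x) < e / 2"
      unfolding eventually_sequentially by blast
    obtain g where g: "g \<in> orbit_span G \<alpha> p" "\<And>x. cmod (u n x - g x) < e / 2"
      using AE[OF u e'] by blast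
    have "cmod (f x - g x) < e" for x
      using norm_diff_triangle_less[of "f x" "u n x" "e/2" "g x" "e/2"] n[of x] g(2)[of x]
      by (simp add: dist_norm norm_minus_commute)
    then show "\<exists>g\<in>orbit_span G \<alpha> p. \<forall>x. cmod (f x - g x) < e" using g(1) by blast
  qed
  have induced_A: "induced G \<alpha> s f \<in> A" if s: "s \<in> carrier G" and f: "f \<in> A" for s f
  proof (rule AI)
    fix e :: real assume "0 < e"
    from AE[OF f this] obtain g where g: "g \<in> orbit_span G \<alpha> p" "\<And>x. cmod (f x - g x) < e" by blast
    then show "\<exists>g\<in>orbit_span G \<alpha> p. \<forall>x. cmod (induced G \<alpha> s f x - g x) < e"
      by (intro bexI[of _ "induced G \<alpha> s g"] orbit_span_induced s g) (auto simp: induced_def)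
  qed
  have "A \<subseteq> CX" by (auto simp: A_def)
  moreover have "(\<lambda>x. 1) \<in> A"
    by (rule span_A[OF orbit_span.span_mono[OF orbit_monomials.mono_one]])
  moreover have "\<forall>u f. (\<forall>n. u n \<in> A) \<and> uniform_limit UNIV u f sequentially \<longrightarrow> f \<in> A"
    using limit_A by blast
  ultimately have "invariant_unital_subalgebra G \<alpha> A"
    unfolding invariant_unital_subalgebra_def
    by (intro conjI ballI; (assumption | blast intro: scale_A add_A mult_A cnj_A induced_A))
  moreover have "range p \<subseteq> A"
  proof -
    have "p n \<in> orbit_monomials G \<alpha> p" for n
      using orbit_monomials.mono_mult[OF orbit_monomials.mono_one, where G = G and \<alpha> = \<alpha> and p = p and s = \<one> and n = n]
      by (simp add: induced_def act_one)
    then show ?thesis using span_A orbit_span.span_mono by blast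
  qed
  ultimately have "A = CX" using p by (simp add: dyn_generating_seq_def)
  then show ?thesis using AE[of f e] assms(2,3) that by blast
qed

section \<open>Moments along maps\<close>

definition moment_error :: "nat \<Rightarrow> (nat \<Rightarrow> 'x) \<Rightarrow> ('x \<Rightarrow> complex) \<Rightarrow> real" where
  "moment_error n x f = cmod ((\<Sum>a\<in>{1..n}. f (x a)) / of_nat n - (\<integral>x. f x \<partial>\<mu>))"

lemma prob_mu: "prob_space \<mu>"
  using invariant by (simp add: invariant_borel_prob_def)

lemma integrable_CX:
  assumes "f \<in> CX" shows "integrable \<mu> f"
proof -
  interpret prob_space \<mu> by (rule prob_mu)
  obtain B where "\<And>x. cmod (f x) \<le> B" using CX_bounded[OF assms compact_X] by metis
  moreover have "f \<in> borel_measurable \<mu>"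
    using assms invariant borel_measurable_continuous_onI[of f]
    by (simp add: CX_def invariant_borel_prob_def cong: measurable_cong_sets)
  ultimately show ?thesis by (intro integrable_const_bound[where B = B]) auto
qed

text \<open>For \<open>n = 0\<close> the mean of 1 would be 0, while the integral is 1.\<close>

lemma moment_error_const: "1 \<le> n \<Longrightarrow> moment_error n x (\<lambda>x. 1) = 0"
  using prob_space.prob_space[OF prob_mu] by (simp add: moment_error_def)

lemma moment_error_scale: "moment_error n x (\<lambda>x. c * f x) = cmod c * moment_error n x f"
  unfolding moment_error_def norm_mult[symmetric] right_diff_distrib
  by (simp add: sum_distrib_left[symmetric])

lemma moment_error_add:
  assumes "f \<in> CX" "g \<in> CX"
  shows "moment_error n x (\<lambda>x. f x + g x) \<le> moment_error n x f + moment_error n x g"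
proof -
  have "(\<Sum>a\<in>{1..n}. f (x a) + g (x a)) / of_nat n - (\<integral>x. f x + g x \<partial>\<mu>)
    = ((\<Sum>a\<in>{1..n}. f (x a)) / of_nat n - (\<integral>x. f x \<partial>\<mu>)) + ((\<Sum>a\<in>{1..n}. g (x a)) / of_nat n - (\<integral>x. g x \<partial>\<mu>))"
    using integrable_CX assms by (simp add: sum.distrib add_divide_distrib)
  then show ?thesis unfolding moment_error_def by (simp only: norm_triangle_ineq)
qed

text \<open>The mean and the integral each contribute at most \<open>e\<close>.\<close>

lemma moment_error_le_bound:
  assumes "f \<in> CX" "\<And>x. cmod (f x) \<le> e"
  shows "moment_error n x f \<le> 2 * e"
proof -
  interpret prob_space \<mu> by (rule prob_mu)
  have e: "0 \<le> e" using assms(2) norm_ge_zero order_trans by blast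
  have "cmod (\<Sum>a\<in>{1..n}. f (x a)) \<le> real n * e"
    using sum_norm_le[of "{1..n}" "\<lambda>a. f (x a)" "\<lambda>_. e"] assms(2) by simp
  then have 1: "cmod ((\<Sum>a\<in>{1..n}. f (x a)) / of_nat n) \<le> e"
    using e by (cases "n = 0") (auto simp: norm_divide field_simps)
  have "cmod (\<integral>x. f x \<partial>\<mu>) \<le> (\<integral>x. cmod (f x) \<partial>\<mu>)" by (rule integral_norm_bound)
  also have "\<dots> \<le> (\<integral>x. e \<partial>\<mu>)"
    using integrable_CX[OF assms(1)] assms(2) by (intro integral_mono) auto
  also have "\<dots> = e" by (simp add: prob_space)
  finally have "cmod (\<integral>x. f x \<partial>\<mu>) \<le> e" .
  then show ?thesis unfolding moment_error_def
    using 1 norm_triangle_ineq4[of "(\<Sum>a\<in>{1..n}. f (x a)) / of_nat n" "\<integral>x. f x \<partial>\<mu>"] by linarith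
qed

text \<open>The parameters are uniform in the degree and in the map, so they can be fixed before
  \<open>i\<close> tends to infinity.\<close>

definition controls :: "(nat \<Rightarrow> 'x \<Rightarrow> complex) \<Rightarrow> ('x \<Rightarrow> complex) set \<Rightarrow> real \<Rightarrow> bool" where
  "controls p L \<delta> \<longleftrightarrow> (\<exists>F m \<delta>'. finite F \<and> F \<noteq> {} \<and> F \<subseteq> carrier G \<and> 1 \<le> m \<and> 0 < \<delta>' \<and>
     (\<forall>n\<ge>1. \<forall>x. (\<forall>g\<in>S_products G \<alpha> p F m. moment_error n x g < \<delta>') \<longrightarrow>
        (\<forall>f\<in>L. moment_error n x f < \<delta>)))"

lemma controlsE:
  assumes "controls p L \<delta>"
  obtains F m \<delta>' where "finite F" "F \<noteq> {}" "F \<subseteq> carrier G" "1 \<le> m" "0 < \<delta>'"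
    "\<forall>n\<ge>1. \<forall>x. (\<forall>g\<in>S_products G \<alpha> p F m. moment_error n x g < \<delta>') \<longrightarrow>
        (\<forall>f\<in>L. moment_error n x f < \<delta>)"
  using assms unfolding controls_def by (elim exE conjE) (rule that)

lemma controlsI:
  assumes "finite F" "F \<noteq> {}" "F \<subseteq> carrier G" "1 \<le> m" "0 < \<delta>'"
    "\<And>n x. 1 \<le> n \<Longrightarrow> \<forall>g\<in>S_products G \<alpha> p F m. moment_error n x g < \<delta>' \<Longrightarrow>
        \<forall>f\<in>L. moment_error n x f < \<delta>"
  shows "controls p L \<delta>"
  unfolding controls_def
  by (rule exI[of _ F], rule exI[of _ m], rule exI[of _ \<delta>']) (use assms in simp)

lemma controls_if:
  assumes "\<And>n x. 1 \<le> n \<Longrightarrow> (\<forall>f\<in>L. moment_error n x f < \<delta>) \<Longrightarrow> (\<forall>f\<in>L'. moment_error n x f < \<delta>')"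
    and "controls p L \<delta>"
  shows "controls p L' \<delta>'"
  using assms(2) by (rule controlsE, intro controlsI) (use assms(1) in auto)

lemma controls_Un:
  assumes "controls p L1 \<delta>" "controls p L2 \<delta>"
  shows "controls p (L1 \<union> L2) \<delta>"
proof -
  obtain F1 m1 \<delta>1 where 1: "finite F1" "F1 \<noteq> {}" "F1 \<subseteq> carrier G" "1 \<le> m1" "0 < \<delta>1"
    "\<forall>n\<ge>1. \<forall>x. (\<forall>g\<in>S_products G \<alpha> p F1 m1. moment_error n x g < \<delta>1) \<longrightarrow>
        (\<forall>f\<in>L1. moment_error n x f < \<delta>)"
    by (rule controlsE[OF assms(1)])
  obtain F2 m2 \<delta>2 where 2: "finite F2" "F2 \<noteq> {}" "F2 \<subseteq> carrier G" "1 \<le> m2" "0 < \<delta>2"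
    "\<forall>n\<ge>1. \<forall>x. (\<forall>g\<in>S_products G \<alpha> p F2 m2. moment_error n x g < \<delta>2) \<longrightarrow>
        (\<forall>f\<in>L2. moment_error n x f < \<delta>)"
    by (rule controlsE[OF assms(2)])
  have sub: "S_products G \<alpha> p F1 m1 \<subseteq> S_products G \<alpha> p (F1 \<union> F2) (max m1 m2)"
    "S_products G \<alpha> p F2 m2 \<subseteq> S_products G \<alpha> p (F1 \<union> F2) (max m1 m2)"
    by (intro S_products_mono; simp)+
  show ?thesis
  proof (rule controlsI[of "F1 \<union> F2" "max m1 m2" "min \<delta>1 \<delta>2"])
    fix n x
    assume n: "1 \<le> n"
      and *: "\<forall>g\<in>S_products G \<alpha> p (F1 \<union> F2) (max m1 m2). moment_error n x g < min \<delta>1 \<delta>2"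
    have "\<forall>g\<in>S_products G \<alpha> p F1 m1. moment_error n x g < \<delta>1"
      "\<forall>g\<in>S_products G \<alpha> p F2 m2. moment_error n x g < \<delta>2"
      using * sub by (auto dest!: subsetD)
    then show "\<forall>f\<in>L1 \<union> L2. moment_error n x f < \<delta>"
      using 1(6) 2(6) n by blast
  qed (use 1 2 in auto)
qed

lemma controls_orbit_span:
  assumes p: "range p \<subseteq> CX" and "g \<in> orbit_span G \<alpha> p" "0 < \<delta>"
  shows "controls p {g} \<delta>"
  using assms(2,3)
proof (induction g arbitrary: \<delta> rule: orbit_span.induct)
  case (span_mono g)
  from orbit_monomials_S_products[OF this(1)] show ?case
  proof
    assume "g = (\<lambda>x. 1)"
    \<comment> \<open>In positive degree the constant has no error, so any parameters serve.\<close>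
    then show ?thesis
      using span_mono by (intro controlsI[of "{\<one>}" 1 1]) (auto simp: moment_error_const)
  next
    assume "\<exists>F m. finite F \<and> F \<noteq> {} \<and> F \<subseteq> carrier G \<and> 1 \<le> m \<and> g \<in> S_products G \<alpha> p F m"
    then obtain F m where "finite F" "F \<noteq> {}" "F \<subseteq> carrier G" "1 \<le> m" "g \<in> S_products G \<alpha> p F m"
      by blast
    then show ?thesis using span_mono(2) by (intro controlsI[of F m \<delta>]) auto
  qed
next
  case (span_add g h)
  then have "controls p ({g} \<union> {h}) (\<delta> / 2)" by (intro controls_Un) auto
  then show ?case
  proof (rule controls_if[rotated])
    fix n x assume *: "\<forall>f\<in>{g} \<union> {h}. moment_error n x f < \<delta> / 2"
    have "g \<in> CX" "h \<in> CX" using orbit_span_CX[OF p] span_add by auto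
    from moment_error_add[OF this, of n x] *
    show "\<forall>f\<in>{\<lambda>x. g x + h x}. moment_error n x f < \<delta>" by auto
  qed
next
  case (span_scale g c)
  have c: "0 < cmod c + 1" by (auto intro: add_nonneg_pos)
  then have "controls p {g} (\<delta> / (cmod c + 1))" using span_scale by (intro span_scale.IH) simp
  then show ?case
  proof (rule controls_if[rotated])
    fix n x assume "\<forall>f\<in>{g}. moment_error n x f < \<delta> / (cmod c + 1)"
    then have "cmod c * moment_error n x g \<le> cmod c * (\<delta> / (cmod c + 1))"
      by (intro mult_left_mono) auto
    also have "\<dots> < (cmod c + 1) * (\<delta> / (cmod c + 1))"
      using span_scale c by (intro mult_strict_right_mono) auto
    also have "\<dots> = \<delta>" using c by simp
    finally show "\<forall>f\<in>{\<lambda>x. c * g x}. moment_error n x f < \<delta>" by (simp add: moment_error_scale)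
  qed
qed

lemma controls_finite:
  assumes p: "dyn_generating_seq G \<alpha> p" and "finite L" "L \<subseteq> CX" "0 < \<delta>"
  shows "controls p L \<delta>"
  using assms(2,3)
proof (induction L rule: finite_induct)
  case empty
  show ?case by (rule controlsI[of "{\<one>}" 1 1]) auto
next
  case (insert f L)
  have pC: "range p \<subseteq> CX" using p by (auto simp: dyn_generating_seq_def)
  \<comment> \<open>Approximation within \<delta> / 4 costs \<delta> / 2, as it enters both the mean
    and the integral; the other half is left for \<open>g\<close>.\<close>
  obtain g where g: "g \<in> orbit_span G \<alpha> p" "\<And>x. cmod (f x - g x) < \<delta> / 4"
    by (rule orbit_span_dense[OF p, of f "\<delta>/4"]) (use insert \<open>0 < \<delta>\<close> in auto)
  have C: "f \<in> CX" "g \<in> CX" using insert orbit_span_CX[OF pC g(1)] by auto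
  have "controls p {g} (\<delta> / 2)" using \<open>0 < \<delta>\<close> by (intro controls_orbit_span pC g) simp
  then have "controls p {f} \<delta>"
  proof (rule controls_if[rotated])
    fix n x assume *: "\<forall>f\<in>{g}. moment_error n x f < \<delta> / 2"
    have fg: "(\<lambda>x. f x + (- 1) * g x) \<in> CX" by (intro CX_add CX_scale C)
    have "moment_error n x (\<lambda>x. g x + (f x + (- 1) * g x)) \<le> moment_error n x g + 2 * (\<delta> / 4)"
      using moment_error_add[OF C(2) fg, of n x] moment_error_le_bound[OF fg, of "\<delta>/4" n x] g(2)
      by (force simp: less_imp_le)
    then show "\<forall>f\<in>{f}. moment_error n x f < \<delta>" using * by simp
  qed
  then show ?case using controls_Un[of p "{f}" \<delta> L] insert by simp
qed

end

section \<open>The pseudometric of a generating sequence\<close>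

text \<open>The bound 2 is that for differences of numbers of modulus at most 1. It gives domination
  by the geometric series and a tail estimate that is uniform in \<open>u\<close>.\<close>

lemma
  fixes u :: "nat \<Rightarrow> real"
  assumes "\<And>n. 0 \<le> u n" "\<And>n. u n \<le> 2"
  shows dyadic_summable: "summable (\<lambda>n. (1/2) ^ Suc n * u n)"
    and dyadic_tail: "(\<Sum>n. (1/2) ^ Suc n * u n) \<le> (\<Sum>n<N. (1/2) ^ Suc n * u n) + 2 * (1/2) ^ N"
    and dyadic_partial: "(\<Sum>n<N. (1/2) ^ Suc n * u n) \<le> (\<Sum>n. (1/2) ^ Suc n * u n)"
    and dyadic_term: "(1/2) ^ Suc k * u k \<le> (\<Sum>n. (1/2) ^ Suc n * u n)"
proof -
  let ?f = "\<lambda>n. (1/2) ^ Suc n * u n"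
  have nonneg: "0 \<le> ?f n" for n using assms(1)[of n] by simp
  have le: "?f n \<le> (1/2) ^ n" for n
    using mult_left_mono[OF assms(2)[of n], of "(1/2) ^ Suc n"] by simp
  have geo: "summable (\<lambda>n. (1/2 :: real) ^ n)" by (rule summable_geometric) simp
  show sum: "summable ?f"
    by (rule summable_comparison_test'[OF geo, of 0]) (use nonneg le in \<open>simp only: real_norm_def abs_of_nonneg\<close>)
  show "(\<Sum>n<N. ?f n) \<le> (\<Sum>n. ?f n)"
    by (rule sum_le_suminf[OF sum]) (use nonneg in auto)
  show "?f k \<le> (\<Sum>n. ?f n)"
    using sum_le_suminf[OF sum, of "{k}"] nonneg by simp
  have "(\<Sum>n. ?f (n + N)) \<le> (\<Sum>n. (1/2) ^ N * (1/2) ^ n)"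
  proof (rule suminf_le)
    show "?f (n + N) \<le> (1/2) ^ N * (1/2) ^ n" for n
      using le[of "n + N"] by (simp only: power_add mult.commute)
  qed (rule summable_ignore_initial_segment[OF sum] summable_mult[OF geo])+
  also have "\<dots> = (1/2) ^ N * (\<Sum>n. (1/2) ^ n)" by (rule suminf_mult[OF geo])
  also have "(\<Sum>n. (1/2 :: real) ^ n) = 2" by (subst suminf_geometric) auto
  finally show "(\<Sum>n. ?f n) \<le> (\<Sum>n<N. ?f n) + 2 * (1/2) ^ N"
    using suminf_split_initial_segment[OF sum, of N] by simp
qed

lemma dyadic_sum_le_one: "(\<Sum>n<N. (1/2 :: real) ^ Suc n) \<le> 1"
proof -
  have "(\<Sum>n<N. (1/2 :: real) ^ Suc n) = 1 - (1/2) ^ N" by (induction N) auto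
  then show ?thesis by simp
qed

lemma dyadic_small:
  assumes "0 < (e :: real)" obtains N where "2 * (1/2) ^ N < e"
proof -
  obtain N where "(1/2) ^ N < e / 2" using real_arch_pow_inv[of "e/2" "1/2"] assms by auto
  then show ?thesis by (intro that[of N]) simp
qed

lemma rms_cmod_triangle:
  "rms d (\<lambda>a. cmod (u a - w a)) \<le> rms d (\<lambda>a. cmod (u a - v a)) + rms d (\<lambda>a. cmod (v a - w a))"
proof -
  have "rms d (\<lambda>a. cmod (u a - w a)) \<le> rms d (\<lambda>a. cmod (u a - v a) + cmod (v a - w a))"
    by (rule rms_mono) (auto intro: norm_diff_triangle_le)
  then show ?thesis by (rule order_trans) (rule rms_add)
qed

definition seq_pm :: "(nat \<Rightarrow> 'x \<Rightarrow> complex) \<Rightarrow> 'x \<Rightarrow> 'x \<Rightarrow> real" where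
  "seq_pm p x y = (\<Sum>n. (1/2) ^ Suc n * cmod (p n x - p n y))"

text \<open>The common yardstick for \<open>seq_dist\<close> and \<open>rho_2 (seq_pm p)\<close>:
  each is at most a weighted partial sum of coordinate distances plus a small tail.\<close>

definition coord_dist :: "(nat \<Rightarrow> 'x \<Rightarrow> complex) \<Rightarrow> nat \<Rightarrow> nat \<Rightarrow> (nat \<Rightarrow> 'x) \<Rightarrow> (nat \<Rightarrow> 'x) \<Rightarrow> real" where
  "coord_dist p d k x y = rms d (\<lambda>a. cmod (p k (x a) - p k (y a)))"

lemma coord_dist_sym: "coord_dist p d k x y = coord_dist p d k y x"
  by (simp add: coord_dist_def norm_minus_commute)

lemma coord_dist_triangle: "coord_dist p d k x z \<le> coord_dist p d k x y + coord_dist p d k y z"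
  unfolding coord_dist_def by (rule rms_cmod_triangle)

context
  fixes p :: "nat \<Rightarrow> 'x::topological_space \<Rightarrow> complex"
  assumes bound: "\<And>n x. cmod (p n x) \<le> 1"
begin

lemma diff_le_2: "cmod (p n x - p n y) \<le> 2"
  using norm_triangle_ineq4[of "p n x" "p n y"] bound[of n x] bound[of n y] by linarith

lemma coord_dist_le_2: "coord_dist p d k x y \<le> 2"
proof -
  have "coord_dist p d k x y \<le> rms d (\<lambda>a. 2)"
    unfolding coord_dist_def by (intro rms_mono diff_le_2) auto
  also have "\<dots> \<le> 2" by (rule rms_const_le) simp
  finally show ?thesis .
qed

lemma seq_dist_tail:
  "seq_dist p d x y \<le> (\<Sum>k<N. (1/2) ^ Suc k * coord_dist p d k x y) + 2 * (1/2) ^ N"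
  unfolding seq_dist_def coord_dist_def[symmetric]
  by (intro dyadic_tail coord_dist_le_2) (simp add: coord_dist_def rms_nonneg)

lemma seq_dist_partial: "(\<Sum>k<N. (1/2) ^ Suc k * coord_dist p d k x y) \<le> seq_dist p d x y"
  unfolding seq_dist_def coord_dist_def[symmetric]
  by (intro dyadic_partial coord_dist_le_2) (simp add: coord_dist_def rms_nonneg)

text \<open>The pointwise tail is a constant, and Minkowski's inequality moves the quadratic mean
  inside the remaining finite sum.\<close>

lemma rho_2_seq_pm_tail:
  "rho_2 (seq_pm p) d x y \<le> (\<Sum>k<N. (1/2) ^ Suc k * coord_dist p d k x y) + 2 * (1/2) ^ N"
proof -
  let ?u = "\<lambda>k a. (1/2) ^ Suc k * cmod (p k (x a) - p k (y a))"
  have "0 \<le> seq_pm p z w" for z w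
    using dyadic_partial[of "\<lambda>n. cmod (p n z - p n w)" 0] diff_le_2 by (simp add: seq_pm_def)
  then have "rho_2 (seq_pm p) d x y \<le> rms d (\<lambda>a. (\<Sum>k<N. ?u k a) + 2 * (1/2) ^ N)"
    unfolding rho_2_eq_rms by (rule rms_mono) (auto simp: seq_pm_def intro!: dyadic_tail diff_le_2 simp del: power_Suc)
  also have "\<dots> \<le> rms d (\<lambda>a. \<Sum>k<N. ?u k a) + rms d (\<lambda>a. 2 * (1/2) ^ N)" by (rule rms_add)
  also have "\<dots> \<le> (\<Sum>k<N. rms d (?u k)) + 2 * (1/2) ^ N"
    by (intro add_mono rms_sum rms_const_le) auto
  also have "(\<Sum>k<N. rms d (?u k)) = (\<Sum>k<N. (1/2) ^ Suc k * coord_dist p d k x y)"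
    unfolding coord_dist_def by (intro sum.cong refl rms_scale) auto
  finally show ?thesis .
qed

lemma coord_dist_le_rho_2: "(1/2) ^ Suc k * coord_dist p d k x y \<le> rho_2 (seq_pm p) d x y"
proof -
  have "(1/2) ^ Suc k * coord_dist p d k x y = rms d (\<lambda>a. (1/2) ^ Suc k * cmod (p k (x a) - p k (y a)))"
    unfolding coord_dist_def by (rule rms_scale[symmetric]) simp
  also have "\<dots> \<le> rho_2 (seq_pm p) d x y"
    unfolding rho_2_eq_rms seq_pm_def by (intro rms_mono dyadic_term diff_le_2) auto
  finally show ?thesis .
qed

lemma continuous_pseudometric_seq_pm:
  assumes "range p \<subseteq> CX"
  shows "continuous_pseudometric (seq_pm p)"
  unfolding continuous_pseudometric_def
proof (intro conjI allI)
  fix x y z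
  have sums: "summable (\<lambda>n. (1/2) ^ Suc n * cmod (p n x - p n y))" for x y
    by (intro dyadic_summable diff_le_2) auto
  show "0 \<le> seq_pm p x y" unfolding seq_pm_def by (intro suminf_nonneg sums) simp
  show "seq_pm p x x = 0" by (simp add: seq_pm_def)
  show "seq_pm p x y = seq_pm p y x" by (simp add: seq_pm_def norm_minus_commute)
  show "seq_pm p x z \<le> seq_pm p x y + seq_pm p y z"
    unfolding seq_pm_def suminf_add[OF sums sums]
  proof (intro suminf_le sums summable_add)
    fix n
    show "(1/2) ^ Suc n * cmod (p n x - p n z)
      \<le> (1/2) ^ Suc n * cmod (p n x - p n y) + (1/2) ^ Suc n * cmod (p n y - p n z)"
      unfolding distrib_left[symmetric]
      by (intro mult_left_mono) (auto intro: norm_diff_triangle_le)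
  qed
next
  let ?f = "\<lambda>n z. (1/2) ^ Suc n * cmod (p n (fst z) - p n (snd z))"
  \<comment> \<open>Comparison with the geometric series makes convergence uniform, hence the sum
    jointly continuous.\<close>
  have lim: "uniform_limit UNIV (\<lambda>n z. \<Sum>i<n. ?f i z) (\<lambda>z. \<Sum>i. ?f i z) sequentially"
  proof (rule Weierstrass_m_test)
    fix n and z :: "'x \<times> 'x"
    show "norm (?f n z) \<le> (1/2) ^ n"
      using mult_left_mono[OF diff_le_2[of n "fst z" "snd z"], of "(1/2) ^ Suc n"] by simp
  qed (auto intro: summable_geometric)
  have "continuous_on UNIV (p n)" for n using assms by (auto simp: CX_def)
  then have "continuous_on UNIV (\<lambda>z :: 'x \<times> 'x. p n (fst z))" "continuous_on UNIV (\<lambda>z :: 'x \<times> 'x. p n (snd z))"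
    for n
    by (rule continuous_on_compose2; simp add: continuous_on_fst continuous_on_snd)+
  then have "continuous_on UNIV (\<lambda>z. \<Sum>i<n. ?f i z)" for n
    by (intro continuous_intros)
  then have "continuous_on UNIV (\<lambda>z. \<Sum>i. ?f i z)"
    by (intro uniform_limit_theorem[OF _ lim] always_eventually allI) auto
  then show "continuous_on UNIV (\<lambda>(x, y). seq_pm p x y)"
    by (simp add: seq_pm_def case_prod_unfold)
qed

end

section \<open>The entropy of a sequence as a spatial entropy\<close>

context sofic_pmp_action
begin

text \<open>If no translate separated \<open>x\<close> from \<open>y\<close>, the functions that
  agree at \<open>\<alpha> s x\<close> and \<open>\<alpha> s y\<close> for all \<open>s\<close>
  would form an invariant C*-subalgebra containing the sequence, hence all of
  \<open>CX\<close>.\<close>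

lemma dyn_generating_seq_pm:
  assumes \<rho>: "continuous_pseudometric \<rho>" and gen: "dyn_generating_pseudometric G \<alpha> \<rho>"
    and p: "dyn_generating_seq G \<alpha> p"
  shows "dyn_generating_pseudometric G \<alpha> (seq_pm p)"
  unfolding dyn_generating_pseudometric_def
proof (intro allI impI, rule ccontr)
  fix x y :: 'x
  assume "x \<noteq> y" and no: "\<not> (\<exists>s\<in>carrier G. 0 < seq_pm p (\<alpha> s x) (\<alpha> s y))"
  have bound: "cmod (p n x) \<le> 1" for n x using p by (simp add: dyn_generating_seq_def)
  have pC: "p n \<in> CX" for n using p by (simp add: dyn_generating_seq_def)
  have eq: "p n (\<alpha> s x) = p n (\<alpha> s y)" if s: "s \<in> carrier G" for n s
  proof -
    have "(1/2) ^ Suc n * cmod (p n (\<alpha> s x) - p n (\<alpha> s y)) \<le> seq_pm p (\<alpha> s x) (\<alpha> s y)"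
      unfolding seq_pm_def by (intro dyadic_term diff_le_2 bound) auto
    also have "\<dots> \<le> 0" using no s by (simp add: not_less)
    finally show ?thesis by (simp add: mult_le_0_iff power_le_zero_eq)
  qed
  define A where "A = {f \<in> CX. \<forall>s\<in>carrier G. f (\<alpha> s x) = f (\<alpha> s y)}"
  have limit_A: "f \<in> A" if u: "\<And>n. u n \<in> A" and lim: "uniform_limit UNIV u f sequentially" for u f
  proof -
    have "f (\<alpha> s x) = f (\<alpha> s y)" if s: "s \<in> carrier G" for s
    proof (rule LIMSEQ_unique)
      show "(\<lambda>n. u n (\<alpha> s x)) \<longlonglongrightarrow> f (\<alpha> s x)" by (rule tendsto_uniform_limitI[OF lim]) simp
      have "(\<lambda>n. u n (\<alpha> s y)) \<longlonglongrightarrow> f (\<alpha> s y)" by (rule tendsto_uniform_limitI[OF lim]) simp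
      then show "(\<lambda>n. u n (\<alpha> s x)) \<longlonglongrightarrow> f (\<alpha> s y)" using u s by (simp add: A_def)
    qed
    moreover have "continuous_on UNIV f"
      by (rule uniform_limit_theorem[OF _ lim]) (use u in \<open>auto simp: A_def CX_def\<close>)
    ultimately show ?thesis by (simp add: A_def CX_def)
  qed
  have induced_A: "induced G \<alpha> s f \<in> A" if "s \<in> carrier G" "f \<in> A" for s f
  proof -
    have "induced G \<alpha> s f (\<alpha> t x) = induced G \<alpha> s f (\<alpha> t y)" if t: "t \<in> carrier G" for t
    proof -
      have "\<alpha> (inv s) (\<alpha> t z) = \<alpha> (inv s \<otimes> t) z" for z
        using act_mult[of "inv s" t z] \<open>s \<in> carrier G\<close> t by simp
      moreover have "f (\<alpha> (inv s \<otimes> t) x) = f (\<alpha> (inv s \<otimes> t) y)"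
        using \<open>s \<in> carrier G\<close> \<open>f \<in> A\<close> t unfolding A_def by blast
      ultimately show ?thesis by (simp only: induced_def)
    qed
    then show ?thesis using that induced_CX by (simp add: A_def)
  qed
  have algebra_A: "(\<lambda>z. 1) \<in> A"
    "\<And>f c. f \<in> A \<Longrightarrow> (\<lambda>z. c * f z) \<in> A"
    "\<And>f g. f \<in> A \<Longrightarrow> g \<in> A \<Longrightarrow> (\<lambda>z. f z + g z) \<in> A"
    "\<And>f g. f \<in> A \<Longrightarrow> g \<in> A \<Longrightarrow> (\<lambda>z. f z * g z) \<in> A"
    "\<And>f. f \<in> A \<Longrightarrow> (\<lambda>z. cnj (f z)) \<in> A"
    by (simp_all add: A_def CX_const CX_scale CX_add CX_mult CX_cnj)
  have "A \<subseteq> CX" by (auto simp: A_def)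
  moreover have "\<forall>u f. (\<forall>n. u n \<in> A) \<and> uniform_limit UNIV u f sequentially \<longrightarrow> f \<in> A"
    using limit_A by blast
  ultimately have "invariant_unital_subalgebra G \<alpha> A"
    unfolding invariant_unital_subalgebra_def
    by (intro conjI ballI; (assumption | blast intro: algebra_A induced_A))
  moreover have "range p \<subseteq> A" using eq pC by (auto simp: A_def)
  ultimately have A: "A = CX" using p by (simp add: dyn_generating_seq_def)
  obtain s where s: "s \<in> carrier G" "0 < \<rho> (\<alpha> s x) (\<alpha> s y)"
    using gen \<open>x \<noteq> y\<close> unfolding dyn_generating_pseudometric_def by blast
  \<comment> \<open>This function vanishes at \<open>\<alpha> s x\<close> and not at
    \<open>\<alpha> s y\<close>, although it would have to lie in \<open>A\<close>.\<close>
  have "(\<lambda>z. complex_of_real (\<rho> (\<alpha> s x) z)) \<in> CX"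
    unfolding CX_def by (auto intro!: continuous_intros pm_continuous_on[OF \<rho>])
  then have "\<rho> (\<alpha> s x) (\<alpha> s x) = \<rho> (\<alpha> s x) (\<alpha> s y)"
    using s(1) unfolding A[symmetric] by (simp add: A_def)
  then show False using s(2) pm_refl[OF \<rho>] by simp
qed

text \<open>Outside an exceptional set that depends on \<sigma> alone the two arguments coincide, so
  the estimate is uniform in the map \<open>x\<close> and the coordinate \<open>n\<close>.\<close>

lemma eventually_inverse_coord_small:
  assumes "s \<in> carrier G" "0 < \<eta>" and bound: "\<And>n x. cmod (p n x) \<le> 1"
  shows "\<forall>\<^sub>F i in sequentially. \<forall>x n.
    coord_dist p (d i) n (\<lambda>a. x (\<sigma> i (inv s) a)) (\<lambda>a. x (inv_into {1..d i} (\<sigma> i s) a)) < \<eta>"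
proof -
  obtain \<theta> \<kappa> :: real where \<kappa>: "0 < \<theta>" "0 < \<kappa>" "\<And>d u. few d \<kappa> (\<lambda>a. \<theta> \<le> u a) \<Longrightarrow>
      (\<And>a. a \<in> {1..d} \<Longrightarrow> 0 \<le> u a) \<Longrightarrow> (\<And>a. a \<in> {1..d} \<Longrightarrow> u a \<le> 2) \<Longrightarrow> rms d u < \<eta>"
    by (rule rms_small_if_few[OF \<open>0 < \<eta>\<close>, of 2]) auto
  from eventually_sigma_inv[OF assms(1) \<kappa>(2)] show ?thesis
  proof eventually_elim
    case (elim i)
    show ?case
      unfolding coord_dist_def
    proof (intro allI \<kappa>(3))
      fix x n
      show "few (d i) \<kappa> (\<lambda>a. \<theta> \<le> cmod (p n (x (\<sigma> i (inv s) a)) - p n (x (inv_into {1..d i} (\<sigma> i s) a))))"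
      proof (rule few_mono[OF elim])
        fix a assume "\<theta> \<le> cmod (p n (x (\<sigma> i (inv s) a)) - p n (x (inv_into {1..d i} (\<sigma> i s) a)))"
        then show "inv_into {1..d i} (\<sigma> i s) a \<noteq> \<sigma> i (inv s) a" using \<kappa>(1) by auto
      qed simp
    qed (auto intro: diff_le_2[OF bound])
  qed
qed

lemma h_bar_le_h_2_seq_pm:
  assumes p: "dyn_generating_seq G \<alpha> p"
  shows "h_bar G \<alpha> \<mu> d \<sigma> p \<le> h_2 G \<alpha> \<mu> d \<sigma> (seq_pm p)"
proof -
  have bound: "cmod (p n x) \<le> 1" for n x using p by (simp add: dyn_generating_seq_def)
  have pC: "range p \<subseteq> CX" using p by (auto simp: dyn_generating_seq_def)
  show ?thesis
    unfolding h_bar_eq_Hom_maps[OF pC] h_2_def h_spatial_def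
  proof (rule entropy_le)
    fix \<epsilon> :: real assume \<epsilon>: "0 < \<epsilon>"
    \<comment> \<open>If the first \<open>N\<close> weighted coordinate distances were below
      \<epsilon>', they would add up to at most \<epsilon> / 2, and the tail is less than that.
      \<open>N + 1\<close> covers \<open>N = 0\<close>.\<close>
    obtain N where N: "2 * (1/2) ^ N < \<epsilon> / 2" using dyadic_small[of "\<epsilon>/2"] \<epsilon> by auto
    define \<epsilon>' where "\<epsilon>' = \<epsilon> / (2 * (real N + 1))"
    have \<epsilon>': "0 < \<epsilon>'" using \<epsilon> by (simp add: \<epsilon>'_def)
    have sep: "\<epsilon>' \<le> rho_2 (seq_pm p) n x y" if "\<epsilon> \<le> seq_dist p n x y" for n x y
    proof (rule ccontr)
      assume "\<not> ?thesis"
      then have "(\<Sum>k<N. (1/2) ^ Suc k * coord_dist p n k x y) \<le> (\<Sum>k<N. \<epsilon>')"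
        using coord_dist_le_rho_2[where p = p and d = n and x = x and y = y, OF bound] by (intro sum_mono) (meson not_le order_trans less_imp_le)
      also have "\<dots> = real N * \<epsilon>'" by simp
      also have "\<dots> \<le> (real N + 1) * \<epsilon>'" using \<epsilon>' by simp
      also have "\<dots> = \<epsilon> / 2" by (simp add: \<epsilon>'_def field_simps)
      finally show False using seq_dist_tail[where p = p and d = n and x = x and y = y and N = N, OF bound] N that by linarith
    qed
    show "\<exists>\<epsilon>'>0. \<forall>F\<in>{F. finite F \<and> F \<noteq> {} \<and> F \<subseteq> carrier G}. \<forall>L\<in>{L. finite L \<and> L \<subseteq> CX}. \<forall>\<delta>\<in>{0<..}.
      \<exists>F'\<in>{F. finite F \<and> F \<noteq> {} \<and> F \<subseteq> carrier G}. \<exists>m'\<in>{1..}. \<exists>\<delta>'\<in>{0<..}.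
      \<forall>\<^sub>F i in sequentially.
        Hom_maps G \<alpha> \<mu> p F' m' \<delta>' (d i) (\<sigma> i) \<subseteq> Map_mu \<alpha> \<mu> (seq_pm p) F L \<delta> (d i) (\<sigma> i) \<and>
        (\<forall>x\<in>Hom_maps G \<alpha> \<mu> p F' m' \<delta>' (d i) (\<sigma> i). \<forall>y\<in>Hom_maps G \<alpha> \<mu> p F' m' \<delta>' (d i) (\<sigma> i).
          \<epsilon> \<le> seq_dist p (d i) x y \<longrightarrow> \<epsilon>' \<le> rho_2 (seq_pm p) (d i) x y)"
    proof (intro exI[of _ \<epsilon>'] conjI ballI)
      fix F and L :: "('x \<Rightarrow> complex) set" and \<delta>
      assume "F \<in> {F. finite F \<and> F \<noteq> {} \<and> F \<subseteq> carrier G}" "L \<in> {L. finite L \<and> L \<subseteq> CX}" "\<delta> \<in> {0::real<..}"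
      then have F: "finite F" "F \<noteq> {}" "F \<subseteq> carrier G" and L: "finite L" "L \<subseteq> CX" and \<delta>: "0 < \<delta>"
        by auto
      obtain FL mL \<delta>L where C: "finite FL" "FL \<noteq> {}" "FL \<subseteq> carrier G" "1 \<le> mL" "0 < \<delta>L"
        "\<forall>n\<ge>1. \<forall>x. (\<forall>g\<in>S_products G \<alpha> p FL mL. moment_error n x g < \<delta>L) \<longrightarrow>
          (\<forall>f\<in>L. moment_error n x f < \<delta>)"
        by (rule controlsE[OF controls_finite[OF p L \<delta>]])
      obtain M where M: "2 * (1/2) ^ M < \<delta> / 2" using dyadic_small[of "\<delta>/2"] \<delta> by auto
      \<comment> \<open>The condition at \<open>s\<close> in \<open>Hom_maps\<close> concerns
        \<open>\<alpha> (inv s)\<close>, hence the inverses. Besides, \<open>FL\<close> and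
        \<open>mL\<close> supply the moments on \<open>L\<close>, and \<open>M\<close> the number of
        coordinates needed for \<open>rho_2\<close>.\<close>
      define F' where "F' = m_inv G ` F \<union> FL"
      define m' where "m' = max M mL"
      \<comment> \<open>One quarter goes to the condition on homomorphisms and one to the inverse
        permutation. The weights sum to at most 1, so the first \<open>M\<close> coordinates use
        \<delta> / 2 and the tail stays below the other half.\<close>
      define \<delta>' where "\<delta>' = min (\<delta> / 4) \<delta>L"
      let ?Y = "\<lambda>i. Hom_maps G \<alpha> \<mu> p F' m' \<delta>' (d i) (\<sigma> i)"
      have "\<forall>\<^sub>F i in sequentially. \<forall>t\<in>F. \<forall>x n.
        coord_dist p (d i) n (\<lambda>a. x (\<sigma> i (inv (inv t)) a)) (\<lambda>a. x (inv_into {1..d i} (\<sigma> i (inv t)) a)) < \<delta> / 4"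
        using F \<delta> by (intro eventually_ball_finite ballI eventually_inverse_coord_small bound) auto
      then have "\<forall>\<^sub>F i in sequentially. ?Y i \<subseteq> Map_mu \<alpha> \<mu> (seq_pm p) F L \<delta> (d i) (\<sigma> i) \<and>
        (\<forall>x\<in>?Y i. \<forall>y\<in>?Y i. \<epsilon> \<le> seq_dist p (d i) x y \<longrightarrow> \<epsilon>' \<le> rho_2 (seq_pm p) (d i) x y)"
        using eventually_degree_pos
      proof eventually_elim
        case (elim i)
        have "x \<in> Map_mu \<alpha> \<mu> (seq_pm p) F L \<delta> (d i) (\<sigma> i)" if x: "x \<in> ?Y i" for x
        proof -
          have "S_products G \<alpha> p FL mL \<subseteq> S_products G \<alpha> p F' m'"
            by (rule S_products_mono) (auto simp: F'_def m'_def)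
          then have "\<forall>g\<in>S_products G \<alpha> p FL mL. moment_error (d i) x g < \<delta>L"
            using x unfolding Hom_maps_def moment_error_def \<delta>'_def by auto
          then have moments: "\<forall>f\<in>L. moment_error (d i) x f < \<delta>" using C(6) elim(2) by blast
          have "rho_2 (seq_pm p) (d i) (\<lambda>a. x (\<sigma> i t a)) (\<lambda>a. \<alpha> t (x a)) < \<delta>" if t: "t \<in> F" for t
          proof -
            have tG: "t \<in> carrier G" using t F by auto
            let ?inv = "\<lambda>a. x (inv_into {1..d i} (\<sigma> i (inv t)) a)"
            have coord: "coord_dist p (d i) k (\<lambda>a. x (\<sigma> i t a)) (\<lambda>a. \<alpha> t (x a)) \<le> \<delta> / 2" if "k < M" for k
            proof -
              have "coord_dist p (d i) k (\<lambda>a. x (\<sigma> i t a)) ?inv < \<delta> / 4"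
                using elim(1) t tG by fastforce
              moreover have "inv t \<in> F'" "k < m'" using t that by (auto simp: F'_def m'_def)
              then have "coord_dist p (d i) k (\<lambda>a. \<alpha> (inv (inv t)) (x a)) ?inv < \<delta>'"
                using x unfolding Hom_maps_def coord_dist_def by blast
              then have "coord_dist p (d i) k ?inv (\<lambda>a. \<alpha> t (x a)) < \<delta> / 4"
                using tG coord_dist_sym[of p "d i" k ?inv "\<lambda>a. \<alpha> t (x a)"] by (simp add: \<delta>'_def)
              ultimately show ?thesis
                using coord_dist_triangle[of p "d i" k "\<lambda>a. x (\<sigma> i t a)" "\<lambda>a. \<alpha> t (x a)" ?inv] by linarith
            qed
            have "(\<Sum>k<M. (1/2) ^ Suc k * coord_dist p (d i) k (\<lambda>a. x (\<sigma> i t a)) (\<lambda>a. \<alpha> t (x a)))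
                \<le> (\<Sum>k<M. (1/2) ^ Suc k * (\<delta> / 2))"
              using coord by (intro sum_mono mult_left_mono) auto
            also have "\<dots> = (\<Sum>k<M. (1/2) ^ Suc k) * (\<delta> / 2)" by (rule sum_distrib_right[symmetric])
            also have "\<dots> \<le> 1 * (\<delta> / 2)" using \<delta> by (intro mult_right_mono dyadic_sum_le_one) auto
            finally show ?thesis
              using rho_2_seq_pm_tail[where p = p and d = "d i" and x = "\<lambda>a. x (\<sigma> i t a)"
                  and y = "\<lambda>a. \<alpha> t (x a)" and N = M, OF bound] M by linarith
          qed
          then show ?thesis using x moments unfolding Map_mu_def Hom_maps_def moment_error_def by blast
        qed
        then show ?case using sep by blast
      qed
      moreover have "F' \<in> {F. finite F \<and> F \<noteq> {} \<and> F \<subseteq> carrier G}" "m' \<in> {1..}" "\<delta>' \<in> {0<..}"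
        using F C \<delta> by (auto simp: F'_def m'_def \<delta>'_def)
      ultimately show "\<exists>F'\<in>{F. finite F \<and> F \<noteq> {} \<and> F \<subseteq> carrier G}. \<exists>m'\<in>{1..}. \<exists>\<delta>'\<in>{0<..}.
        \<forall>\<^sub>F i in sequentially.
          Hom_maps G \<alpha> \<mu> p F' m' \<delta>' (d i) (\<sigma> i) \<subseteq> Map_mu \<alpha> \<mu> (seq_pm p) F L \<delta> (d i) (\<sigma> i) \<and>
          (\<forall>x\<in>Hom_maps G \<alpha> \<mu> p F' m' \<delta>' (d i) (\<sigma> i). \<forall>y\<in>Hom_maps G \<alpha> \<mu> p F' m' \<delta>' (d i) (\<sigma> i).
            \<epsilon> \<le> seq_dist p (d i) x y \<longrightarrow> \<epsilon>' \<le> rho_2 (seq_pm p) (d i) x y)"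
        by (intro bexI)
    qed (rule \<epsilon>')
  qed
qed

lemma h_2_seq_pm_le_h_bar:
  assumes p: "dyn_generating_seq G \<alpha> p"
  shows "h_2 G \<alpha> \<mu> d \<sigma> (seq_pm p) \<le> h_bar G \<alpha> \<mu> d \<sigma> p"
proof -
  have bound: "cmod (p n x) \<le> 1" for n x using p by (simp add: dyn_generating_seq_def)
  have pC: "range p \<subseteq> CX" using p by (auto simp: dyn_generating_seq_def)
  show ?thesis
    unfolding h_bar_eq_Hom_maps[OF pC] h_2_def h_spatial_def
  proof (rule entropy_le)
    fix \<epsilon> :: real assume \<epsilon>: "0 < \<epsilon>"
    obtain N where N: "2 * (1/2) ^ N < \<epsilon> / 2" using dyadic_small[of "\<epsilon>/2"] \<epsilon> by auto
    have sep: "\<epsilon> / 2 \<le> seq_dist p n x y" if "\<epsilon> \<le> rho_2 (seq_pm p) n x y" for n x y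
      using that N rho_2_seq_pm_tail[where p = p and d = n and x = x and y = y and N = N, OF bound] seq_dist_partial[where p = p and d = n and x = x and y = y and N = N, OF bound] by linarith
    show "\<exists>\<epsilon>'>0. \<forall>F\<in>{F. finite F \<and> F \<noteq> {} \<and> F \<subseteq> carrier G}. \<forall>m\<in>{1..}. \<forall>\<delta>\<in>{0<..}.
      \<exists>F'\<in>{F. finite F \<and> F \<noteq> {} \<and> F \<subseteq> carrier G}. \<exists>L'\<in>{L. finite L \<and> L \<subseteq> CX}. \<exists>\<delta>'\<in>{0<..}.
      \<forall>\<^sub>F i in sequentially.
        Map_mu \<alpha> \<mu> (seq_pm p) F' L' \<delta>' (d i) (\<sigma> i) \<subseteq> Hom_maps G \<alpha> \<mu> p F m \<delta> (d i) (\<sigma> i) \<and>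
        (\<forall>x\<in>Map_mu \<alpha> \<mu> (seq_pm p) F' L' \<delta>' (d i) (\<sigma> i). \<forall>y\<in>Map_mu \<alpha> \<mu> (seq_pm p) F' L' \<delta>' (d i) (\<sigma> i).
          \<epsilon> \<le> rho_2 (seq_pm p) (d i) x y \<longrightarrow> \<epsilon>' \<le> seq_dist p (d i) x y)"
    proof (intro exI[of _ "\<epsilon> / 2"] conjI ballI)
      fix F and m :: nat and \<delta>
      assume "F \<in> {F. finite F \<and> F \<noteq> {} \<and> F \<subseteq> carrier G}" "m \<in> {1..}" "\<delta> \<in> {0::real<..}"
      then have F: "finite F" "F \<noteq> {}" "F \<subseteq> carrier G" and \<delta>: "0 < \<delta>" by auto
      define F' where "F' = m_inv G ` F"
      \<comment> \<open>The products themselves are the test functions. In \<delta>' the power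
        undoes the weight \<open>(1/2) ^ Suc n\<close> of a coordinate \<open>n < m\<close>; half of
        \<delta> is reserved for the inverse permutation.\<close>
      define L' where "L' = S_products G \<alpha> p F m"
      define \<delta>' where "\<delta>' = min \<delta> ((1/2) ^ m * (\<delta> / 2))"
      let ?Y = "\<lambda>i. Map_mu \<alpha> \<mu> (seq_pm p) F' L' \<delta>' (d i) (\<sigma> i)"
      have "\<forall>\<^sub>F i in sequentially. \<forall>s\<in>F. \<forall>x n.
        coord_dist p (d i) n (\<lambda>a. x (\<sigma> i (inv s) a)) (\<lambda>a. x (inv_into {1..d i} (\<sigma> i s) a)) < \<delta> / 2"
        using F \<delta> by (intro eventually_ball_finite ballI eventually_inverse_coord_small bound) auto
      then have "\<forall>\<^sub>F i in sequentially. ?Y i \<subseteq> Hom_maps G \<alpha> \<mu> p F m \<delta> (d i) (\<sigma> i) \<and>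
        (\<forall>x\<in>?Y i. \<forall>y\<in>?Y i. \<epsilon> \<le> rho_2 (seq_pm p) (d i) x y \<longrightarrow> \<epsilon> / 2 \<le> seq_dist p (d i) x y)"
      proof eventually_elim
        case (elim i)
        have "x \<in> Hom_maps G \<alpha> \<mu> p F m \<delta> (d i) (\<sigma> i)" if x: "x \<in> ?Y i" for x
        proof -
          have "coord_dist p (d i) n (\<lambda>a. \<alpha> (inv s) (x a)) (\<lambda>a. x (inv_into {1..d i} (\<sigma> i s) a)) < \<delta>"
            if s: "s \<in> F" and n: "n < m" for s n
          proof -
            have "(1/2) ^ Suc n * coord_dist p (d i) n (\<lambda>a. x (\<sigma> i (inv s) a)) (\<lambda>a. \<alpha> (inv s) (x a)) < \<delta>'"
              using coord_dist_le_rho_2[where p = p and k = n and d = "d i"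
                  and x = "\<lambda>a. x (\<sigma> i (inv s) a)" and y = "\<lambda>a. \<alpha> (inv s) (x a)", OF bound]
                x s unfolding Map_mu_def F'_def by fastforce
            also have "\<delta>' \<le> (1/2) ^ m * (\<delta> / 2)" by (simp add: \<delta>'_def)
            also have "\<dots> \<le> (1/2) ^ Suc n * (\<delta> / 2)"
              using \<delta> n by (intro mult_right_mono power_decreasing) auto
            finally have "coord_dist p (d i) n (\<lambda>a. x (\<sigma> i (inv s) a)) (\<lambda>a. \<alpha> (inv s) (x a)) < \<delta> / 2"
              by (simp only: mult_less_cancel_left_pos zero_less_power zero_less_divide_1_iff zero_less_numeral)
            moreover have "coord_dist p (d i) n (\<lambda>a. x (\<sigma> i (inv s) a)) (\<lambda>a. x (inv_into {1..d i} (\<sigma> i s) a)) < \<delta> / 2"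
              using elim s by blast
            ultimately show ?thesis
              using coord_dist_triangle[of p "d i" n "\<lambda>a. \<alpha> (inv s) (x a)"
                  "\<lambda>a. x (inv_into {1..d i} (\<sigma> i s) a)" "\<lambda>a. x (\<sigma> i (inv s) a)"]
                coord_dist_sym[of p "d i" n "\<lambda>a. \<alpha> (inv s) (x a)" "\<lambda>a. x (\<sigma> i (inv s) a)"]
              by linarith
          qed
          moreover have "cmod ((\<Sum>a\<in>{1..d i}. f (x a)) / of_nat (d i) - (\<integral>x. f x \<partial>\<mu>)) < \<delta>"
            if "f \<in> S_products G \<alpha> p F m" for f
          proof -
            have "cmod ((\<Sum>a\<in>{1..d i}. f (x a)) / of_nat (d i) - (\<integral>x. f x \<partial>\<mu>)) < \<delta>'"
              using x that unfolding Map_mu_def L'_def by blast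
            then show ?thesis by (simp add: \<delta>'_def)
          qed
          moreover have "x \<in> {1..d i} \<rightarrow>\<^sub>E UNIV" using x unfolding Map_mu_def by blast
          ultimately show ?thesis unfolding Hom_maps_def coord_dist_def by blast
        qed
        then show ?case using sep by blast
      qed
      moreover have "F' \<in> {F. finite F \<and> F \<noteq> {} \<and> F \<subseteq> carrier G}" "L' \<in> {L. finite L \<and> L \<subseteq> CX}" "\<delta>' \<in> {0<..}"
        using F \<delta> S_products_CX[OF F(3) pC, of m] finite_S_products[OF F(1), of G \<alpha> p m]
        by (auto simp: F'_def L'_def \<delta>'_def)
      ultimately show "\<exists>F'\<in>{F. finite F \<and> F \<noteq> {} \<and> F \<subseteq> carrier G}. \<exists>L'\<in>{L. finite L \<and> L \<subseteq> CX}. \<exists>\<delta>'\<in>{0<..}.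
        \<forall>\<^sub>F i in sequentially.
          Map_mu \<alpha> \<mu> (seq_pm p) F' L' \<delta>' (d i) (\<sigma> i) \<subseteq> Hom_maps G \<alpha> \<mu> p F m \<delta> (d i) (\<sigma> i) \<and>
          (\<forall>x\<in>Map_mu \<alpha> \<mu> (seq_pm p) F' L' \<delta>' (d i) (\<sigma> i). \<forall>y\<in>Map_mu \<alpha> \<mu> (seq_pm p) F' L' \<delta>' (d i) (\<sigma> i).
            \<epsilon> \<le> rho_2 (seq_pm p) (d i) x y \<longrightarrow> \<epsilon> / 2 \<le> seq_dist p (d i) x y)"
        by (intro bexI)
    qed (use \<epsilon> in simp)
  qed
qed

section \<open>Existence of generating sequences\<close>

text \<open>Without a generating sequence every value would meet the defining condition of the
  entropy. Distances to a \<rho>-dense sequence of points generate, because their translates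
  separate points and the Stone-Weierstrass theorem applies.\<close>

lemma dyn_generating_seq_exists:
  assumes \<rho>: "continuous_pseudometric \<rho>" and gen: "dyn_generating_pseudometric G \<alpha> \<rho>"
  shows "\<exists>p. dyn_generating_seq G \<alpha> p"
proof -
  obtain D where D: "0 \<le> D" "\<And>x y. \<rho> x y \<le> D" using pm_bounded[OF \<rho> compact_X] by blast
  have "\<exists>Q. finite Q \<and> (\<forall>x. \<exists>q\<in>Q. \<rho> q x < 1 / (real k + 1))" for k
    by (rule pm_finite_net[OF \<rho> compact_X, of "1 / (real k + 1)"]) (simp, blast)
  then obtain Q where Q: "\<And>k. finite (Q k)" "\<And>k x. \<exists>q\<in>Q k. \<rho> q x < 1 / (real k + 1)" by metis
  \<comment> \<open>Density refers to \<rho>, which need not induce the topology.\<close>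
  define q where "q = from_nat_into (\<Union>k. Q k)"
  have dense: "\<exists>n. \<rho> (q n) x < e" if e: "0 < e" for x e
  proof -
    obtain k where k: "1 / (real k + 1) < e"
      using reals_Archimedean[OF e] by (auto simp: inverse_eq_divide add.commute)
    obtain y where y: "y \<in> Q k" "\<rho> y x < 1 / (real k + 1)" using Q(2) by blast
    have "y \<in> range q"
      unfolding q_def using y(1) Q(1)
      by (subst range_from_nat_into) (auto intro: countable_finite)
    then obtain n where "q n = y" by blast
    then show ?thesis using y(2) k by (intro exI[of _ n]) simp
  qed
  \<comment> \<open>Normalised to values in [0, 1], also when \<open>D = 0\<close>.\<close>
  define r where "r n x = \<rho> (q n) x / (D + 1)" for n x
  define p where "p n x = complex_of_real (r n x)" for n x
  have r: "0 \<le> r n x" "r n x \<le> 1" for n x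
    using D(1) D(2)[of "q n" x] pm_nonneg[OF \<rho>, of "q n" x] by (auto simp: r_def)
  have "continuous_on UNIV (r n)" for n
    unfolding r_def using D(1) by (auto intro!: continuous_intros pm_continuous_on[OF \<rho>])
  then have pC: "p n \<in> CX" for n
    unfolding CX_def p_def by (auto intro!: continuous_intros)
  have "A = CX" if A: "invariant_unital_subalgebra G \<alpha> A" "range p \<subseteq> A" for A
  proof
    have A': "A \<subseteq> CX" "(\<lambda>x. 1) \<in> A" "\<And>f c. f \<in> A \<Longrightarrow> (\<lambda>x. c * f x) \<in> A"
      "\<And>f g. f \<in> A \<Longrightarrow> g \<in> A \<Longrightarrow> (\<lambda>x. f x + g x) \<in> A"
      "\<And>f g. f \<in> A \<Longrightarrow> g \<in> A \<Longrightarrow> (\<lambda>x. f x * g x) \<in> A"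
      "\<And>u f. (\<And>n. u n \<in> A) \<Longrightarrow> uniform_limit UNIV u f sequentially \<Longrightarrow> f \<in> A"
      "\<And>s f. s \<in> carrier G \<Longrightarrow> f \<in> A \<Longrightarrow> induced G \<alpha> s f \<in> A"
      using A(1) unfolding invariant_unital_subalgebra_def by blast+
    show AC: "A \<subseteq> CX" by (rule A'(1))
    \<comment> \<open>Stone-Weierstrass is used for real functions; real and imaginary parts are
      reassembled afterwards.\<close>
    define R where "R = {f :: 'x \<Rightarrow> real. (\<lambda>x. complex_of_real (f x)) \<in> A}"
    interpret function_ring_on R "UNIV :: 'x set"
    proof
      show "compact (UNIV :: 'x set)" by (rule compact_X)
    next
      fix f assume "f \<in> R"
      then have "continuous_on UNIV (\<lambda>x. Re (complex_of_real (f x)))"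
        using AC unfolding R_def CX_def by (intro continuous_intros) auto
      then show "continuous_on UNIV f" by simp
    next
      fix f g assume fg: "f \<in> R" "g \<in> R"
      then have "(\<lambda>x. complex_of_real (f x) + complex_of_real (g x)) \<in> A"
        "(\<lambda>x. complex_of_real (f x) * complex_of_real (g x)) \<in> A"
        unfolding R_def by (simp_all only: mem_Collect_eq A'(4,5))
      then show "(\<lambda>x. f x + g x) \<in> R" "(\<lambda>x. f x * g x) \<in> R" by (simp_all add: R_def)
    next
      fix c :: real
      have "(\<lambda>x. complex_of_real c * 1) \<in> A" by (intro A'(2,3))
      then show "(\<lambda>_. c) \<in> R" by (simp add: R_def)
    next
      fix x y :: 'x assume "x \<noteq> y"
      then obtain s where s: "s \<in> carrier G" "0 < \<rho> (\<alpha> s x) (\<alpha> s y)"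
        using gen unfolding dyn_generating_pseudometric_def by blast
      \<comment> \<open>Less than half the distance away from \<open>\<alpha> s x\<close>, the point
        \<open>q n\<close> is more than half away from \<open>\<alpha> s y\<close>.\<close>
      obtain n where n: "\<rho> (q n) (\<alpha> s x) < \<rho> (\<alpha> s x) (\<alpha> s y) / 2"
        using dense[of "\<rho> (\<alpha> s x) (\<alpha> s y) / 2"] s(2) by auto
      have ne: "\<rho> (q n) (\<alpha> s x) \<noteq> \<rho> (q n) (\<alpha> s y)"
        using n pm_triangle[OF \<rho>, of "\<alpha> s x" "\<alpha> s y" "q n"] pm_sym[OF \<rho>, of "q n" "\<alpha> s x"] by linarith
      \<comment> \<open>The action on functions inverts, so \<open>inv s\<close> yields evaluation
        at \<open>\<alpha> s x\<close>.\<close>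
      have "induced G \<alpha> (inv s) (p n) \<in> A" using A(2) s(1) by (intro A'(7)) auto
      then have "(\<lambda>x. r n (\<alpha> s x)) \<in> R" using s(1) by (simp add: R_def induced_def p_def)
      moreover have "r n (\<alpha> s x) \<noteq> r n (\<alpha> s y)" using ne D(1) by (simp add: r_def)
      ultimately show "\<exists>f\<in>R. f x \<noteq> f y" by (intro bexI[of _ "\<lambda>x. r n (\<alpha> s x)"])
    qed
    have real_A: "(\<lambda>x. complex_of_real (f x)) \<in> A" if f: "continuous_on UNIV f" for f
    proof -
      obtain u where u: "u \<in> UNIV \<rightarrow> R" "uniform_limit UNIV u f sequentially"
        using Stone_Weierstrass[OF f] by blast
      have "uniform_limit UNIV (\<lambda>n x. complex_of_real (u n x)) (\<lambda>x. complex_of_real (f x)) sequentially"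
        using u(2) unfolding uniform_limit_iff dist_norm of_real_diff[symmetric] norm_of_real real_norm_def .
      moreover have "(\<lambda>x. complex_of_real (u n x)) \<in> A" for n using u(1) by (auto simp: R_def)
      ultimately show ?thesis by (rule A'(6)[of "\<lambda>n x. complex_of_real (u n x)", rotated])
    qed
    show "CX \<subseteq> A"
    proof
      fix f :: "'x \<Rightarrow> complex" assume "f \<in> CX"
      then have "continuous_on UNIV (\<lambda>x. Re (f x))" "continuous_on UNIV (\<lambda>x. Im (f x))"
        by (auto simp: CX_def intro!: continuous_intros)
      then have "(\<lambda>x. complex_of_real (Re (f x)) + \<i> * complex_of_real (Im (f x))) \<in> A"
        by (rule A'(4)[OF real_A A'(3)[OF real_A]])
      then show "f \<in> A" by (simp flip: complex_eq)
    qed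
  qed
  then have "dyn_generating_seq G \<alpha> p"
    using pC r unfolding dyn_generating_seq_def by (auto simp: p_def)
  then show ?thesis by blast
qed

text \<open>The right side does not mention \<open>p\<close>, so independence of the generating
  sequence comes out as well.\<close>

lemma h_bar_eq_h_2:
  assumes \<rho>: "continuous_pseudometric \<rho>" and gen: "dyn_generating_pseudometric G \<alpha> \<rho>"
    and p: "dyn_generating_seq G \<alpha> p"
  shows "h_bar G \<alpha> \<mu> d \<sigma> p = h_2 G \<alpha> \<mu> d \<sigma> \<rho>"
proof -
  have "continuous_pseudometric (seq_pm p)"
    using p by (intro continuous_pseudometric_seq_pm) (auto simp: dyn_generating_seq_def)
  note pm = this dyn_generating_seq_pm[OF \<rho> gen p]
  have "h_2 G \<alpha> \<mu> d \<sigma> (seq_pm p) = h_2 G \<alpha> \<mu> d \<sigma> \<rho>"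
    by (intro antisym h_2_le_of_generating \<rho> gen pm)
  then show ?thesis
    using h_bar_le_h_2_seq_pm[OF p] h_2_seq_pm_le_h_bar[OF p] by simp
qed

end

theorem proposition3p4:
  fixes G :: "('g, 'r) monoid_scheme"
    and d :: "nat \<Rightarrow> nat" and \<sigma> :: "nat \<Rightarrow> 'g \<Rightarrow> nat \<Rightarrow> nat"
    and \<alpha> :: "'g \<Rightarrow> 'x \<Rightarrow> 'x::t2_space" and \<mu> :: "'x measure"
    and \<rho> :: "'x \<Rightarrow> 'x \<Rightarrow> real"
  assumes "group G" and "countable (carrier G)"
    and "sofic_approx G d \<sigma>"
    and "compact (UNIV :: 'x set)" and "metrizable_space (euclidean :: 'x topology)"
    and "continuous_action G \<alpha>"
    and "invariant_borel_prob G \<alpha> \<mu>"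
    and "continuous_pseudometric \<rho>"
    and "dyn_generating_pseudometric G \<alpha> \<rho>"
  shows "sofic_measure_entropy G \<alpha> \<mu> d \<sigma> = h_2 G \<alpha> \<mu> d \<sigma> \<rho>
       \<and> h_2 G \<alpha> \<mu> d \<sigma> \<rho> = h_inf G \<alpha> \<mu> d \<sigma> \<rho>"
proof
  interpret sofic_pmp_action G d \<sigma> \<alpha> \<mu>
    using assms by (intro sofic_pmp_action.intro sofic_pmp_action_axioms.intro)
  note \<rho> = assms(8,9)
  \<comment> \<open>Equality for every sequence shows that the 2-entropy qualifies as the common
    value; existence of a sequence makes it the only one.\<close>
  show "sofic_measure_entropy G \<alpha> \<mu> d \<sigma> = h_2 G \<alpha> \<mu> d \<sigma> \<rho>"
    unfolding sofic_measure_entropy_def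
    using dyn_generating_seq_exists[OF \<rho>] h_bar_eq_h_2[OF \<rho>] by (intro the_equality) metis+
  show "h_2 G \<alpha> \<mu> d \<sigma> \<rho> = h_inf G \<alpha> \<mu> d \<sigma> \<rho>"
    by (intro antisym h_2_le_h_inf h_inf_le_h_2 \<rho>(1) compact_X degrees_at_top)
qed

end
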